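(* Let $n\ge 3$ and let $G$ be a connected weighted graph on $[n]$. Then the following holds. (a) Suppose $n=4$ and $G$ is the $4$-cycle with uniform edge weights (the support graph is a $4$-cycle and its four edges all have the same weight $c>0$). Then $$\lambda_{\min}(L_G,S^{(2,2)})=\lambda_{\min}(L_G,S^{(3,1)}).$$ The multiplicity of $\lambda_{\min}(L_G,S^{(2,2)})$ as an eigenvalue of $L_G|_{S^{(2,2)}}$ is $1$, and the multiplicity of $\lambda_{\min}(L_G,S^{(3,1)})$ as an eigenvalue of $L_G|_{S^{(3,1)}}$ is $2$. For every $\mu\vdash 4$ with $\mu\notin\{(4),(3,1),(2,2)\}$, $$\lambda_{\min}(L_G,S^\mu)>\lambda_{\min}(L_G,S^{(3,1)}).$$ (b) If $G$ is any other connected weighted graph (i.e. $G$ is not a $4$-cycle with uniform edge weights), then for all $\mu\vdash n$ with $\mu\ne (n),(n-1,1)$, $$\lambda_{\min}(L_G,S^\mu)>\lambda_{\min}(L_G,S^{(n-1,1)}).$$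
   Context: $[n]=\{1,\dots,n\}$ and $\mathfrak S_n$ is the symmetric group on $[n]$. A weighted graph $G$ on $[n]$ is given by real weights $c_{ij}=c_{ji}\ge 0$ for $i\ne j$, with $c_{ii}=0$; its support graph has edge set $E=\{ij: i<j,\ c_{ij}>0\}$, and graph-theoretic terms (connected, cycle, degree, ...) refer to the support graph. The interchange operator of $G$ is $$L_G=\sum_{1\le i<j\le n}c_{ij}(\mathrm{Id}-(i,j)),$$ where $(i,j)$ is a transposition; it acts on every real left $\mathfrak S_n$-module. For a partition $\mu\vdash n$, $S^\mu$ is the real Specht module of shape $\mu$ (irreducible; $S^{(n)}$ is trivial and $S^{(n-1,1)}$ is the standard representation on mean-zero vectors of $\mathbb R^n$). $L_G$ acts on $S^\mu$ as a symmetric positive semidefinite operator with respect to any $\mathfrak S_n$-invariant inner product, denoted $L_G|_{S^\mu}$, and $\lambda_{\min}(L_G,S^\mu)$ denotes its smallest eigenvalue. *)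

theory Defs
  imports
    "HOL-Analysis.Analysis"
    "HOL-Analysis.Finite_Function_Topology"
    "HOL-Combinatorics.Permutations"
begin

section \<open>Weighted graphs on \<open>{1..n}\<close>\<close>

text \<open>The values of \<open>c\<close> outside \<open>{1..n} \<times> {1..n}\<close> are never inspected.\<close>

definition weighted_graph :: "nat \<Rightarrow> (nat \<Rightarrow> nat \<Rightarrow> real) \<Rightarrow> bool" where
  "weighted_graph n c \<longleftrightarrow>
     (\<forall>i\<in>{1..n}. \<forall>j\<in>{1..n}. c i j = c j i \<and> 0 \<le> c i j) \<and> (\<forall>i\<in>{1..n}. c i i = 0)"

definition support_edges :: "nat \<Rightarrow> (nat \<Rightarrow> nat \<Rightarrow> real) \<Rightarrow> nat set set" where
  "support_edges n c = {{i, j} | i j. 1 \<le> i \<and> i < j \<and> j \<le> n \<and> c i j > 0}"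

definition connected_support :: "nat \<Rightarrow> (nat \<Rightarrow> nat \<Rightarrow> real) \<Rightarrow> bool" where
  "connected_support n c \<longleftrightarrow>
     (\<forall>i\<in>{1..n}. \<forall>j\<in>{1..n}. (i, j) \<in> {(u, v). {u, v} \<in> support_edges n c}\<^sup>*)"

text \<open>The support graph is a single cycle through all of \<open>{1..n}\<close> (meaningful for \<open>n \<ge> 3\<close>),
  and all its edges carry the same weight \<open>w\<close>; \<open>vs\<close> lists the vertices in cyclic order.\<close>

definition uniform_cycle :: "nat \<Rightarrow> (nat \<Rightarrow> nat \<Rightarrow> real) \<Rightarrow> bool" where
  "uniform_cycle n c \<longleftrightarrow>
     (\<exists>vs. distinct vs \<and> set vs = {1..n} \<and>
           support_edges n c = {{vs ! k, vs ! (Suc k mod n)} | k. k < n}) \<and>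
     (\<exists>w>0. \<forall>i\<in>{1..n}. \<forall>j\<in>{1..n}. {i, j} \<in> support_edges n c \<longrightarrow> c i j = w)"


section \<open>Real Specht modules\<close>

definition is_partition :: "nat list \<Rightarrow> nat \<Rightarrow> bool" (infix \<open>\<turnstile>\<close> 50) where
  "\<mu> \<turnstile> n \<longleftrightarrow> sorted_wrt (\<ge>) \<mu> \<and> 0 \<notin> set \<mu> \<and> sum_list \<mu> = n"

text \<open>Cells are (row, column), both counted from 0; tableau entries are \<open>1, \<dots>, n\<close>.\<close>

definition young_diagram :: "nat list \<Rightarrow> (nat \<times> nat) set" where
  "young_diagram \<mu> = {(i, j). i < length \<mu> \<and> j < \<mu> ! i}"

definition is_tableau :: "nat list \<Rightarrow> (nat \<times> nat \<Rightarrow> nat) \<Rightarrow> bool" where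
  "is_tableau \<mu> t \<longleftrightarrow> bij_betw t (young_diagram \<mu>) {1..sum_list \<mu>}"

text \<open>The row-equivalence class of a tableau, encoded as the list of the sets of entries of its
  rows.\<close>

type_synonym tabloid = "nat set list"

definition tabloid_of :: "nat list \<Rightarrow> (nat \<times> nat \<Rightarrow> nat) \<Rightarrow> tabloid" where
  "tabloid_of \<mu> t = map (\<lambda>i. {t (i, j) | j. j < \<mu> ! i}) [0..<length \<mu>]"

text \<open>The left action of permutations on formal real linear combinations of tabloids: the linear
  extension of the entrywise action on tabloids.\<close>

definition perm_act :: "(nat \<Rightarrow> nat) \<Rightarrow> (tabloid \<Rightarrow>\<^sub>0 real) \<Rightarrow> (tabloid \<Rightarrow>\<^sub>0 real)" where
  "perm_act \<sigma> f =
     (\<Sum>T\<in>Poly_Mapping.keys f. Poly_Mapping.single (map ((`) \<sigma>) T) (Poly_Mapping.lookup f T))"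

definition column_stabilizer :: "nat list \<Rightarrow> (nat \<times> nat \<Rightarrow> nat) \<Rightarrow> (nat \<Rightarrow> nat) set" where
  "column_stabilizer \<mu> t =
     {\<pi>. \<pi> permutes {1..sum_list \<mu>} \<and>
         (\<forall>j. let col = {t (i, j) | i. (i, j) \<in> young_diagram \<mu>} in \<pi> ` col = col)}"

definition polytabloid :: "nat list \<Rightarrow> (nat \<times> nat \<Rightarrow> nat) \<Rightarrow> (tabloid \<Rightarrow>\<^sub>0 real)" where
  "polytabloid \<mu> t =
     (\<Sum>\<pi>\<in>column_stabilizer \<mu> t.
        of_int (sign \<pi>) *\<^sub>R perm_act \<pi> (Poly_Mapping.single (tabloid_of \<mu> t) 1))"

definition specht :: "nat list \<Rightarrow> (tabloid \<Rightarrow>\<^sub>0 real) set" where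
  "specht \<mu> = span {polytabloid \<mu> t | t. is_tableau \<mu> t}"


section \<open>The interchange operator and its spectrum\<close>

definition interchange ::
    "((nat \<Rightarrow> nat) \<Rightarrow> 'v \<Rightarrow> 'v) \<Rightarrow> nat \<Rightarrow> (nat \<Rightarrow> nat \<Rightarrow> real) \<Rightarrow> 'v \<Rightarrow> 'v::real_vector" where
  "interchange act n c v =
     (\<Sum>j\<in>{1..n}. \<Sum>i\<in>{1..<j}. c i j *\<^sub>R (v - act (Transposition.transpose i j) v))"

text \<open>Below, \<open>V\<close> is meant to be a finite-dimensional subspace invariant under \<open>A\<close>
  on which \<open>A\<close> is linear and symmetric for some inner product. Hence the set of eigenvalues is
  finite, it is nonempty if \<open>V \<noteq> {0}\<close>, and geometric and algebraic multiplicity coincide.\<close>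

definition eigenspace_on :: "('v \<Rightarrow> 'v) \<Rightarrow> 'v::real_vector set \<Rightarrow> real \<Rightarrow> 'v set" where
  "eigenspace_on A V l = {v \<in> V. A v = l *\<^sub>R v}"

definition eigenvalues_on :: "('v \<Rightarrow> 'v) \<Rightarrow> 'v::real_vector set \<Rightarrow> real set" where
  "eigenvalues_on A V = {l. \<exists>v\<in>eigenspace_on A V l. v \<noteq> 0}"

definition eig_mult :: "('v \<Rightarrow> 'v) \<Rightarrow> 'v::real_vector set \<Rightarrow> real \<Rightarrow> nat" where
  "eig_mult A V l = dim (eigenspace_on A V l)"

definition lambda_min :: "nat \<Rightarrow> (nat \<Rightarrow> nat \<Rightarrow> real) \<Rightarrow> nat list \<Rightarrow> real" where
  "lambda_min n c \<mu> = Min (eigenvalues_on (interchange perm_act n c) (specht \<mu>))"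

definition lambda_mult :: "nat \<Rightarrow> (nat \<Rightarrow> nat \<Rightarrow> real) \<Rightarrow> nat list \<Rightarrow> nat" where
  "lambda_mult n c \<mu> =
     eig_mult (interchange perm_act n c) (specht \<mu>) (lambda_min n c \<mu>)"


section \<open>Specht modules are invariant under the interchange operator\<close>

lemma lookup_scaleR:
  "Poly_Mapping.lookup (r *\<^sub>R f) x = r *\<^sub>R Poly_Mapping.lookup f x"
proof -
  have "finite {x. r *\<^sub>R Poly_Mapping.lookup f x \<noteq> 0}"
    by (rule finite_subset[OF _ finite_lookup[of f]]) auto
  then show ?thesis
    by (simp add: scaleR_poly_mapping_def lookup_Abs_poly_mapping)
qed

lemma perm_act_superset:
  assumes "finite A" "Poly_Mapping.keys f \<subseteq> A"
  shows "perm_act \<sigma> f =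
    (\<Sum>T\<in>A. Poly_Mapping.single (map ((`) \<sigma>) T) (Poly_Mapping.lookup f T))"
  unfolding perm_act_def using assms
  by (intro sum.mono_neutral_left) (auto simp: in_keys_iff)

lemma linear_perm_act: "linear (perm_act \<sigma>)"
proof (rule linearI)
  fix f g :: "tabloid \<Rightarrow>\<^sub>0 real" and r :: real
  let ?A = "Poly_Mapping.keys f \<union> Poly_Mapping.keys g"
  have "finite ?A" by simp
  then show "perm_act \<sigma> (f + g) = perm_act \<sigma> f + perm_act \<sigma> g"
    using Poly_Mapping.keys_add[of f g]
    by (simp add: perm_act_superset[of ?A] lookup_add single_add sum.distrib)
  have "Poly_Mapping.keys (r *\<^sub>R f) \<subseteq> Poly_Mapping.keys f"
    by (auto simp: in_keys_iff lookup_scaleR)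
  moreover have "Poly_Mapping.single S (r * a) = r *\<^sub>R Poly_Mapping.single S a"
    for S :: tabloid and a :: real
    by (rule poly_mapping_eqI) (simp add: lookup_single lookup_scaleR when_def)
  ultimately show "perm_act \<sigma> (r *\<^sub>R f) = r *\<^sub>R perm_act \<sigma> f"
    by (simp add: perm_act_superset[of "Poly_Mapping.keys f"] scaleR_sum_right lookup_scaleR)
qed

lemma perm_act_single:
  "perm_act \<sigma> (Poly_Mapping.single T a) = Poly_Mapping.single (map ((`) \<sigma>) T) a"
  by (simp add: perm_act_superset[of "{T}"])

lemma map_tabloid_of: "map ((`) \<sigma>) (tabloid_of \<mu> t) = tabloid_of \<mu> (\<sigma> \<circ> t)"
  by (auto simp: tabloid_of_def)

lemma perm_act_polytabloid:
  assumes "\<sigma> permutes {1..sum_list \<mu>}"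
  shows "perm_act \<sigma> (polytabloid \<mu> t) = polytabloid \<mu> (\<sigma> \<circ> t)"
proof -
  let ?n = "{1..sum_list \<mu>}"
  have inv: "inv \<sigma> permutes ?n" "\<sigma> \<circ> inv \<sigma> = id" "inv \<sigma> \<circ> \<sigma> = id"
    using assms by (auto simp: permutes_inv permutes_inv_o)
  have perm: "permutation \<pi>" if "\<pi> permutes ?n" for \<pi>
    using that permutation_permutes by blast
  have sgn: "sign \<pi> = sign (inv \<sigma> \<circ> \<pi> \<circ> \<sigma>)" if "\<pi> permutes ?n" for \<pi>
    using perm[OF assms] perm[OF that]
    by (simp add: sign_compose permutation_compose permutation_inverse sign_inverse algebra_simps)
  have cols: "{\<sigma> (t (i, j)) |i. (i, j) \<in> young_diagram \<mu>} = \<sigma> ` {t (i, j) | i. (i, j) \<in> young_diagram \<mu>}" for j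
    by auto
  have "polytabloid \<mu> (\<sigma> \<circ> t) = (\<Sum>\<pi>\<in>column_stabilizer \<mu> t.
      of_int (sign \<pi>) *\<^sub>R perm_act \<sigma> (perm_act \<pi> (Poly_Mapping.single (tabloid_of \<mu> t) 1)))"
    unfolding polytabloid_def
  proof (rule sum.reindex_bij_witness[of _ "\<lambda>\<pi>. \<sigma> \<circ> \<pi> \<circ> inv \<sigma>" "\<lambda>\<pi>. inv \<sigma> \<circ> \<pi> \<circ> \<sigma>"])
    fix \<pi> assume \<pi>: "\<pi> \<in> column_stabilizer \<mu> (\<sigma> \<circ> t)"
    show "\<sigma> \<circ> (inv \<sigma> \<circ> \<pi> \<circ> \<sigma>) \<circ> inv \<sigma> = \<pi>"
      by (metis inv(2) comp_assoc comp_id id_comp)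
    have "(inv \<sigma> \<circ> \<pi> \<circ> \<sigma>) ` C = C" if "\<pi> ` \<sigma> ` C = \<sigma> ` C" for C
    proof -
      have "(inv \<sigma> \<circ> \<pi> \<circ> \<sigma>) ` C = inv \<sigma> ` \<pi> ` \<sigma> ` C"
        by (simp only: image_comp comp_assoc)
      also have "\<dots> = (inv \<sigma> \<circ> \<sigma>) ` C"
        by (subst that) (rule image_comp)
      finally show ?thesis
        by (simp only: inv image_id id_apply)
    qed
    then show "inv \<sigma> \<circ> \<pi> \<circ> \<sigma> \<in> column_stabilizer \<mu> t"
      using \<pi> inv(1) assms unfolding column_stabilizer_def Let_def
      by (auto simp only: cols o_apply mem_Collect_eq intro!: permutes_compose)
    have "\<sigma> \<circ> (inv \<sigma> \<circ> \<pi> \<circ> \<sigma>) = \<pi> \<circ> \<sigma>"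
      by (metis inv(2) comp_assoc id_comp)
    then show "real_of_int (sign (inv \<sigma> \<circ> \<pi> \<circ> \<sigma>)) *\<^sub>R perm_act \<sigma> (perm_act (inv \<sigma> \<circ> \<pi> \<circ> \<sigma>) (Poly_Mapping.single (tabloid_of \<mu> t) 1)) =
      real_of_int (sign \<pi>) *\<^sub>R perm_act \<pi> (Poly_Mapping.single (tabloid_of \<mu> (\<sigma> \<circ> t)) 1)"
      using \<pi> sgn[of \<pi>] by (simp add: perm_act_single map_tabloid_of column_stabilizer_def flip: comp_assoc)
  next
    fix \<pi> assume \<pi>: "\<pi> \<in> column_stabilizer \<mu> t"
    show "inv \<sigma> \<circ> (\<sigma> \<circ> \<pi> \<circ> inv \<sigma>) \<circ> \<sigma> = \<pi>"
      by (metis inv(3) comp_assoc comp_id id_comp)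
    have "(\<sigma> \<circ> \<pi> \<circ> inv \<sigma>) ` \<sigma> ` C = \<sigma> ` C" if "\<pi> ` C = C" for C
    proof -
      have "(\<sigma> \<circ> \<pi> \<circ> inv \<sigma>) ` \<sigma> ` C = \<sigma> ` \<pi> ` (inv \<sigma> \<circ> \<sigma>) ` C"
        by (simp only: image_comp comp_assoc)
      then show ?thesis
        by (simp only: inv image_id id_apply that)
    qed
    then show "\<sigma> \<circ> \<pi> \<circ> inv \<sigma> \<in> column_stabilizer \<mu> (\<sigma> \<circ> t)"
      using \<pi> inv(1) assms unfolding column_stabilizer_def Let_def
      by (auto simp only: cols o_apply mem_Collect_eq intro!: permutes_compose)
  qed
  also have "\<dots> = perm_act \<sigma> (polytabloid \<mu> t)"
    by (simp add: polytabloid_def linear_sum[OF linear_perm_act] linear_cmul[OF linear_perm_act])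
  finally show ?thesis ..
qed

lemma perm_act_specht:
  assumes "\<sigma> permutes {1..sum_list \<mu>}" "v \<in> specht \<mu>"
  shows "perm_act \<sigma> v \<in> specht \<mu>"
proof -
  have "is_tableau \<mu> (\<sigma> \<circ> t)" if "is_tableau \<mu> t" for t
    using that permutes_imp_bij[OF assms(1)] unfolding is_tableau_def by (rule bij_betw_trans)
  then have "perm_act \<sigma> ` {polytabloid \<mu> t | t. is_tableau \<mu> t}
      \<subseteq> {polytabloid \<mu> t | t. is_tableau \<mu> t}"
    using perm_act_polytabloid[OF assms(1)] by blast
  then show ?thesis
    using assms(2) linear_span_image[OF linear_perm_act] span_mono unfolding specht_def
    by blast
qed

lemma interchange_specht:
  assumes "sum_list \<mu> = n" "v \<in> specht \<mu>"
  shows "interchange perm_act n c v \<in> specht \<mu>"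
proof -
  have "perm_act (Transposition.transpose i j) v \<in> specht \<mu>" if "j \<in> {1..n}" "i \<in> {1..<j}" for i j
    using that assms by (intro perm_act_specht permutes_swap_id) auto
  then show ?thesis
    using assms(2) unfolding interchange_def specht_def
    by (intro span_sum span_scale span_diff) simp_all
qed

end

theory Submission
  imports Defs
begin

text \<open>The spectral gap inequality follows the strategy of Caputo, Liggett and Richthammer: removing a
  vertex and replacing the network by its reduction (Schur complement) does not decrease the gap of
  the Laplacian, and by the octopus inequality it does not increase the interchange operator.  A
  minimal eigenvector either has a nonzero average over the stabilizer of some point, and then yields
  an eigenfunction of the Laplacian, or induction applies to all reductions.

  In the case of equality, an eigenvector for the gap \<open>g\<close> whose averages over all point stabilizers
  vanish is paired with a fixed vector to give functions \<open>F\<close> of ordered pairs of points. Equality in the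
  octopus inequality at every vertex makes each row and column of \<open>F\<close> an eigenvector of the Laplacian,
  and comparison with the eigenvalue equation on pairs gives \<open>g F a b = c a b (F a b + F b a)\<close>. So
  \<open>F\<close> is symmetric and supported on edges of weight \<open>g / 2\<close>; looking at a maximal entry, one finds
  that \<open>F\<close> vanishes or the graph is a uniform four-cycle. If all \<open>F\<close> vanish, induction applies.

  For a Specht module, the absence of vectors fixed by a Young subgroup is seen from the fact that
  polytabloids are alternating in the entries of each column.\<close>

section \<open>Symmetric operators on inner product spaces\<close>

text \<open>The spectral part never mentions Specht modules: it takes place in any orthogonal action
  of permutations, and the shape enters only through the vanishing of sums over subgroups such as
  the stabilizer of a point. Keeping one action while vertices are deleted lets both inductions
  change the graph inside a fixed space.

  The obstacle in the strict inequality is that the exception may reappear: a reduction of a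
  five-vertex graph could be a uniform square, and the induction would break off. Row sums show that
  some vertex avoids this.

  The exception belongs to shape (2,2) because, on four points, symmetric functions F with zero
  diagonal and zero row sums form exactly that module. A shape with at least three rows has no
  nonzero vector fixed by all permutations preserving a pair, so it stays strict on the square.

  The octopus inequality rests on idempotents in the group algebras of the alternating groups on
  four and five points; they are even because the square of a sum of transpositions is.\<close>

locale ip_space =
  fixes ip :: "'v::real_vector \<Rightarrow> 'v \<Rightarrow> real"
  assumes ip_add_left: "ip (u + v) w = ip u w + ip v w"
    and ip_scale_left: "ip (r *\<^sub>R u) w = r * ip u w"
    and ip_commute: "ip u v = ip v u"
    and ip_pos: "v \<noteq> 0 \<Longrightarrow> ip v v > 0"
begin

lemma ip_add_right: "ip w (u + v) = ip w u + ip w v"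
  by (simp add: ip_commute[of w] ip_add_left)

lemma ip_scale_right: "ip w (r *\<^sub>R u) = r * ip w u"
  by (simp add: ip_commute[of w] ip_scale_left)

lemma ip_zero_left [simp]: "ip 0 v = 0"
  using ip_scale_left[of 0 0 v] by simp

lemma ip_zero_right [simp]: "ip v 0 = 0"
  by (simp add: ip_commute[of v])

lemma ip_minus_left: "ip (- u) w = - ip u w"
  using ip_scale_left[of "-1" u w] by simp

lemma ip_minus_right: "ip w (- u) = - ip w u"
  by (simp add: ip_commute[of w] ip_minus_left)

lemma ip_diff_left: "ip (u - v) w = ip u w - ip v w"
  using ip_add_left[of u "- v" w] by (simp add: ip_minus_left)

lemma ip_diff_right: "ip w (u - v) = ip w u - ip w v"
  by (simp add: ip_commute[of w] ip_diff_left)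

lemma ip_sum_left: "ip (sum f A) w = (\<Sum>a\<in>A. ip (f a) w)"
  by (induction A rule: infinite_finite_induct) (auto simp: ip_add_left)

lemma ip_sum_right: "ip w (sum f A) = (\<Sum>a\<in>A. ip w (f a))"
  by (simp add: ip_commute[of w] ip_sum_left)

lemmas ip_simps = ip_add_left ip_add_right ip_scale_left ip_scale_right ip_minus_left
  ip_minus_right ip_diff_left ip_diff_right

lemma ip_ge_0: "ip v v \<ge> 0"
  using ip_pos[of v] by (cases "v = 0") auto

lemma ip_eq_0_iff [simp]: "ip v v = 0 \<longleftrightarrow> v = 0"
  using ip_pos[of v] by (cases "v = 0") auto

text \<open>Equality in an inequality between forms becomes an eigenvector equation through this
  lemma. Testing the form on \<open>v + t *\<^sub>R M v\<close> works without finite dimension and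
  without a square root of \<open>M\<close>.\<close>

lemma psd_kernel:
  assumes "linear M" "subspace W" "\<And>u. u \<in> W \<Longrightarrow> M u \<in> W"
    and sym: "\<And>u w. u \<in> W \<Longrightarrow> w \<in> W \<Longrightarrow> ip (M u) w = ip u (M w)"
    and psd: "\<And>u. u \<in> W \<Longrightarrow> ip (M u) u \<ge> 0"
    and "v \<in> W" "ip (M v) v = 0"
  shows "M v = 0"
proof -
  define a where "a = ip (M v) (M v)"
  define b where "b = ip (M (M v)) (M v)"
  \<comment> \<open>The minimizer of \<open>2 * t * a + t\<^sup>2 * b\<close> would be
    \<open>- a / b\<close>. The added 1 keeps the denominator positive when \<open>b = 0\<close>,
    and the value stays negative unless \<open>a = 0\<close>.\<close>
  define t where "t = - a / (b + 1)"
  have W: "M v \<in> W" "v + t *\<^sub>R M v \<in> W"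
    using assms by (auto intro: subspace_add subspace_scale)
  have b: "b \<ge> 0" and a: "a \<ge> 0"
    using psd[OF W(1)] ip_ge_0 by (auto simp: b_def a_def)
  have "ip (M (M v)) v = a"
    using sym[OF W(1) \<open>v \<in> W\<close>] by (simp add: a_def)
  then have "ip (M (v + t *\<^sub>R M v)) (v + t *\<^sub>R M v) = 2 * t * a + t\<^sup>2 * b"
    using assms(7) by (simp add: linear_add[OF assms(1)] linear_scale[OF assms(1)] ip_simps
        a_def[symmetric] b_def[symmetric] power2_eq_square algebra_simps)
  then have "0 \<le> 2 * t * a + t\<^sup>2 * b"
    using psd[OF W(2)] by simp
  also have "\<dots> = - (a\<^sup>2 * (b + 2) / (b + 1)\<^sup>2)"
    using b by (simp add: t_def divide_simps power2_eq_square) (simp add: algebra_simps)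
  finally have "a\<^sup>2 * (b + 2) / (b + 1)\<^sup>2 \<le> 0"
    by simp
  then have "a\<^sup>2 * (b + 2) \<le> 0"
    using b by (simp add: divide_le_0_iff)
  then have "a = 0"
    using b by (simp add: mult_le_0_iff)
  then show ?thesis
    by (simp add: a_def)
qed

text \<open>Compactness provides a minimum \<open>l\<close> of the Rayleigh quotient. Then
  \<open>T - l\<close> is positive semidefinite on \<open>W\<close> and its form vanishes at the
  minimizer, which is therefore an eigenvector by \<open>psd_kernel\<close>.\<close>

lemma rayleigh_min:
  assumes "linear T" "subspace W" "finite S" "W \<subseteq> span S" "W \<noteq> {0}"
    and inv: "\<And>u. u \<in> W \<Longrightarrow> T u \<in> W"
    and sym: "\<And>u w. u \<in> W \<Longrightarrow> w \<in> W \<Longrightarrow> ip (T u) w = ip u (T w)"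
  obtains l w where "w \<in> W" "w \<noteq> 0" "T w = l *\<^sub>R w"
    "\<And>u. u \<in> W \<Longrightarrow> ip (T u) u \<ge> l * ip u u"
proof -
  obtain B where B: "B \<subseteq> W" "independent B" "W \<subseteq> span B"
    using basis_exists[of W] by metis
  have finB: "finite B"
    using independent_span_bound[OF assms(3) B(2)] B(1) assms(4) by auto
  have spB: "span B = W"
    using B assms(2) by (simp add: span_subspace)
  have "B \<noteq> {}"
    using spB assms(5) by auto
  define vec where "vec a = (\<Sum>b\<in>B. a b *\<^sub>R b)" for a :: "'v \<Rightarrow> real"
  define N where "N a = ip (vec a) (vec a)" for a
  define Q where "Q a = ip (T (vec a)) (vec a)" for a
  \<comment> \<open>Coefficients are functions on the whole type, set to zero off the basis
    \<open>B\<close>. The unit sphere is then a closed part of a product of compact sets, and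
    Tychonoff's theorem applies.\<close>
  define K where "K = {a :: 'v \<Rightarrow> real. (\<forall>b. a b \<in> (if b \<in> B then {-1..1} else {0})) \<and> (\<Sum>b\<in>B. (a b)\<^sup>2) = 1}"
  have vecW: "vec a \<in> W" for a
    unfolding vec_def spB[symmetric] by (intro span_sum span_scale span_base)
  have vec0: "vec a \<noteq> 0" if "(\<Sum>b\<in>B. (a b)\<^sup>2) = 1" for a
  proof
    assume "vec a = 0"
    then have "\<forall>b\<in>B. a b = 0"
      using B(2) finB unfolding vec_def by (metis independentD subset_refl)
    then show False
      using that by simp
  qed
  have N: "N a = (\<Sum>b\<in>B. \<Sum>b'\<in>B. a b * a b' * ip b b')" for a
    by (simp add: N_def vec_def ip_sum_left ip_sum_right ip_simps sum_distrib_left mult.assoc)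
      (subst sum.swap, simp add: mult.left_commute)
  have Q: "Q a = (\<Sum>b\<in>B. \<Sum>b'\<in>B. a b * a b' * ip (T b) b')" for a
    by (simp add: Q_def vec_def linear_sum[OF assms(1)] linear_scale[OF assms(1)] ip_sum_left ip_sum_right
        ip_simps sum_distrib_left mult.assoc) (subst sum.swap, simp add: mult.left_commute)
  have cont: "continuous_on A (\<lambda>a. a b)" for A :: "('v \<Rightarrow> real) set" and b
    by (rule continuous_on_subset[OF continuous_on_product_coordinates]) simp
  have "compact (PiE UNIV (\<lambda>b. if b \<in> B then {-1..1} else {0::real}))"
    using compactin_PiE[of "\<lambda>_. euclidean" UNIV "\<lambda>b. if b \<in> B then {-1..1} else {0::real}"]
    by (auto simp: euclidean_product_topology)
  moreover have "closed {a :: 'v \<Rightarrow> real. (\<Sum>b\<in>B. (a b)\<^sup>2) = 1}"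
    by (intro closed_Collect_eq continuous_intros cont)
  ultimately have "compact (PiE UNIV (\<lambda>b. if b \<in> B then {-1..1} else {0::real}) \<inter> {a. (\<Sum>b\<in>B. (a b)\<^sup>2) = 1})"
    by (rule compact_Int_closed)
  moreover have "PiE UNIV (\<lambda>b. if b \<in> B then {-1..1} else {0::real}) \<inter> {a. (\<Sum>b\<in>B. (a b)\<^sup>2) = 1} = K"
    by (auto simp: K_def PiE_def Pi_def)
  ultimately have "compact K"
    by simp
  moreover have "K \<noteq> {}"
  proof -
    obtain b0 where b0: "b0 \<in> B" using \<open>B \<noteq> {}\<close> by auto
    have "(\<Sum>b\<in>B. (if b = b0 then 1 else 0 :: real)\<^sup>2) = (\<Sum>b\<in>B. if b = b0 then 1 else 0)"
      by (rule sum.cong) auto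
    then have "(\<lambda>b. if b = b0 then 1 else 0) \<in> K"
      using b0 finB by (auto simp: K_def)
    then show ?thesis by blast
  qed
  moreover have "continuous_on K (\<lambda>a. Q a / N a)"
  proof (rule continuous_on_divide)
    show "continuous_on K Q" "continuous_on K N"
      unfolding N[abs_def] Q[abs_def] by (intro continuous_intros cont)+
    show "\<forall>a\<in>K. N a \<noteq> 0"
      using vec0 by (auto simp: N_def K_def)
  qed
  ultimately obtain a0 where a0: "a0 \<in> K" "\<And>a. a \<in> K \<Longrightarrow> Q a0 / N a0 \<le> Q a / N a"
    using continuous_attains_inf[of K "\<lambda>a. Q a / N a"] by blast
  define l where "l = Q a0 / N a0"
  define w where "w = vec a0"
  have w: "w \<in> W" "w \<noteq> 0"
    using a0(1) vec0 vecW by (auto simp: w_def K_def)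
  have lw: "ip (T w) w = l * ip w w"
    using w by (simp add: l_def w_def Q_def N_def)
  have min: "ip (T u) u \<ge> l * ip u u" if u: "u \<in> W" for u
  proof (cases "u = 0")
    case False
    obtain a where a: "u = vec a"
      using u spB span_finite[OF finB] unfolding vec_def by auto
    define s where "s = (\<Sum>b\<in>B. (a b)\<^sup>2)"
    have "s \<noteq> 0"
    proof
      assume "s = 0"
      then have "\<forall>b\<in>B. a b = 0"
        using finB by (simp add: s_def sum_nonneg_eq_0_iff)
      then show False using False a by (simp add: vec_def)
    qed
    then have s: "s > 0"
      by (simp add: s_def order_less_le sum_nonneg)
    define a' where "a' b = (if b \<in> B then a b / sqrt s else 0)" for b
    have sq: "(\<Sum>b\<in>B. (a' b)\<^sup>2) = 1"
    proof -
      have "(\<Sum>b\<in>B. (a' b)\<^sup>2) = (\<Sum>b\<in>B. (a b)\<^sup>2) / s"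
        using s by (simp add: a'_def power_divide sum_divide_distrib)
      then show ?thesis using s by (simp add: s_def)
    qed
    have "(a' b)\<^sup>2 \<le> 1" if "b \<in> B" for b
      using member_le_sum[of b B "\<lambda>b. (a' b)\<^sup>2"] that finB sq by simp
    then have "a' b \<in> {-1..1}" if "b \<in> B" for b
      using that by (simp add: abs_square_le_1 abs_le_iff)
    then have "a' \<in> K"
      using sq by (auto simp: K_def a'_def)
    then have "l \<le> Q a' / N a'"
      using a0(2) by (simp add: l_def)
    moreover have "vec a' = (1 / sqrt s) *\<^sub>R u"
      unfolding a vec_def by (simp add: scaleR_sum_right a'_def)
    then have "N a' = ip u u / s" "Q a' = ip (T u) u / s"
      using s by (simp_all add: N_def Q_def linear_scale[OF assms(1)] ip_simps power2_eq_square[symmetric])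
    ultimately have "l \<le> ip (T u) u / ip u u"
      using s by simp
    then show ?thesis
      using ip_pos[OF False] by (simp add: pos_le_divide_eq)
  qed (simp add: linear_0[OF assms(1)])
  have "T w - l *\<^sub>R w = 0"
  proof (rule psd_kernel[where M = "\<lambda>u. T u - l *\<^sub>R u" and W = W])
    show "linear (\<lambda>u. T u - l *\<^sub>R u)"
      by (intro linear_compose_sub assms(1) linear_compose_scale_right linear_id[unfolded id_def])
    show "T u - l *\<^sub>R u \<in> W" if "u \<in> W" for u
      using assms(2) inv that by (intro subspace_diff subspace_scale) auto
    show "ip (T u - l *\<^sub>R u) x = ip u (T x - l *\<^sub>R x)" if "u \<in> W" "x \<in> W" for u x
      using sym[OF that] by (simp add: ip_simps)
    show "ip (T u - l *\<^sub>R u) u \<ge> 0" if "u \<in> W" for u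
      using min[OF that] by (simp add: ip_simps)
    show "ip (T w - l *\<^sub>R w) w = 0"
      using lw by (simp add: ip_simps)
  qed (use assms(2) w in auto)
  then show ?thesis
    using that[of w l] w min by auto
qed

text \<open>Eigenvectors of different eigenvalues are orthogonal, hence independent inside a finite
  span. Finiteness is what gives the \<open>Min\<close> in \<open>lambda_min\<close> its
  meaning.\<close>

lemma eigenvalues_finite:
  assumes "subspace W" "finite S" "W \<subseteq> span S"
    and sym: "\<And>u w. u \<in> W \<Longrightarrow> w \<in> W \<Longrightarrow> ip (T u) w = ip u (T w)"
  shows "finite (eigenvalues_on T W)"
proof -
  define ev where "ev l = (SOME v. v \<in> eigenspace_on T W l \<and> v \<noteq> 0)" for l
  let ?E = "eigenvalues_on T W"
  have ev: "ev l \<in> W" "T (ev l) = l *\<^sub>R ev l" "ev l \<noteq> 0" if "l \<in> ?E" for l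
    using someI_ex[of "\<lambda>v. v \<in> eigenspace_on T W l \<and> v \<noteq> 0"] that
    unfolding ev_def eigenvalues_on_def eigenspace_on_def by blast+
  have orth: "ip (ev l) (ev m) = 0" if "l \<in> ?E" "m \<in> ?E" "l \<noteq> m" for l m
    using sym[OF ev(1)[OF that(1)] ev(1)[OF that(2)]] ev(2) that by (simp add: ip_simps)
  have inj: "inj_on ev ?E"
    by (rule inj_onI) (metis orth ev(3) ip_eq_0_iff)
  have "independent (ev ` ?E)"
    unfolding independent_explicit_module
  proof (intro allI impI)
    fix t u v
    assume t: "finite t" "t \<subseteq> ev ` ?E" "(\<Sum>v\<in>t. u v *\<^sub>R v) = 0" and v: "v \<in> t"
    have "0 = (\<Sum>x\<in>t. u x * ip x v)"
      using arg_cong[OF t(3), of "\<lambda>x. ip x v"] by (simp add: ip_sum_left ip_simps)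
    also have "\<dots> = (\<Sum>x\<in>{v}. u x * ip x v)"
    proof (intro sum.mono_neutral_right ballI)
      fix x assume x: "x \<in> t - {v}"
      then obtain l m where "l \<in> ?E" "x = ev l" "m \<in> ?E" "v = ev m"
        using t(2) v by blast
      then show "u x * ip x v = 0"
        using x orth[of l m] by auto
    qed (use t v in auto)
    finally show "u v = 0"
      using v t(2) ev(3) by auto
  qed
  moreover have "ev ` ?E \<subseteq> span S"
    using ev assms by blast
  ultimately have "finite (ev ` ?E)"
    using independent_span_bound[OF assms(2)] by blast
  then show ?thesis
    using inj finite_imageD by blast
qed

end

section \<open>Weighted graphs and the Poincare inequality\<close>

text \<open>The diagonal is left free because \<open>reduce\<close> creates positive entries there.
  Differences of values make it invisible to \<open>lap\<close> and \<open>energy\<close>, and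
  \<open>hub_weight\<close> skips it.\<close>

definition weights_on :: "'a set \<Rightarrow> ('a \<Rightarrow> 'a \<Rightarrow> real) \<Rightarrow> bool" where
  "weights_on X c \<longleftrightarrow> (\<forall>i\<in>X. \<forall>j\<in>X. c i j = c j i \<and> 0 \<le> c i j)"

definition lap :: "'a set \<Rightarrow> ('a \<Rightarrow> 'a \<Rightarrow> real) \<Rightarrow> ('a \<Rightarrow> real) \<Rightarrow> 'a \<Rightarrow> real" where
  "lap X c f y = (\<Sum>z\<in>X. c y z * (f y - f z))"

definition energy :: "'a set \<Rightarrow> ('a \<Rightarrow> 'a \<Rightarrow> real) \<Rightarrow> ('a \<Rightarrow> real) \<Rightarrow> real" where
  "energy X c f = (\<Sum>i\<in>X. \<Sum>j\<in>X. c i j * (f i - f j)\<^sup>2) / 2"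

text \<open>A lower bound for the gap rather than its exact value: a reduction may enlarge the gap,
  while the inductions keep one \<open>g\<close> throughout.\<close>

definition poincare :: "'a set \<Rightarrow> ('a \<Rightarrow> 'a \<Rightarrow> real) \<Rightarrow> real \<Rightarrow> bool" where
  "poincare X c g \<longleftrightarrow> (\<forall>f. sum f X = 0 \<longrightarrow> g * (\<Sum>i\<in>X. (f i)\<^sup>2) \<le> energy X c f)"

definition hub_weight :: "'a set \<Rightarrow> ('a \<Rightarrow> 'a \<Rightarrow> real) \<Rightarrow> 'a \<Rightarrow> real" where
  "hub_weight X c x = (\<Sum>y\<in>X - {x}. c x y)"

text \<open>Schur complement of the Laplacian at \<open>x\<close>. If \<open>x\<close> is isolated, division by zero makes this the
  deletion of \<open>x\<close>.\<close>

definition reduce :: "'a set \<Rightarrow> ('a \<Rightarrow> 'a \<Rightarrow> real) \<Rightarrow> 'a \<Rightarrow> 'a \<Rightarrow> 'a \<Rightarrow> real" where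
  "reduce X c x y z = c y z + c x y * c x z / hub_weight X c x"

lemma weights_on_sym: "weights_on X c \<Longrightarrow> i \<in> X \<Longrightarrow> j \<in> X \<Longrightarrow> c i j = c j i"
  by (auto simp: weights_on_def)

lemma weights_on_nonneg: "weights_on X c \<Longrightarrow> i \<in> X \<Longrightarrow> j \<in> X \<Longrightarrow> 0 \<le> c i j"
  by (auto simp: weights_on_def)

lemma hub_weight_nonneg: "weights_on X c \<Longrightarrow> x \<in> X \<Longrightarrow> 0 \<le> hub_weight X c x"
  unfolding hub_weight_def by (intro sum_nonneg) (auto simp: weights_on_def)

lemma weights_on_subset: "weights_on X c \<Longrightarrow> Y \<subseteq> X \<Longrightarrow> weights_on Y c"
  by (auto simp: weights_on_def)

lemma weights_on_reduce:
  assumes "weights_on X c" "x \<in> X"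
  shows "weights_on (X - {x}) (reduce X c x)"
  using assms hub_weight_nonneg[OF assms] unfolding weights_on_def reduce_def
  by (auto simp: mult.commute intro!: add_nonneg_nonneg divide_nonneg_nonneg mult_nonneg_nonneg)

lemma energy_eq_lap:
  assumes "weights_on X c"
  shows "energy X c f = (\<Sum>y\<in>X. f y * lap X c f y)"
proof -
  have "(\<Sum>i\<in>X. \<Sum>j\<in>X. c i j * (f i - f j)\<^sup>2) =
      (\<Sum>i\<in>X. \<Sum>j\<in>X. c i j * f i * (f i - f j)) + (\<Sum>i\<in>X. \<Sum>j\<in>X. c i j * f j * (f j - f i))"
    by (simp add: sum.distrib[symmetric] power2_eq_square algebra_simps)
  also have "(\<Sum>i\<in>X. \<Sum>j\<in>X. c i j * f j * (f j - f i)) = (\<Sum>i\<in>X. \<Sum>j\<in>X. c i j * f i * (f i - f j))"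
    by (subst sum.swap) (intro sum.cong refl, simp add: weights_on_sym[OF assms])
  finally show ?thesis
    by (simp add: energy_def lap_def sum_distrib_left mult_ac)
qed

lemma energy_nonneg: "weights_on X c \<Longrightarrow> 0 \<le> energy X c f"
  unfolding energy_def by (intro divide_nonneg_pos sum_nonneg mult_nonneg_nonneg) (auto simp: weights_on_def)

lemma energy_cong: "(\<And>y. y \<in> X \<Longrightarrow> f y = g y) \<Longrightarrow> energy X c f = energy X c g"
  unfolding energy_def by (intro arg_cong[of _ _ "\<lambda>x. x / 2"] sum.cong) auto

lemma energy_shift: "energy X c (\<lambda>y. f y - a) = energy X c f"
  by (simp add: energy_def)

lemma energy_remove:
  assumes "finite X" "x \<in> X" "weights_on X c"
  shows "energy X c f = energy (X - {x}) c f + (\<Sum>y\<in>X - {x}. c x y * (f x - f y)\<^sup>2)"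
proof -
  have "(\<Sum>i\<in>X - {x}. c i x * (f i - f x)\<^sup>2) = (\<Sum>y\<in>X - {x}. c x y * (f x - f y)\<^sup>2)"
    using assms by (intro sum.cong) (auto simp: weights_on_def power2_commute)
  then show ?thesis
    using assms by (simp add: energy_def sum.remove[of X x] sum.distrib add_divide_distrib)
qed

lemma poincare_variance:
  assumes "finite X" "X \<noteq> {}" "poincare X c g"
  shows "g * ((\<Sum>i\<in>X. (f i)\<^sup>2) - (sum f X)\<^sup>2 / card X) \<le> energy X c f"
proof -
  define a where "a = sum f X / card X"
  have card: "real (card X) \<noteq> 0"
    using assms by simp
  have "(\<Sum>i\<in>X. (f i - a)\<^sup>2) = (\<Sum>i\<in>X. (f i)\<^sup>2) - 2 * a * sum f X + card X * a\<^sup>2"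
    by (simp add: power2_diff sum.distrib sum_subtractf sum_distrib_left sum_distrib_right mult_ac)
  also have "\<dots> = (\<Sum>i\<in>X. (f i)\<^sup>2) - (sum f X)\<^sup>2 / card X"
    using card by (simp add: a_def field_simps power2_eq_square)
  finally have 1: "(\<Sum>i\<in>X. (f i - a)\<^sup>2) = (\<Sum>i\<in>X. (f i)\<^sup>2) - (sum f X)\<^sup>2 / card X" .
  have "sum (\<lambda>i. f i - a) X = 0"
    using card by (simp add: sum_subtractf a_def)
  then have "g * (\<Sum>i\<in>X. (f i - a)\<^sup>2) \<le> energy X c (\<lambda>i. f i - a)"
    using assms by (simp add: poincare_def)
  then show ?thesis
    by (simp add: 1 energy_shift)
qed

lemma poincare_eigenvalue_le:
  assumes "finite X" "weights_on X c" "poincare X c g" "sum f X = 0"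
    and "\<And>y. y \<in> X \<Longrightarrow> lap X c f y = l * f y" and "\<exists>y\<in>X. f y \<noteq> 0"
  shows "g \<le> l"
proof -
  have "energy X c f = l * (\<Sum>y\<in>X. (f y)\<^sup>2)"
    unfolding energy_eq_lap[OF assms(2)] sum_distrib_left
    by (intro sum.cong) (auto simp: assms(5) power2_eq_square)
  then have "g * (\<Sum>y\<in>X. (f y)\<^sup>2) \<le> l * (\<Sum>y\<in>X. (f y)\<^sup>2)"
    using assms by (metis poincare_def)
  moreover have "(\<Sum>y\<in>X. (f y)\<^sup>2) > 0"
    using assms by (auto intro: sum_pos2)
  ultimately show ?thesis
    by simp
qed

text \<open>The indicator of a set without outgoing edges has energy zero, but its variance
  \<open>card S - (card S)\<^sup>2 / card X\<close> is positive for a proper nonempty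
  subset.\<close>

lemma poincare_connected:
  assumes "finite X" "weights_on X c" "poincare X c g" "g > 0" "S \<subseteq> X" "S \<noteq> {}"
    and "\<And>i j. i \<in> S \<Longrightarrow> j \<in> X - S \<Longrightarrow> c i j = 0"
  shows "S = X"
proof -
  define f where "f i = (if i \<in> S then 1 else 0 :: real)" for i
  have fin: "finite S"
    using assms finite_subset by blast
  have "c i j * (f i - f j)\<^sup>2 = 0" if "i \<in> X" "j \<in> X" for i j
    using assms(7)[of i j] assms(7)[of j i] weights_on_sym[OF assms(2) that] that by (auto simp: f_def)
  then have "(\<Sum>i\<in>X. \<Sum>j\<in>X. c i j * (f i - f j)\<^sup>2) = 0"
    by (intro sum.neutral ballI)
  then have "energy X c f = 0"
    by (simp add: energy_def)
  moreover have "(\<Sum>i\<in>X. (f i)\<^sup>2) = card S" "sum f X = card S"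
    using assms(1,5) by (simp_all add: f_def if_distrib[of "\<lambda>x. x\<^sup>2"] sum.If_cases Int_absorb1 cong: if_cong)
  ultimately have "g * (card S - (card S)\<^sup>2 / card X) \<le> 0"
    using poincare_variance[of X c g f] assms by auto
  then have "card S - (card S)\<^sup>2 / card X \<le> 0"
    using assms(4) by (simp add: mult_le_0_iff)
  moreover have "card X > 0" "card S > 0"
    using assms fin card_gt_0_iff by auto
  ultimately have "card X \<le> card S"
    by (simp add: field_simps power2_eq_square flip: of_nat_mult)
  then show ?thesis
    using assms card_seteq by blast
qed

lemma hub_weight_pos:
  assumes "finite X" "weights_on X c" "poincare X c g" "g > 0" "x \<in> X" "X \<noteq> {x}"
  shows "hub_weight X c x > 0"
proof (rule ccontr)
  assume "\<not> ?thesis"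
  then have "hub_weight X c x = 0"
    using hub_weight_nonneg[OF assms(2,5)] by simp
  then have "\<forall>y\<in>X - {x}. c x y = 0"
    unfolding hub_weight_def using assms
    by (subst (asm) sum_nonneg_eq_0_iff) (auto simp: weights_on_def)
  then show False
    using poincare_connected[OF assms(1-4), of "{x}"] assms by auto
qed

section \<open>The Schur complement and harmonic extension\<close>

lemma lap_reduce:
  assumes "finite X" "x \<in> X" "y \<in> X - {x}" "hub_weight X c x \<noteq> 0"
  shows "lap (X - {x}) (reduce X c x) f y =
    lap (X - {x}) c f y + c x y * (f y - (\<Sum>z\<in>X - {x}. c x z * f z) / hub_weight X c x)"
proof -
  have "(\<Sum>z\<in>X - {x}. c x y * c x z / hub_weight X c x * (f y - f z)) =
     c x y / hub_weight X c x * (hub_weight X c x * f y - (\<Sum>z\<in>X - {x}. c x z * f z))"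
    by (simp add: hub_weight_def sum_distrib_left sum_distrib_right sum_subtractf[symmetric] diff_divide_distrib algebra_simps)
  also have "\<dots> = c x y * (f y - (\<Sum>z\<in>X - {x}. c x z * f z) / hub_weight X c x)"
    using assms by (simp add: field_simps)
  finally show ?thesis
    by (simp add: lap_def reduce_def distrib_right sum.distrib)
qed

text \<open>The value \<open>h\<close> makes the extension harmonic at \<open>x\<close>, so the
  terms linear in \<open>f y - h\<close> cancel. The reduced network carries the energy of the
  harmonic extension.\<close>

lemma energy_reduce:
  assumes "finite X" "x \<in> X" "weights_on X c" "hub_weight X c x \<noteq> 0"
    and h: "h = (\<Sum>z\<in>X - {x}. c x z * f z) / hub_weight X c x"
  shows "energy (X - {x}) (reduce X c x) f = energy X c (f(x := h))"
proof -
  let ?Y = "X - {x}"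
  have w: "weights_on ?Y c"
    using assms(3) weights_on_subset by blast
  have z: "(\<Sum>y\<in>?Y. c x y * (f y - h)) = 0"
  proof -
    have "(\<Sum>y\<in>?Y. c x y * (f y - h)) = (\<Sum>z\<in>?Y. c x z * f z) - hub_weight X c x * h"
      by (simp only: right_diff_distrib sum_subtractf hub_weight_def sum_distrib_right)
    then show ?thesis
      using assms(4) by (simp add: h)
  qed
  have "energy ?Y (reduce X c x) f = (\<Sum>y\<in>?Y. f y * lap ?Y c f y) + (\<Sum>y\<in>?Y. c x y * f y * (f y - h))"
    using assms by (simp add: energy_eq_lap[OF weights_on_reduce] lap_reduce sum.distrib[symmetric] algebra_simps)
  also have "(\<Sum>y\<in>?Y. c x y * f y * (f y - h)) = (\<Sum>y\<in>?Y. c x y * (h - f y)\<^sup>2) + h * (\<Sum>y\<in>?Y. c x y * (f y - h))"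
    unfolding sum_distrib_left sum.distrib[symmetric] by (simp add: power2_eq_square algebra_simps)
  also have "(\<Sum>y\<in>?Y. f y * lap ?Y c f y) = energy ?Y c (f(x := h))"
    unfolding energy_eq_lap[OF w, symmetric] by (rule energy_cong) auto
  finally have "energy ?Y (reduce X c x) f =
      energy ?Y c (f(x := h)) + (\<Sum>y\<in>?Y. c x y * (h - f y)\<^sup>2)"
    by (simp add: z)
  also have "(\<Sum>y\<in>?Y. c x y * (h - f y)\<^sup>2) = (\<Sum>y\<in>?Y. c x y * ((f(x := h)) x - (f(x := h)) y)\<^sup>2)"
    by (intro sum.cong) auto
  finally show ?thesis
    by (simp only: energy_remove[OF assms(1-3)])
qed

text \<open>The extension has total \<open>h\<close>, since \<open>f\<close> sums to zero. Its
  variance produces the surplus \<open>h\<^sup>2 * (1 - 1 / card X)\<close>, which is kept because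
  it detects equality.\<close>

lemma energy_reduce_ge:
  assumes "finite X" "x \<in> X" "weights_on X c" "hub_weight X c x \<noteq> 0" "poincare X c g"
    and h: "h = (\<Sum>z\<in>X - {x}. c x z * f z) / hub_weight X c x" and f: "sum f (X - {x}) = 0"
  shows "g * ((\<Sum>y\<in>X - {x}. (f y)\<^sup>2) + h\<^sup>2 * (1 - 1 / card X)) \<le> energy (X - {x}) (reduce X c x) f"
proof -
  have "(\<Sum>y\<in>X - {x}. ((f(x := h)) y)\<^sup>2) = (\<Sum>y\<in>X - {x}. (f y)\<^sup>2)" "sum (f(x := h)) (X - {x}) = sum f (X - {x})"
    by (auto intro: sum.cong)
  then have "(\<Sum>y\<in>X. ((f(x := h)) y)\<^sup>2) = (\<Sum>y\<in>X - {x}. (f y)\<^sup>2) + h\<^sup>2" "sum (f(x := h)) X = h"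
    using assms(1,2) f by (simp_all add: sum.remove[of X x])
  then show ?thesis
    unfolding energy_reduce[OF assms(1-4) h] using poincare_variance[of X c g "f(x := h)"] assms
    by (auto simp: algebra_simps)
qed

lemma poincare_reduce:
  assumes "finite X" "weights_on X c" "poincare X c g" "g > 0" "x \<in> X"
  shows "poincare (X - {x}) (reduce X c x) g"
  unfolding poincare_def
proof (intro allI impI)
  fix f :: "'a \<Rightarrow> real" assume f: "sum f (X - {x}) = 0"
  show "g * (\<Sum>i\<in>X - {x}. (f i)\<^sup>2) \<le> energy (X - {x}) (reduce X c x) f"
  proof (cases "X = {x}")
    case False
    define h where "h = (\<Sum>z\<in>X - {x}. c x z * f z) / hub_weight X c x"
    have "hub_weight X c x \<noteq> 0"
      using hub_weight_pos[OF assms False] by simp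
    note * = energy_reduce_ge[OF assms(1,5,2) this assms(3) h_def f]
    have "card X \<ge> 1"
      using assms by (simp add: Suc_le_eq card_gt_0_iff) blast
    then have "h\<^sup>2 * (1 - 1 / card X) \<ge> 0"
      by (intro mult_nonneg_nonneg) auto
    then have "g * (\<Sum>i\<in>X - {x}. (f i)\<^sup>2) \<le> g * ((\<Sum>y\<in>X - {x}. (f y)\<^sup>2) + h\<^sup>2 * (1 - 1 / card X))"
      using assms by (intro mult_left_mono) auto
    then show ?thesis
      using * by simp
  qed (simp add: energy_def)
qed

text \<open>Equality in \<open>energy_reduce_ge\<close> forces the harmonic extension of \<open>f\<close> to vanish at \<open>x\<close>.\<close>

lemma extend_eigenfunction:
  assumes "finite X" "weights_on X c" "poincare X c g" "g > 0" "x \<in> X" "X \<noteq> {x}"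
    and f: "sum f (X - {x}) = 0" "f x = 0"
    and eig: "\<And>y. y \<in> X - {x} \<Longrightarrow> lap (X - {x}) (reduce X c x) f y = g * f y"
    and y: "y \<in> X"
  shows "lap X c f y = g * f y"
proof -
  have hub: "hub_weight X c x \<noteq> 0"
    using hub_weight_pos[OF assms(1-6)] by simp
  define h where "h = (\<Sum>z\<in>X - {x}. c x z * f z) / hub_weight X c x"
  have "energy (X - {x}) (reduce X c x) f = g * (\<Sum>y\<in>X - {x}. (f y)\<^sup>2)"
    unfolding energy_eq_lap[OF weights_on_reduce[OF assms(2,5)]] sum_distrib_left
    by (intro sum.cong) (auto simp: eig power2_eq_square)
  then have "g * (h\<^sup>2 * (1 - 1 / card X)) \<le> 0"
    using energy_reduce_ge[OF assms(1,5,2) hub assms(3) h_def f(1)] by (simp add: algebra_simps)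
  moreover have "1 - 1 / card X > 0"
  proof -
    have "card X \<noteq> 1" "card X \<noteq> 0"
      using assms card_1_singletonE[of X] by auto
    then show ?thesis by simp
  qed
  ultimately have "h = 0"
    using assms(4) by (simp add: mult_le_0_iff)
  then have z: "(\<Sum>z\<in>X - {x}. c x z * f z) = 0"
    using hub by (simp add: h_def)
  show ?thesis
  proof (cases "y = x")
    case True
    then show ?thesis
      using assms(1,5) f z by (simp add: lap_def sum.remove[of X x] sum_negf)
  next
    case False
    then have "lap (X - {x}) c f y + c x y * f y = g * f y"
      using eig[of y] y lap_reduce[OF assms(1,5) _ hub, of y f] z by simp
    then show ?thesis
      using assms(1,5) f False y weights_on_sym[OF assms(2,5) y] by (simp add: lap_def sum.remove[of X x])
  qed
qed

section \<open>Two positivity certificates in group algebras\<close>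

text \<open>The action is by bijections of the whole type rather than of one finite set, so that
  deleting vertices leaves the representation unchanged.\<close>

locale perm_rep = ip_space ip for ip :: "'v::real_vector \<Rightarrow> 'v \<Rightarrow> real" +
  fixes \<rho> :: "('a \<Rightarrow> 'a) \<Rightarrow> 'v \<Rightarrow> 'v"
  assumes rho_linear: "bij s \<Longrightarrow> linear (\<rho> s)"
    and rho_comp: "bij s \<Longrightarrow> bij t \<Longrightarrow> \<rho> (s \<circ> t) v = \<rho> s (\<rho> t v)"
    and rho_id: "\<rho> id v = v"
    and rho_isometry: "bij s \<Longrightarrow> ip (\<rho> s u) (\<rho> s v) = ip u v"
begin

lemma rho_adjoint: "bij s \<Longrightarrow> ip (\<rho> s u) v = ip u (\<rho> (inv s) v)"
  by (metis bij_imp_bij_inv bij_is_inj inv_o_cancel rho_comp rho_id rho_isometry)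

lemma ip_rho_inv: "bij s \<Longrightarrow> ip (\<rho> (inv s) v) v = ip (\<rho> s v) v"
  by (metis rho_adjoint ip_commute)

end

section \<open>Permutations as lists, for verification by evaluation\<close>

fun arrangements :: "nat \<Rightarrow> nat \<Rightarrow> nat list list" where
  "arrangements m 0 = [[]]"
| "arrangements m (Suc k) =
     concat (map (\<lambda>p. map (\<lambda>a. a # p) (filter (\<lambda>a. a \<notin> set p) [0..<m])) (arrangements m k))"

lemma set_arrangements:
  "set (arrangements m k) = {p. length p = k \<and> distinct p \<and> set p \<subseteq> {..<m}}"
proof (induction k)
  case (Suc k)
  have "p \<in> set (arrangements m (Suc k)) \<longleftrightarrow> p \<in> {p. length p = Suc k \<and> distinct p \<and> set p \<subseteq> {..<m}}" for p
    using Suc by (cases p) auto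
  then show ?case by blast
qed auto

abbreviation perm_lists :: "nat \<Rightarrow> nat list set" where
  "perm_lists m \<equiv> set (arrangements m m)"

lemma perm_lists_set: "p \<in> perm_lists m \<Longrightarrow> set p = {..<m}"
  unfolding set_arrangements by (intro card_subset_eq) (auto simp: distinct_card)

text \<open>The list \<open>p\<close> of positions is read as the permutation sending \<open>xs ! i\<close> to \<open>xs ! (p ! i)\<close>.\<close>

definition place :: "'a list \<Rightarrow> nat list \<Rightarrow> 'a \<Rightarrow> 'a" where
  "place xs p x = (case map_of (zip xs (map ((!) xs) p)) x of None \<Rightarrow> x | Some y \<Rightarrow> y)"

lemma place_outside: "length p = length xs \<Longrightarrow> x \<notin> set xs \<Longrightarrow> place xs p x = x"
  by (auto simp: place_def split: option.split dest!: map_of_SomeD set_zip_leftD)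

lemma place_nth: "distinct xs \<Longrightarrow> length p = length xs \<Longrightarrow> i < length xs \<Longrightarrow> place xs p (xs ! i) = xs ! (p ! i)"
  by (simp add: place_def map_of_zip_nth)

lemma place_permutes:
  assumes "distinct xs" "p \<in> perm_lists (length xs)"
  shows "place xs p permutes set xs"
proof (rule bij_imp_permutes)
  have len: "length p = length xs"
    using assms by (auto simp: set_arrangements)
  have "xs ! j \<in> place xs p ` set xs" if j: "j < length xs" for j
  proof -
    obtain i where "i < length xs" "p ! i = j"
      using perm_lists_set[OF assms(2)] len j by (metis in_set_conv_nth lessThan_iff)
    then show ?thesis
      using place_nth[OF assms(1) len] by (metis image_eqI nth_mem)
  qed
  then have "set xs \<subseteq> place xs p ` set xs"
    by (auto simp: in_set_conv_nth)
  moreover have "place xs p ` set xs \<subseteq> set xs"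
  proof
    fix y assume "y \<in> place xs p ` set xs"
    then obtain i where i: "i < length xs" "y = xs ! (p ! i)"
      using place_nth[OF assms(1) len] by (auto simp: in_set_conv_nth)
    then have "p ! i < length xs"
      using perm_lists_set[OF assms(2)] len by (metis lessThan_iff nth_mem)
    then show "y \<in> set xs"
      using i by simp
  qed
  ultimately have "place xs p ` set xs = set xs"
    by blast
  then show "bij_betw (place xs p) (set xs) (set xs)"
    by (simp add: bij_betw_def eq_card_imp_inj_on)
  show "place xs p x = x" if "x \<notin> set xs" for x
    using place_outside[OF len that] .
qed

lemma perm_lists_comp:
  assumes "q \<in> perm_lists m" "r \<in> perm_lists m"
  shows "map ((!) q) r \<in> perm_lists m"
  using assms perm_lists_set[OF assms(2)]
  by (auto simp: set_arrangements distinct_map inj_on_def nth_eq_iff_index_eq subset_iff)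

text \<open>The list \<open>map ((!) q) r\<close> applies \<open>r\<close> first. Hence
  \<open>place\<close> is a homomorphism, and identities computed on lists transfer to the
  representation.\<close>

lemma place_comp:
  assumes "distinct xs" "q \<in> perm_lists (length xs)" "r \<in> perm_lists (length xs)"
  shows "place xs (map ((!) q) r) = place xs q \<circ> place xs r"
proof
  fix x
  have len: "length q = length xs" "length r = length xs"
    using assms by (auto simp: set_arrangements)
  show "place xs (map ((!) q) r) x = (place xs q \<circ> place xs r) x"
  proof (cases "x \<in> set xs")
    case True
    then obtain i where i: "i < length xs" "x = xs ! i"
      by (auto simp: in_set_conv_nth)
    moreover have "r ! i < length xs"
      using perm_lists_set[OF assms(3)] i len by (metis lessThan_iff nth_mem)
    ultimately show ?thesis
      using assms(1) len by (simp add: place_nth)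
  qed (simp add: place_outside len)
qed

lemma sum_perm_lists_comp:
  assumes "q \<in> perm_lists m"
  shows "(\<Sum>p\<in>perm_lists m. f p) = (\<Sum>r\<in>perm_lists m. f (map ((!) q) r))"
proof -
  have "inj_on (\<lambda>r. map ((!) q) r) (perm_lists m)"
  proof (rule inj_onI)
    fix r s assume rs: "r \<in> perm_lists m" "s \<in> perm_lists m" "map ((!) q) r = map ((!) q) s"
    have "inj_on ((!) q) (set r \<union> set s)"
      using assms perm_lists_set[OF rs(1)] perm_lists_set[OF rs(2)]
      by (auto simp: inj_on_def set_arrangements nth_eq_iff_index_eq)
    then show "r = s"
      using rs(3) map_inj_on by blast
  qed
  moreover have "(\<lambda>r. map ((!) q) r) ` perm_lists m \<subseteq> perm_lists m"
    using perm_lists_comp[OF assms] by blast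
  ultimately have "bij_betw (\<lambda>r. map ((!) q) r) (perm_lists m) (perm_lists m)"
    by (simp add: bij_betw_def endo_inj_surj)
  then show ?thesis
    by (rule sum.reindex_bij_betw[symmetric])
qed

context perm_rep
begin

text \<open>An element \<open>b\<close> of the group algebra with \<open>b\<^sup>* b = K b\<close> and \<open>K > 0\<close> acts as a positive operator.\<close>

lemma group_algebra_nonneg:
  fixes b :: "nat list \<Rightarrow> int"
  assumes xs: "distinct xs" "length xs = m" and K: "K > 0"
    and qs: "distinct qs" "set qs \<subseteq> perm_lists m" "\<And>p. p \<in> perm_lists m \<Longrightarrow> p \<notin> set qs \<Longrightarrow> b p = 0"
    and sq: "list_all (\<lambda>r. (\<Sum>q\<leftarrow>qs. b q * b (map ((!) q) r)) = K * b r) (arrangements m m)"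
  shows "0 \<le> (\<Sum>q\<leftarrow>qs. b q * ip (\<rho> (place xs q) v) v)"
proof -
  let ?P = "perm_lists m"
  let ?r = "\<lambda>p. \<rho> (place xs p)"
  define w where "w = (\<Sum>p\<in>?P. b p *\<^sub>R ?r p v)"
  have bij: "bij (place xs p)" if "p \<in> ?P" for p
    using place_permutes[OF xs(1), of p] xs(2) that permutes_bij by blast
  have sum_qs: "(\<Sum>q\<in>?P. of_int (b q) * f q) = (\<Sum>q\<leftarrow>qs. of_int (b q) * f q)" for f :: "nat list \<Rightarrow> 'd::comm_ring_1"
  proof -
    have "(\<Sum>q\<in>?P. of_int (b q) * f q) = (\<Sum>q\<in>set qs. of_int (b q) * f q)"
      using qs by (intro sum.mono_neutral_right) auto
    then show ?thesis
      using qs(1) by (simp add: sum_list_distinct_conv_sum_set)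
  qed
  have "ip w w = (\<Sum>q\<in>?P. \<Sum>p\<in>?P. b q * b p * ip (?r p v) (?r q v))"
    by (simp add: w_def ip_sum_left ip_sum_right ip_simps sum_distrib_left mult_ac)
  \<comment> \<open>Writing p as q r and using the invariance of the form removes q from the inner
    product. The coefficient left at r is that of b^* b.\<close>
  also have "\<dots> = (\<Sum>q\<in>?P. \<Sum>r\<in>?P. b q * b (map ((!) q) r) * ip (?r r v) v)"
  proof (rule sum.cong[OF refl])
    fix q assume q: "q \<in> ?P"
    have "ip (?r (map ((!) q) r) v) (?r q v) = ip (?r r v) v" if r: "r \<in> ?P" for r
      using place_comp[OF xs(1), of q r] q r xs(2) bij by (simp add: rho_comp rho_isometry)
    then show "(\<Sum>p\<in>?P. b q * b p * ip (?r p v) (?r q v)) =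
        (\<Sum>r\<in>?P. b q * b (map ((!) q) r) * ip (?r r v) v)"
      by (subst sum_perm_lists_comp[OF q]) simp
  qed
  also have "\<dots> = (\<Sum>r\<in>?P. real_of_int (\<Sum>q\<in>?P. b q * b (map ((!) q) r)) * ip (?r r v) v)"
    by (subst sum.swap) (simp add: sum_distrib_right)
  also have "\<dots> = (\<Sum>r\<in>?P. K * (b r * ip (?r r v) v))"
    using sq by (intro sum.cong refl) (simp add: sum_qs[of "\<lambda>q. b (map ((!) q) _)", simplified] list_all_iff)
  also have "\<dots> = K * (\<Sum>q\<leftarrow>qs. b q * ip (?r q v) v)"
    by (simp add: sum_qs sum_distrib_left[symmetric])
  finally have "K * (\<Sum>q\<leftarrow>qs. b q * ip (?r q v) v) \<ge> 0"
    using ip_ge_0[of w] by simp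
  then show ?thesis
    using K by (simp add: zero_le_mult_iff)
qed

end

text \<open>\<open>coeff4\<close> is \<open>12 (e\<^sub>V - e\<^sub>A)\<close>, where \<open>e\<^sub>V\<close> and \<open>e\<^sub>A\<close> are the averaging idempotents of the Klein
  four-group and of the alternating group on four points. \<open>coeff5\<close> is 12 times the difference of the
  central idempotent of the five-dimensional irreducible representation of the alternating group on
  five points and \<open>e\<^sub>V - e\<^sub>A\<close> for the points \<open>1, 2, 3, 4\<close>.\<close>

definition coeff4 :: "nat list \<Rightarrow> int" where
  "coeff4 p = (case length (filter (\<lambda>i. p ! i = i) [0,1,2,3]) of
      0 \<Rightarrow> if p ! (p ! 0) = 0 \<and> p ! (p ! 1) = 1 then 2 else 0 | Suc n \<Rightarrow> if n = 0 then - 1 else if n = 3 then 2 else 0)"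

definition coeff5 :: "nat list \<Rightarrow> int" where
  "coeff5 p = (let f = length (filter (\<lambda>i. p ! i = i) [0,1,2,3,4]) in
      if f = 1 then (if list_all (\<lambda>i. p ! (p ! i) = i) [0,1,2,3] then if p ! 0 = 0 then - 1 else 1 else 0)
      else if f = 2 then (if p ! 0 = 0 then 0 else - 1)
      else if f = 5 then 3 else 0)"

definition support4 :: "nat list list" where
 "support4 = [[0,1,2,3], [1,0,3,2], [2,3,0,1], [3,2,1,0],
   [1,2,0,3], [2,0,1,3], [1,3,2,0], [3,0,2,1],
   [2,1,3,0], [3,1,0,2], [0,2,3,1], [0,3,1,2]]"

definition support5 :: "nat list list" where
 "support5 = [[0,1,2,3,4], [0,2,1,4,3], [0,3,4,1,2], [0,4,3,2,1],
   [1,2,0,3,4], [1,3,2,0,4], [1,4,2,3,0],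
   [2,0,1,3,4], [2,1,3,0,4], [2,1,4,3,0],
   [3,0,2,1,4], [3,1,0,2,4], [3,1,2,4,0],
   [4,0,2,3,1], [4,1,0,3,2], [4,1,2,0,3],
   [1,0,3,2,4], [1,0,4,3,2], [1,0,2,4,3],
   [2,3,0,1,4], [2,4,0,3,1], [2,1,0,4,3],
   [3,2,1,0,4], [3,4,2,0,1], [3,1,4,0,2],
   [4,2,1,3,0], [4,3,2,1,0], [4,1,3,2,0]]"

lemma support4: "distinct support4" "list_all (\<lambda>p. (coeff4 p = 0) = (p \<notin> set support4)) (arrangements 4 4)"
  by code_simp+

lemma square4: "list_all (\<lambda>r. (\<Sum>q\<leftarrow>support4. coeff4 q * coeff4 (map ((!) q) r)) = 12 * coeff4 r) (arrangements 4 4)"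
  by code_simp

lemma support5: "distinct support5" "list_all (\<lambda>p. (coeff5 p = 0) = (p \<notin> set support5)) (arrangements 5 5)"
  by code_simp+

text \<open>Below the factor 12 there is an idempotent: \<open>coeff4\<close> projects onto the two
  nontrivial linear characters of the alternating group on four points, and these occur in the
  restriction of only one irreducible representation of the alternating group on five points, the
  five-dimensional one. So one idempotent lies under the other and the difference is again
  idempotent.\<close>

lemma square5: "list_all (\<lambda>r. (\<Sum>q\<leftarrow>support5. coeff5 q * coeff5 (map ((!) q) r)) = 12 * coeff5 r) (arrangements 5 5)"
  by code_simp

section \<open>The octopus inequality\<close>

abbreviation swp :: "'a \<Rightarrow> 'a \<Rightarrow> 'a \<Rightarrow> 'a" where
  "swp \<equiv> Transposition.transpose"

lemma fun_eq_on_list: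
  assumes "list_all (\<lambda>y. f y = g y) xs" "\<And>y. y \<notin> set xs \<Longrightarrow> f y = g y"
  shows "f = g"
  using assms by (auto simp: fun_eq_iff list_all_iff)

text \<open>A dictionary from list permutations to the products of two transpositions that occur in
  \<open>cyc3\<close> and \<open>dbl\<close>.\<close>

lemma place4_eq:
  assumes "distinct [i, j, k, l]"
  shows "place [i, j, k, l] [0,1,2,3] = id"
    "place [i, j, k, l] [1,0,3,2] = swp i j \<circ> swp k l"
    "place [i, j, k, l] [2,3,0,1] = swp i k \<circ> swp j l"
    "place [i, j, k, l] [3,2,1,0] = swp i l \<circ> swp j k"
    "place [i, j, k, l] [1,2,0,3] = swp i j \<circ> swp j k"
    "place [i, j, k, l] [2,0,1,3] = swp k j \<circ> swp j i"
    "place [i, j, k, l] [1,3,2,0] = swp i j \<circ> swp j l"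
    "place [i, j, k, l] [3,0,2,1] = swp l j \<circ> swp j i"
    "place [i, j, k, l] [2,1,3,0] = swp i k \<circ> swp k l"
    "place [i, j, k, l] [3,1,0,2] = swp l k \<circ> swp k i"
    "place [i, j, k, l] [0,2,3,1] = swp j k \<circ> swp k l"
    "place [i, j, k, l] [0,3,1,2] = swp l k \<circ> swp k j"
  by (rule fun_eq_on_list[of _ _ "[i, j, k, l]"]; use assms in \<open>auto simp: place_def Transposition.transpose_def\<close>)+

lemma place5_double:
  assumes "distinct [x, i, j, k, l]"
  shows "place [x, i, j, k, l] [0,1,2,3,4] = id"
    "place [x, i, j, k, l] [0,2,1,4,3] = swp i j \<circ> swp k l"
    "place [x, i, j, k, l] [0,3,4,1,2] = swp i k \<circ> swp j l"
    "place [x, i, j, k, l] [0,4,3,2,1] = swp i l \<circ> swp j k"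
    "place [x, i, j, k, l] [1,0,3,2,4] = swp x i \<circ> swp j k"
    "place [x, i, j, k, l] [1,0,4,3,2] = swp x i \<circ> swp j l"
    "place [x, i, j, k, l] [1,0,2,4,3] = swp x i \<circ> swp k l"
    "place [x, i, j, k, l] [2,3,0,1,4] = swp x j \<circ> swp i k"
    "place [x, i, j, k, l] [2,4,0,3,1] = swp x j \<circ> swp i l"
    "place [x, i, j, k, l] [2,1,0,4,3] = swp x j \<circ> swp k l"
    "place [x, i, j, k, l] [3,2,1,0,4] = swp x k \<circ> swp i j"
    "place [x, i, j, k, l] [3,4,2,0,1] = swp x k \<circ> swp i l"
    "place [x, i, j, k, l] [3,1,4,0,2] = swp x k \<circ> swp j l"
    "place [x, i, j, k, l] [4,2,1,3,0] = swp x l \<circ> swp i j"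
    "place [x, i, j, k, l] [4,3,2,1,0] = swp x l \<circ> swp i k"
    "place [x, i, j, k, l] [4,1,3,2,0] = swp x l \<circ> swp j k"
  by (rule fun_eq_on_list[of _ _ "[x, i, j, k, l]"]; use assms in \<open>auto simp: place_def Transposition.transpose_def\<close>)+

lemma place5_cycle:
  assumes "distinct [x, i, j, k, l]"
  shows "place [x, i, j, k, l] [1,2,0,3,4] = swp x i \<circ> swp i j"
    "place [x, i, j, k, l] [1,3,2,0,4] = swp x i \<circ> swp i k"
    "place [x, i, j, k, l] [1,4,2,3,0] = swp x i \<circ> swp i l"
    "place [x, i, j, k, l] [2,0,1,3,4] = swp j i \<circ> swp i x"
    "place [x, i, j, k, l] [2,1,3,0,4] = swp x j \<circ> swp j k"
    "place [x, i, j, k, l] [2,1,4,3,0] = swp x j \<circ> swp j l"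
    "place [x, i, j, k, l] [3,0,2,1,4] = swp k i \<circ> swp i x"
    "place [x, i, j, k, l] [3,1,0,2,4] = swp k j \<circ> swp j x"
    "place [x, i, j, k, l] [3,1,2,4,0] = swp x k \<circ> swp k l"
    "place [x, i, j, k, l] [4,0,2,3,1] = swp l i \<circ> swp i x"
    "place [x, i, j, k, l] [4,1,0,3,2] = swp l j \<circ> swp j x"
    "place [x, i, j, k, l] [4,1,2,0,3] = swp l k \<circ> swp k x"
  by (rule fun_eq_on_list[of _ _ "[x, i, j, k, l]"]; use assms in \<open>auto simp: place_def Transposition.transpose_def\<close>)+

section \<open>Sums over tuples of distinct points\<close>

definition sum3 :: "'a set \<Rightarrow> ('a \<Rightarrow> 'a \<Rightarrow> 'a \<Rightarrow> real) \<Rightarrow> real" where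
  "sum3 Y f = (\<Sum>i\<in>Y. \<Sum>j\<in>Y. \<Sum>k\<in>Y. if distinct [i, j, k] then f i j k else 0)"

definition sum4 :: "'a set \<Rightarrow> ('a \<Rightarrow> 'a \<Rightarrow> 'a \<Rightarrow> 'a \<Rightarrow> real) \<Rightarrow> real" where
  "sum4 Y f = (\<Sum>i\<in>Y. \<Sum>j\<in>Y. \<Sum>k\<in>Y. \<Sum>l\<in>Y. if distinct [i, j, k, l] then f i j k l else 0)"

lemma sum3_swap12: "sum3 Y f = sum3 Y (\<lambda>i j k. f j i k)"
  unfolding sum3_def by (subst sum.swap) (intro sum.cong refl, auto)

lemma sum3_swap23: "sum3 Y f = sum3 Y (\<lambda>i j k. f i k j)"
  unfolding sum3_def by (rule sum.cong[OF refl], subst sum.swap) (intro sum.cong refl, auto)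

lemma sum4_swap12: "sum4 Y f = sum4 Y (\<lambda>i j k l. f j i k l)"
  unfolding sum4_def by (subst sum.swap) (intro sum.cong refl, auto)

lemma sum4_swap23: "sum4 Y f = sum4 Y (\<lambda>i j k l. f i k j l)"
  unfolding sum4_def by (rule sum.cong[OF refl], subst sum.swap) (intro sum.cong refl, auto)

lemma sum4_swap34: "sum4 Y f = sum4 Y (\<lambda>i j k l. f i j l k)"
  unfolding sum4_def by (rule sum.cong[OF refl], rule sum.cong[OF refl], subst sum.swap) (intro sum.cong refl, auto)

lemma sum3_cong: 
  "(\<And>i j k. i \<in> Y \<Longrightarrow> j \<in> Y \<Longrightarrow> k \<in> Y \<Longrightarrow> distinct [i, j, k] \<Longrightarrow> f i j k = g i j k) \<Longrightarrow> sum3 Y f = sum3 Y g"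
  unfolding sum3_def by (intro sum.cong refl if_cong) auto

lemma sum4_nonneg: 
  "(\<And>i j k l. i \<in> Y \<Longrightarrow> j \<in> Y \<Longrightarrow> k \<in> Y \<Longrightarrow> l \<in> Y \<Longrightarrow> distinct [i, j, k, l] \<Longrightarrow> 0 \<le> f i j k l) \<Longrightarrow> 0 \<le> sum4 Y f"
  unfolding sum4_def by (intro sum_nonneg) auto

lemma sum3_nonneg: 
  "(\<And>i j k. i \<in> Y \<Longrightarrow> j \<in> Y \<Longrightarrow> k \<in> Y \<Longrightarrow> distinct [i, j, k] \<Longrightarrow> 0 \<le> f i j k) \<Longrightarrow> 0 \<le> sum3 Y f"
  unfolding sum3_def by (intro sum_nonneg) auto

lemma sum3_add: "sum3 Y (\<lambda>i j k. f i j k + g i j k) = sum3 Y f + sum3 Y g"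
  unfolding sum3_def sum.distrib[symmetric] by (intro sum.cong refl) auto

lemma sum4_add: "sum4 Y (\<lambda>i j k l. f i j k l + g i j k l) = sum4 Y f + sum4 Y g"
  unfolding sum4_def sum.distrib[symmetric] by (intro sum.cong refl) auto

lemma sum3_cmult: "sum3 Y (\<lambda>i j k. a * f i j k) = a * sum3 Y f"
  unfolding sum3_def sum_distrib_left by (intro sum.cong refl) auto

lemma sum4_cmult: "sum4 Y (\<lambda>i j k l. a * f i j k l) = a * sum4 Y f"
  unfolding sum4_def sum_distrib_left by (intro sum.cong refl) auto

lemma sum4_uminus: "sum4 Y (\<lambda>i j k l. - f i j k l) = - sum4 Y f"
  using sum4_cmult[of Y "-1" f] by simp

lemma sum4_diff: "sum4 Y (\<lambda>i j k l. f i j k l - g i j k l) = sum4 Y f - sum4 Y g"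
  using sum4_add[of Y f "\<lambda>i j k l. - g i j k l"] by (simp add: sum4_uminus)

text \<open>A free fourth index either repeats one of the first three or is new. With weights of
  total zero this trades coincidences for tuples of four distinct points.\<close>

lemma sum3_sum:
  assumes "finite Y"
  shows "sum3 Y (\<lambda>i j k. \<Sum>l\<in>Y. f i j k l) = sum3 Y (\<lambda>i j k. f i j k i + f i j k j + f i j k k) + sum4 Y f"
proof -
  have "(if distinct [i, j, k] then \<Sum>l\<in>Y. f i j k l else 0) =
     (if distinct [i, j, k] then f i j k i + f i j k j + f i j k k else 0) +
     (\<Sum>l\<in>Y. if distinct [i, j, k, l] then f i j k l else 0)"
    if "i \<in> Y" "j \<in> Y" "k \<in> Y" for i j k
  proof (cases "distinct [i, j, k]")
    case True
    have "f i j k l = (if l = i then f i j k i else 0) + (if l = j then f i j k j else 0)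
       + (if l = k then f i j k k else 0) + (if distinct [i, j, k, l] then f i j k l else 0)" for l
      using True by auto
    then have "(\<Sum>l\<in>Y. f i j k l) = (\<Sum>l\<in>Y. (if l = i then f i j k i else 0) + (if l = j then f i j k j else 0)
       + (if l = k then f i j k k else 0) + (if distinct [i, j, k, l] then f i j k l else 0))"
      by (rule sum.cong[OF refl])
    then show ?thesis
      using True that assms by (simp add: sum.distrib)
  qed auto
  then show ?thesis
    unfolding sum3_def sum4_def by (simp add: sum.distrib[symmetric])
qed

lemma sum4_insert:
  assumes "finite Y" "x \<notin> Y"
  shows "sum4 (insert x Y) f = sum4 Y f + sum3 Y (\<lambda>i j k. f x i j k + f i x j k + f i j x k + f i j k x)"
proof -
  have neq: "\<And>y. y \<in> Y \<Longrightarrow> x \<noteq> y" "\<And>y. y \<in> Y \<Longrightarrow> y \<noteq> x"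
    using assms by auto
  show ?thesis
    unfolding sum3_add unfolding sum4_def sum3_def using assms(1)
    by (simp add: neq assms(2) sum.distrib cong: sum.cong)
qed

section \<open>Forms of three-cycles and double transpositions\<close>

context perm_rep
begin

definition defect :: "'v \<Rightarrow> ('a \<Rightarrow> 'a) \<Rightarrow> real" where
  "defect v s = ip (v - \<rho> s v) v"

lemma ip_rho_eq: "ip (\<rho> s v) v = ip v v - defect v s"
  by (simp add: defect_def ip_simps)

lemma defect_id [simp]: "defect v id = 0"
  by (simp add: defect_def rho_id)

lemma defect_eq_norm: "bij s \<Longrightarrow> 2 * defect v s = ip (v - \<rho> s v) (v - \<rho> s v)"
  by (simp add: defect_def ip_simps rho_isometry ip_commute[of v "\<rho> s v"])

lemma defect_nonneg: "bij s \<Longrightarrow> 0 \<le> defect v s"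
  using defect_eq_norm ip_ge_0 by (metis zero_le_mult_iff zero_less_numeral not_le)

lemma defect_inv: "bij s \<Longrightarrow> defect v (inv s) = defect v s"
  by (simp add: defect_def ip_simps ip_rho_inv)

lemma defect_cycle_rev: "defect v (swp i j \<circ> swp k l) = defect v (swp k l \<circ> swp i j)"
  using defect_inv[of "swp i j \<circ> swp k l" v] by (simp add: o_inv_distrib bij_comp)

definition cyc3 :: "'v \<Rightarrow> 'a \<Rightarrow> 'a \<Rightarrow> 'a \<Rightarrow> real" where
  "cyc3 v i j k = defect v (swp i j \<circ> swp j k)"

definition dbl :: "'v \<Rightarrow> 'a \<Rightarrow> 'a \<Rightarrow> 'a \<Rightarrow> 'a \<Rightarrow> real" where
  "dbl v i j k l = defect v (swp i j \<circ> swp k l)"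

lemma cyc3_rev: "cyc3 v i j k = cyc3 v k j i"
  unfolding cyc3_def using defect_cycle_rev by (metis transpose_commute)

lemma cyc3_rot: "distinct [i, j, k] \<Longrightarrow> cyc3 v i j k = cyc3 v j k i"
proof -
  assume "distinct [i, j, k]"
  then have "swp i j \<circ> swp j k = swp j k \<circ> swp k i"
    by (auto simp: fun_eq_iff Transposition.transpose_def)
  then show ?thesis by (simp add: cyc3_def)
qed

lemma dbl_sym: "dbl v i j k l = dbl v j i k l" "dbl v i j k l = dbl v i j l k" "dbl v i j k l = dbl v k l i j"
  unfolding dbl_def using defect_cycle_rev by (metis transpose_commute)+

text \<open>Half the quadratic form of the element \<open>coeff4\<close> at \<open>v\<close>: its
  coefficients sum to zero, so the norm of \<open>v\<close> drops out, and each three-cycle has the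
  same defect as its inverse.\<close>

definition quad :: "'v \<Rightarrow> 'a \<Rightarrow> 'a \<Rightarrow> 'a \<Rightarrow> 'a \<Rightarrow> real" where
  "quad v i j k l = cyc3 v i j k + cyc3 v i j l + cyc3 v i k l + cyc3 v j k l
     - (dbl v i j k l + dbl v i k j l + dbl v i l j k)"

lemma quad_sym:
  assumes "distinct [i, j, k, l]"
  shows "quad v i j k l = quad v j i k l" "quad v i j k l = quad v i k j l" "quad v i j k l = quad v i j l k"
proof -
  have "cyc3 v a b c = cyc3 v b a c" "cyc3 v a b c = cyc3 v a c b" if "distinct [a, b, c]" for a b c
    using that cyc3_rev[of v] cyc3_rot[of a b c v] cyc3_rot[of b a c v] cyc3_rot[of c a b v] by auto
  then show "quad v i j k l = quad v j i k l" "quad v i j k l = quad v i k j l" "quad v i j k l = quad v i j l k"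
    using assms unfolding quad_def by (smt (verit) distinct_length_2_or_more dbl_sym)+
qed

lemma quad_nonneg:
  assumes "distinct [i, j, k, l]"
  shows "0 \<le> quad v i j k l"
proof -
  have "0 \<le> (\<Sum>q\<leftarrow>support4. coeff4 q * ip (\<rho> (place [i, j, k, l] q) v) v)"
    using assms support4 square4
    by (intro group_algebra_nonneg[where m = 4 and K = 12]) (auto simp: list_all_iff set_arrangements support4_def)
  then show ?thesis
    unfolding support4_def
    by (simp add: place4_eq[OF assms] coeff4_def ip_rho_eq rho_id cyc3_def[symmetric] dbl_def[symmetric] quad_def del: One_nat_def)
      (use cyc3_rev in smt)
qed

text \<open>The difference of the two sides is exactly the quadratic form of \<open>coeff5\<close>.
  Three-cycles avoiding \<open>x\<close> cancel, and each triple through \<open>x\<close> is counted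
  twice, once for each orientation.\<close>

lemma quad5:
  assumes "distinct [x, i, j, k, l]"
  shows "quad v i j k l \<le> quad v x i j k + quad v x i j l + quad v x i k l + quad v x j k l"
proof -
  have "0 \<le> (\<Sum>q\<leftarrow>support5. coeff5 q * ip (\<rho> (place [x, i, j, k, l] q) v) v)"
    using assms support5 square5
    by (intro group_algebra_nonneg[where m = 5 and K = 12]) (auto simp: list_all_iff set_arrangements support5_def)
  then show ?thesis
    unfolding support5_def
    by (simp add: place5_double[OF assms] place5_cycle[OF assms] coeff5_def ip_rho_eq rho_id cyc3_def[symmetric] dbl_def[symmetric] quad_def del: One_nat_def)
      (use cyc3_rev in smt)
qed

end

section \<open>The square of a weighted sum of transpositions\<close>

context perm_rep
begin

lemma bij_swp [simp]: "bij (swp i j)"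
  by simp

lemma bij_swp2 [simp]: "bij (swp i j \<circ> swp k l)"
  by (simp add: bij_comp)

text \<open>Pairs of transpositions sharing one point give 3-cycles, disjoint pairs give the second sum.\<close>

lemma sum_swap_pairs:
  assumes "finite X"
  shows "(\<Sum>i\<in>X. \<Sum>j\<in>X. \<Sum>k\<in>X. \<Sum>l\<in>X. if i \<noteq> j \<and> k \<noteq> l then a i * a j * a k * a l * defect v (swp i j \<circ> swp k l) else 0) =
    sum3 X (\<lambda>i j k. 4 * (a i * a j * a k * cyc3 v i j k) * a j) + sum4 X (\<lambda>i j k l. a i * a j * a k * a l * dbl v i j k l)"
proof -
  let ?f = "\<lambda>i j k l. a i * a j * a k * a l * defect v (swp i j \<circ> swp k l)"
  \<comment> \<open>If both transpositions are the same, the product is the identity and its defect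
    is zero. What remains is no coincidence or exactly one.\<close>
  have pt: "(if i \<noteq> j \<and> k \<noteq> l then ?f i j k l else 0) =
     (if distinct [i, j, k, l] then ?f i j k l else 0)
     + (if k = i then (if distinct [i, j, l] then ?f i j i l else 0) else 0)
     + (if k = j then (if distinct [i, j, l] then ?f i j j l else 0) else 0)
     + (if l = i then (if distinct [i, j, k] then ?f i j k i else 0) else 0)
     + (if l = j then (if distinct [i, j, k] then ?f i j k j else 0) else 0)" for i j k l
    by (auto simp: transpose_commute[of j i])
  have e: "(if b then (\<Sum>l\<in>X. g l) else 0) = (\<Sum>l\<in>X. if b then g l else 0)" for b and g :: "'a \<Rightarrow> real"
    by simp
  have inner: "(\<Sum>k\<in>X. \<Sum>l\<in>X. if i \<noteq> j \<and> k \<noteq> l then ?f i j k l else 0) =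
     (\<Sum>k\<in>X. \<Sum>l\<in>X. if distinct [i, j, k, l] then ?f i j k l else 0)
     + (\<Sum>l\<in>X. if distinct [i, j, l] then ?f i j i l else 0)
     + (\<Sum>l\<in>X. if distinct [i, j, l] then ?f i j j l else 0)
     + (\<Sum>k\<in>X. if distinct [i, j, k] then ?f i j k i else 0)
     + (\<Sum>k\<in>X. if distinct [i, j, k] then ?f i j k j else 0)" if "i \<in> X" "j \<in> X" for i j
    unfolding pt sum.distrib using assms that
    by (simp add: e[symmetric] sum.delta' del: distinct.simps)
  have "(\<Sum>i\<in>X. \<Sum>j\<in>X. \<Sum>k\<in>X. \<Sum>l\<in>X. if i \<noteq> j \<and> k \<noteq> l then ?f i j k l else 0) =
      sum4 X ?f + sum3 X (\<lambda>i j l. ?f i j i l) + sum3 X (\<lambda>i j l. ?f i j j l)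
       + sum3 X (\<lambda>i j k. ?f i j k i) + sum3 X (\<lambda>i j k. ?f i j k j)"
    unfolding sum3_def sum4_def sum.distrib[symmetric]
    by (rule sum.cong[OF refl], rule sum.cong[OF refl], rule inner[unfolded sum.distrib[symmetric]])
  also have "sum3 X (\<lambda>i j k. ?f i j k i) = sum3 X (\<lambda>i j l. ?f i j i l)"
    by (rule sum3_cong) (simp add: transpose_commute mult_ac)
  also have "sum3 X (\<lambda>i j k. ?f i j k j) = sum3 X (\<lambda>i j l. ?f i j j l)"
    by (rule sum3_cong) (simp add: transpose_commute mult_ac)
  also have "sum3 X (\<lambda>i j l. ?f i j i l) = sum3 X (\<lambda>i j l. ?f i j j l)"
    by (subst sum3_swap12) (rule sum3_cong, simp add: transpose_commute mult_ac)
  finally have "(\<Sum>i\<in>X. \<Sum>j\<in>X. \<Sum>k\<in>X. \<Sum>l\<in>X. if i \<noteq> j \<and> k \<noteq> l then ?f i j k l else 0) =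
     4 * sum3 X (\<lambda>i j l. ?f i j j l) + sum4 X ?f"
    by (simp add: comp_def)
  then show ?thesis
    by (simp add: sum3_cmult[symmetric] cyc3_def dbl_def mult_ac)
qed

text \<open>As the weights sum to zero, the terms with three indices turn into terms with four.\<close>

lemma sum3_cyc3:
  assumes "finite X" "sum a X = 0"
  shows "3 * sum3 X (\<lambda>i j k. 4 * (a i * a j * a k * cyc3 v i j k) * a j) =
    - sum4 X (\<lambda>i j k l. a i * a j * a k * a l * (cyc3 v i j k + cyc3 v i j l + cyc3 v i k l + cyc3 v j k l))"
proof -
  let ?H = "\<lambda>i j k. a i * a j * a k * cyc3 v i j k"
  have H: "?H i j k = ?H j i k" "?H i j k = ?H i k j" if "distinct [i, j, k]" for i j k
  proof -
    have "cyc3 v i j k = cyc3 v j i k" "cyc3 v i j k = cyc3 v i k j"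
      using that cyc3_rev[of v] cyc3_rot[of i j k v] cyc3_rot[of j i k v] cyc3_rot[of k i j v] by auto
    then show "?H i j k = ?H j i k" "?H i j k = ?H i k j"
      by auto
  qed
  have 1: "sum3 X (\<lambda>i j k. ?H i j k * a i) = sum3 X (\<lambda>i j k. ?H i j k * a j)"
    by (subst sum3_swap12) (rule sum3_cong, use H in auto)
  have 2: "sum3 X (\<lambda>i j k. ?H i j k * a k) = sum3 X (\<lambda>i j k. ?H i j k * a j)"
    by (subst sum3_swap23) (rule sum3_cong, use H in auto)
  have "0 = sum3 X (\<lambda>i j k. \<Sum>l\<in>X. ?H i j k * a l)"
    by (simp add: sum_distrib_left[symmetric] assms(2) sum3_def)
  also have "\<dots> = 3 * sum3 X (\<lambda>i j k. ?H i j k * a j) + sum4 X (\<lambda>i j k l. ?H i j k * a l)"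
    unfolding sum3_sum[OF assms(1)] sum3_add 1 2 by simp
  finally have main: "3 * sum3 X (\<lambda>i j k. ?H i j k * a j) = - sum4 X (\<lambda>i j k l. ?H i j k * a l)"
    by simp
  let ?A = "\<lambda>i j k l. a i * a j * a k * a l"
  have h1: "sum4 X (\<lambda>i j k l. ?A i j k l * cyc3 v i j k) = sum4 X (\<lambda>i j k l. ?A i j k l * cyc3 v i j l)"
    by (subst sum4_swap34) (simp add: mult_ac)
  have h2: "sum4 X (\<lambda>i j k l. ?A i j k l * cyc3 v i j l) = sum4 X (\<lambda>i j k l. ?A i j k l * cyc3 v i k l)"
    by (subst sum4_swap23) (simp add: mult_ac)
  have h3: "sum4 X (\<lambda>i j k l. ?A i j k l * cyc3 v i k l) = sum4 X (\<lambda>i j k l. ?A i j k l * cyc3 v j k l)"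
    by (subst sum4_swap12) (simp add: mult_ac)
  have "sum4 X (\<lambda>i j k l. ?A i j k l * (cyc3 v i j k + cyc3 v i j l + cyc3 v i k l + cyc3 v j k l)) =
      4 * sum4 X (\<lambda>i j k l. ?A i j k l * cyc3 v i j k)"
    unfolding distrib_left sum4_add h1 h2 h3 by simp
  moreover have "sum3 X (\<lambda>i j k. 4 * (a i * a j * a k * cyc3 v i j k) * a j) = 4 * sum3 X (\<lambda>i j k. ?H i j k * a j)"
    by (simp add: sum3_cmult[symmetric] mult_ac)
  ultimately show ?thesis
    using main by (simp add: mult_ac)
qed

lemma sum4_dbl:
  "3 * sum4 X (\<lambda>i j k l. a i * a j * a k * a l * dbl v i j k l) =
   sum4 X (\<lambda>i j k l. a i * a j * a k * a l * (dbl v i j k l + dbl v i k j l + dbl v i l j k))"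
proof -
  let ?A = "\<lambda>i j k l. a i * a j * a k * a l"
  have h1: "sum4 X (\<lambda>i j k l. ?A i j k l * dbl v i j k l) = sum4 X (\<lambda>i j k l. ?A i j k l * dbl v i k j l)"
    by (subst sum4_swap23) (simp add: mult_ac)
  have h2: "sum4 X (\<lambda>i j k l. ?A i j k l * dbl v i k j l) = sum4 X (\<lambda>i j k l. ?A i j k l * dbl v i l j k)"
    by (subst sum4_swap34) (simp add: mult_ac)
  show ?thesis
    unfolding distrib_left sum4_add h1 h2 by simp
qed

text \<open>The only negative weight is \<open>a x\<close>. Replacing it by minus the sum over
  \<open>Y\<close> leaves, up to positive factors, coincidence terms that are nonnegative by
  \<open>quad_nonneg\<close>, and a sum over four distinct points of the difference that
  \<open>quad5\<close> bounds.\<close>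

lemma sum_swap_pairs_nonneg:
  assumes "finite Y" "x \<notin> Y" and nn: "\<And>y. y \<in> Y \<Longrightarrow> 0 \<le> a y" and x: "a x = - sum a Y"
  shows "0 \<le> (\<Sum>i\<in>insert x Y. \<Sum>j\<in>insert x Y. \<Sum>k\<in>insert x Y. \<Sum>l\<in>insert x Y.
     if i \<noteq> j \<and> k \<noteq> l then a i * a j * a k * a l * defect v (swp i j \<circ> swp k l) else 0)"
    (is "0 \<le> ?S")
proof -
  let ?X = "insert x Y"
  let ?A = "\<lambda>i j k l. a i * a j * a k * a l"
  let ?B = "\<lambda>i j k. a i * a j * a k * quad v x i j k"
  have q: "quad v i x j k = quad v x i j k" "quad v i j x k = quad v x i j k" "quad v i j k x = quad v x i j k"
    if "i \<in> Y" "j \<in> Y" "k \<in> Y" "distinct [i, j, k]" for i j k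
  proof -
    have "distinct [x, i, j, k]" "distinct [i, x, j, k]" "distinct [i, j, x, k]"
      using that assms(2) by auto
    then show "quad v i x j k = quad v x i j k" "quad v i j x k = quad v x i j k" "quad v i j k x = quad v x i j k"
      using quad_sym(1)[of x i j k v] quad_sym(2)[of i x j k v] quad_sym(3)[of i j x k v] by metis+
  qed
  have "finite ?X" "sum a ?X = 0"
    using assms by simp_all
  then have "3 * ?S = sum4 ?X (\<lambda>i j k l. ?A i j k l * (dbl v i j k l + dbl v i k j l + dbl v i l j k))
     - sum4 ?X (\<lambda>i j k l. ?A i j k l * (cyc3 v i j k + cyc3 v i j l + cyc3 v i k l + cyc3 v j k l))"
    unfolding sum_swap_pairs[OF \<open>finite ?X\<close>] distrib_left sum3_cyc3[OF \<open>finite ?X\<close> \<open>sum a ?X = 0\<close>]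
      sum4_dbl distrib_left[of _ _ "dbl _ _ _ _ _"] by (simp add: sum4_dbl[unfolded distrib_left])
  also have "\<dots> = - sum4 ?X (\<lambda>i j k l. ?A i j k l * quad v i j k l)"
    unfolding sum4_diff[symmetric] sum4_uminus[symmetric] quad_def
    by (rule arg_cong[where f = "sum4 ?X"]) (simp add: fun_eq_iff algebra_simps)
  also have "sum4 ?X (\<lambda>i j k l. ?A i j k l * quad v i j k l) =
      sum4 Y (\<lambda>i j k l. ?A i j k l * quad v i j k l) + sum3 Y (\<lambda>i j k. 4 * a x * ?B i j k)"
    unfolding sum4_insert[OF assms(1,2)]
    by (intro arg_cong2[where f = "(+)"] refl sum3_cong) (simp add: q)
  also have "sum3 Y (\<lambda>i j k. 4 * a x * ?B i j k) = - (4 * sum3 Y (\<lambda>i j k. \<Sum>l\<in>Y. ?B i j k * a l))"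
  proof -
    have "4 * a x * ?B i j k = (- 4) * (\<Sum>l\<in>Y. ?B i j k * a l)" for i j k
      by (simp add: x sum_distrib_left[symmetric])
    then show ?thesis
      by (simp only: sum3_cmult)
  qed
  also have "sum3 Y (\<lambda>i j k. \<Sum>l\<in>Y. ?B i j k * a l) =
     sum3 Y (\<lambda>i j k. ?B i j k * a i + ?B i j k * a j + ?B i j k * a k) + sum4 Y (\<lambda>i j k l. ?B i j k * a l)"
    by (rule sum3_sum[OF assms(1)])
  finally have S: "3 * ?S = 4 * sum3 Y (\<lambda>i j k. ?B i j k * a i + ?B i j k * a j + ?B i j k * a k)
     + (4 * sum4 Y (\<lambda>i j k l. ?B i j k * a l) - sum4 Y (\<lambda>i j k l. ?A i j k l * quad v i j k l))"
    by simp
  have "0 \<le> ?B i j k" if "i \<in> Y" "j \<in> Y" "k \<in> Y" "distinct [i, j, k]" for i j k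
    using that assms(2) nn quad_nonneg[of x i j k v] by (intro mult_nonneg_nonneg) auto
  then have T: "0 \<le> sum3 Y (\<lambda>i j k. ?B i j k * a i + ?B i j k * a j + ?B i j k * a k)"
    by (intro sum3_nonneg) (simp add: nn)
  have h1: "sum4 Y (\<lambda>i j k l. ?A i j k l * quad v x i j k) = sum4 Y (\<lambda>i j k l. ?A i j k l * quad v x i j l)"
    by (subst sum4_swap34) (simp add: mult_ac)
  have h2: "sum4 Y (\<lambda>i j k l. ?A i j k l * quad v x i j l) = sum4 Y (\<lambda>i j k l. ?A i j k l * quad v x i k l)"
    by (subst sum4_swap23) (simp add: mult_ac)
  have h3: "sum4 Y (\<lambda>i j k l. ?A i j k l * quad v x i k l) = sum4 Y (\<lambda>i j k l. ?A i j k l * quad v x j k l)"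
    by (subst sum4_swap12) (simp add: mult_ac)
  have "4 * sum4 Y (\<lambda>i j k l. ?B i j k * a l) =
     sum4 Y (\<lambda>i j k l. ?A i j k l * (quad v x i j k + quad v x i j l + quad v x i k l + quad v x j k l))"
    unfolding distrib_left sum4_add using h1 h2 h3 by (simp add: mult_ac)
  then have "4 * sum4 Y (\<lambda>i j k l. ?B i j k * a l) - sum4 Y (\<lambda>i j k l. ?A i j k l * quad v i j k l) =
     sum4 Y (\<lambda>i j k l. ?A i j k l * (quad v x i j k + quad v x i j l + quad v x i k l + quad v x j k l - quad v i j k l))"
    by (simp add: sum4_diff[symmetric] right_diff_distrib)
  also have "\<dots> \<ge> 0"
  proof (rule sum4_nonneg)
    fix i j k l assume "i \<in> Y" "j \<in> Y" "k \<in> Y" "l \<in> Y" "distinct [i, j, k, l]"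
    then show "0 \<le> ?A i j k l * (quad v x i j k + quad v x i j l + quad v x i k l + quad v x j k l - quad v i j k l)"
      using quad5[of x i j k l v] assms(2) nn by (intro mult_nonneg_nonneg) auto
  qed
  finally show ?thesis
    using S T by simp
qed

text \<open>This is the passage from \<open>B\<^sup>2 \<le> q\<^sup>2\<close> to positivity of
  \<open>q + B\<close> on a single vector, by expanding the squared norm of
  \<open>q *\<^sub>R v + u\<close>. A factor \<open>q\<close> is cancelled at the end, hence the
  separate case \<open>q = 0\<close>.\<close>

lemma norm_bound_imp_nonneg:
  assumes "ip u u \<le> q\<^sup>2 * ip v v" "q \<ge> 0"
  shows "0 \<le> q * ip v v + ip u v"
proof (cases "q = 0")
  case True
  then have "u = 0"
    using assms(1) ip_pos[of u] by force
  then show ?thesis using True by simp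
next
  case False
  have "0 \<le> ip (q *\<^sub>R v + u) (q *\<^sub>R v + u)"
    by (rule ip_ge_0)
  also have "\<dots> = q\<^sup>2 * ip v v + 2 * q * ip u v + ip u u"
    by (simp add: ip_simps ip_commute[of v u] power2_eq_square algebra_simps)
  also have "\<dots> \<le> 2 * q * (q * ip v v + ip u v)"
    using assms(1) by (simp add: power2_eq_square algebra_simps)
  finally show ?thesis
    using False assms(2) by (simp add: zero_le_mult_iff)
qed

text \<open>Giving the hub \<open>x\<close> the weight minus the sum of the others, the claim becomes the positivity of
  \<open>q + B\<close>, where \<open>q\<close> is the sum of the squared weights and \<open>B\<close> the weighted sum of all transpositions.
  This follows from \<open>B\<^sup>2 \<le> q\<^sup>2\<close>, which is an inequality in the alternating group.\<close>

theorem octopus: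
  assumes "finite Y" "x \<notin> Y" "\<And>y. y \<in> Y \<Longrightarrow> 0 \<le> c y"
  shows "(\<Sum>y\<in>Y. \<Sum>z\<in>Y. c y * c z * defect v (swp y z)) \<le> 2 * sum c Y * (\<Sum>y\<in>Y. c y * defect v (swp x y))"
proof -
  define a where "a = c(x := - sum c Y)"
  have aY: "a y = c y" if "y \<in> Y" for y
    using that assms(2) by (auto simp: a_def)
  have sumaY: "sum a Y = sum c Y"
    using aY by simp
  have ax: "a x = - sum a Y"
    unfolding sumaY by (simp add: a_def)
  let ?X = "insert x Y"
  let ?w = "\<lambda>i j. if i \<noteq> j then a i * a j else 0"
  define q where "q = (\<Sum>i\<in>?X. (a i)\<^sup>2)"
  define u where "u = (\<Sum>i\<in>?X. \<Sum>j\<in>?X. ?w i j *\<^sub>R \<rho> (swp i j) v)"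
  have finX: "finite ?X" and sumX: "sum a ?X = 0"
    using assms(1,2) ax by simp_all
  have q: "q \<ge> 0"
    by (simp add: q_def sum_nonneg)
  \<comment> \<open>The off-diagonal products add up to the square of the total weight, which is
    zero, minus the diagonal \<open>q\<close>.\<close>
  have "(\<Sum>i\<in>?X. \<Sum>j\<in>?X. ?w i j) = (\<Sum>i\<in>?X. \<Sum>j\<in>?X. a i * a j - (if j = i then (a i)\<^sup>2 else 0))"
    by (intro sum.cong refl) (auto simp: power2_eq_square)
  also have "\<dots> = (\<Sum>i\<in>?X. \<Sum>j\<in>?X. a i * a j) - q"
    unfolding sum_subtractf q_def using finX by simp
  also have "(\<Sum>i\<in>?X. \<Sum>j\<in>?X. a i * a j) = 0"
    by (simp only: sum_product[symmetric] sumX)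
  finally have w: "(\<Sum>i\<in>?X. \<Sum>j\<in>?X. ?w i j) = - q"
    by simp
  have "ip u u = (\<Sum>i\<in>?X. \<Sum>j\<in>?X. \<Sum>k\<in>?X. \<Sum>l\<in>?X. ?w i j * ?w k l * ip (\<rho> (swp i j \<circ> swp k l) v) v)"
    unfolding u_def ip_sum_left ip_sum_right
    by (intro sum.cong refl) (simp add: ip_simps rho_comp rho_adjoint del: sum.insert)
  also have "\<dots> = (\<Sum>i\<in>?X. \<Sum>j\<in>?X. \<Sum>k\<in>?X. \<Sum>l\<in>?X. ?w i j * ?w k l * ip v v) -
      (\<Sum>i\<in>?X. \<Sum>j\<in>?X. \<Sum>k\<in>?X. \<Sum>l\<in>?X. ?w i j * ?w k l * defect v (swp i j \<circ> swp k l))"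
    unfolding sum_subtractf[symmetric] ip_rho_eq right_diff_distrib ..
  also have "(\<Sum>i\<in>?X. \<Sum>j\<in>?X. \<Sum>k\<in>?X. \<Sum>l\<in>?X. ?w i j * ?w k l * ip v v) =
     (\<Sum>i\<in>?X. \<Sum>j\<in>?X. ?w i j) * (\<Sum>k\<in>?X. \<Sum>l\<in>?X. ?w k l) * ip v v"
    by (simp only: sum_distrib_left sum_distrib_right) (intro sum.cong refl, simp)
  also have "\<dots> = q\<^sup>2 * ip v v"
    by (simp only: w) (simp add: power2_eq_square)
  also have "(\<Sum>i\<in>?X. \<Sum>j\<in>?X. \<Sum>k\<in>?X. \<Sum>l\<in>?X. ?w i j * ?w k l * defect v (swp i j \<circ> swp k l)) =
     (\<Sum>i\<in>?X. \<Sum>j\<in>?X. \<Sum>k\<in>?X. \<Sum>l\<in>?X. if i \<noteq> j \<and> k \<noteq> l then a i * a j * a k * a l * defect v (swp i j \<circ> swp k l) else 0)"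
    by (intro sum.cong refl) auto
  finally have "ip u u \<le> q\<^sup>2 * ip v v"
    using sum_swap_pairs_nonneg[OF assms(1,2) _ ax, of v] assms(3) aY by simp
  from norm_bound_imp_nonneg[OF this q] have "0 \<le> q * ip v v + ip u v" .
  also have "ip u v = (\<Sum>i\<in>?X. \<Sum>j\<in>?X. ?w i j * ip v v) - (\<Sum>i\<in>?X. \<Sum>j\<in>?X. ?w i j * defect v (swp i j))"
    unfolding u_def ip_sum_left ip_scale_left ip_rho_eq right_diff_distrib sum_subtractf ..
  also have "(\<Sum>i\<in>?X. \<Sum>j\<in>?X. ?w i j * ip v v) = - q * ip v v"
    by (simp only: w sum_distrib_right[symmetric])
  also have "(\<Sum>i\<in>?X. \<Sum>j\<in>?X. ?w i j * defect v (swp i j)) = (\<Sum>i\<in>?X. \<Sum>j\<in>?X. a i * a j * defect v (swp i j))"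
    by (intro sum.cong refl) auto
  also have "\<dots> = (\<Sum>i\<in>Y. \<Sum>j\<in>Y. a i * a j * defect v (swp i j)) + 2 * a x * (\<Sum>y\<in>Y. a y * defect v (swp x y))"
    using assms(1,2) by (simp add: sum.distrib sum_distrib_left transpose_commute[of _ x] mult_ac)
  finally have "(\<Sum>i\<in>Y. \<Sum>j\<in>Y. a i * a j * defect v (swp i j)) + 2 * a x * (\<Sum>y\<in>Y. a y * defect v (swp x y)) \<le> 0"
    by simp
  then show ?thesis
    by (simp add: aY ax cong: sum.cong)
qed

end

section \<open>The spectral gap of the interchange process\<close>

lemma lap_swp:
  assumes "finite X" "weights_on X c" "y \<in> X"
  shows "(\<Sum>i\<in>X. \<Sum>j\<in>X. c i j * (f y - f (swp i j y))) = 2 * lap X c f y"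
proof -
  have e: "(if P then (\<Sum>l\<in>X. g l) else 0) = (\<Sum>l\<in>X. if P then g l else 0)" for P and g :: "'a \<Rightarrow> real"
    by simp
  have "c i j * (f y - f (swp i j y)) =
     (if i = y then c y j * (f y - f j) else 0) + (if j = y then c i y * (f y - f i) else 0)" for i j
    by (auto simp: Transposition.transpose_def)
  then have "(\<Sum>i\<in>X. \<Sum>j\<in>X. c i j * (f y - f (swp i j y))) =
     lap X c f y + (\<Sum>i\<in>X. c i y * (f y - f i))"
    using assms by (simp add: sum.distrib e[symmetric] lap_def)
  also have "(\<Sum>i\<in>X. c i y * (f y - f i)) = lap X c f y"
    unfolding lap_def using weights_on_sym[OF assms(2)] assms(3) by (intro sum.cong) auto
  finally show ?thesis by simp
qed

text \<open>The two Laplacians treat the edge between \<open>a\<close> and \<open>b\<close> as two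
  separate moves, leading to the entries \<open>F b b\<close> and \<open>F a a\<close>, which
  vanish. The transposition really exchanges both arguments at once, and the last term corrects for
  this.\<close>

lemma lap_swp_pair:
  fixes F :: "'a \<Rightarrow> 'a \<Rightarrow> real"
  assumes "finite X" "weights_on X c" "a \<in> X" "b \<in> X" "a \<noteq> b" "F a a = 0" "F b b = 0"
  shows "(\<Sum>i\<in>X. \<Sum>j\<in>X. c i j * (F a b - F (swp i j a) (swp i j b))) =
    2 * (lap X c (\<lambda>z. F z b) a + lap X c (F a) b - c a b * (F a b + F b a))"
proof -
  have ba: "c b a = c a b"
    using weights_on_sym[OF assms(2)] assms by auto
  have e: "(if P then (\<Sum>l\<in>X. g l) else 0) = (\<Sum>l\<in>X. if P then g l else 0)" for P and g :: "'a \<Rightarrow> real"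
    by simp
  have "c i j * (F a b - F (swp i j a) (swp i j b)) =
     (if i = a then c a j * (F a b - F j b) else 0) + (if j = a then c i a * (F a b - F i b) else 0)
    + (if i = b then c b j * (F a b - F a j) else 0) + (if j = b then c i b * (F a b - F a i) else 0)
    - (if i = a then if j = b then c a b * (F a b + F b a) else 0 else 0)
    - (if i = b then if j = a then c a b * (F a b + F b a) else 0 else 0)" for i j
    using assms(5-7) ba by (auto simp: Transposition.transpose_def algebra_simps)
  then have "(\<Sum>i\<in>X. \<Sum>j\<in>X. c i j * (F a b - F (swp i j a) (swp i j b))) =
     lap X c (\<lambda>z. F z b) a + (\<Sum>i\<in>X. c i a * (F a b - F i b)) + lap X c (F a) b
     + (\<Sum>i\<in>X. c i b * (F a b - F a i)) - 2 * (c a b * (F a b + F b a))"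
    using assms(1,3,4) by (simp add: sum.distrib sum_subtractf e[symmetric] lap_def)
  also have "(\<Sum>i\<in>X. c i a * (F a b - F i b)) = lap X c (\<lambda>z. F z b) a"
    unfolding lap_def using weights_on_sym[OF assms(2)] assms(3) by (intro sum.cong) auto
  also have "(\<Sum>i\<in>X. c i b * (F a b - F a i)) = lap X c (F a) b"
    unfolding lap_def using weights_on_sym[OF assms(2)] assms(4) by (intro sum.cong) auto
  finally show ?thesis by simp
qed

context perm_rep
begin

definition ich :: "'a set \<Rightarrow> ('a \<Rightarrow> 'a \<Rightarrow> real) \<Rightarrow> 'v \<Rightarrow> 'v" where
  "ich X c v = (1 / 2) *\<^sub>R (\<Sum>i\<in>X. \<Sum>j\<in>X. c i j *\<^sub>R (v - \<rho> (swp i j) v))"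

lemma linear_ich: "linear (ich X c)"
  unfolding ich_def
  by (intro linear_compose_scale_right linear_compose_sum ballI linear_compose_sub
      linear_id[unfolded id_def] rho_linear bij_swp)

lemma ip_ich: "ip (ich X c v) v = (\<Sum>i\<in>X. \<Sum>j\<in>X. c i j * defect v (swp i j)) / 2"
  by (simp add: ich_def ip_simps ip_sum_left defect_def)

lemma ich_symmetric: "ip (ich X c u) v = ip u (ich X c v)"
proof -
  have "ip (\<rho> (swp i j) u) v = ip u (\<rho> (swp i j) v)" for i j
    by (simp add: rho_adjoint)
  then show ?thesis
    by (simp add: ich_def ip_simps ip_sum_left ip_sum_right)
qed

lemma ip_ich_nonneg: "weights_on X c \<Longrightarrow> 0 \<le> ip (ich X c v) v"
  unfolding ip_ich
  by (intro divide_nonneg_pos sum_nonneg mult_nonneg_nonneg defect_nonneg) (auto simp: weights_on_def)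

text \<open>The octopus inequality divided by the hub weight: deleting \<open>x\<close> removes its
  star and adds the complete graph with weights
  \<open>c x y * c x z / hub_weight X c x\<close>.\<close>

lemma ich_reduce_le:
  assumes "finite X" "x \<in> X" "weights_on X c" "hub_weight X c x > 0"
  shows "ip (ich (X - {x}) (reduce X c x) v) v \<le> ip (ich X c v) v"
proof -
  let ?Y = "X - {x}"
  let ?h = "hub_weight X c x"
  let ?d = "\<lambda>i j. defect v (swp i j)"
  have "(\<Sum>i\<in>?Y. \<Sum>j\<in>?Y. c x i * c x j * ?d i j) \<le> 2 * ?h * (\<Sum>y\<in>?Y. c x y * ?d x y)"
    unfolding hub_weight_def using assms by (intro octopus) (auto simp: weights_on_def)
  then have "(\<Sum>i\<in>?Y. \<Sum>j\<in>?Y. c x i * c x j * ?d i j) / ?h \<le> 2 * (\<Sum>y\<in>?Y. c x y * ?d x y)"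
    using assms(4) by (simp add: divide_le_eq mult_ac)
  moreover have "(\<Sum>i\<in>?Y. \<Sum>j\<in>?Y. reduce X c x i j * ?d i j) =
      (\<Sum>i\<in>?Y. \<Sum>j\<in>?Y. c i j * ?d i j) + (\<Sum>i\<in>?Y. \<Sum>j\<in>?Y. c x i * c x j * ?d i j) / ?h"
    by (simp add: reduce_def distrib_right sum.distrib sum_divide_distrib)
  moreover have "(\<Sum>i\<in>X. \<Sum>j\<in>X. c i j * ?d i j) =
     (\<Sum>i\<in>?Y. \<Sum>j\<in>?Y. c i j * ?d i j) + 2 * (\<Sum>y\<in>?Y. c x y * ?d x y)"
  proof -
    have "(\<Sum>i\<in>?Y. c i x * ?d i x) = (\<Sum>y\<in>?Y. c x y * ?d x y)"
      using weights_on_sym[OF assms(3)] assms(2) by (intro sum.cong) (auto simp: transpose_commute)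
    then show ?thesis
      using assms(1,2) by (simp add: sum.remove[of X x] sum.distrib)
  qed
  ultimately show ?thesis
    unfolding ip_ich by linarith
qed

section \<open>Sums over cosets in the permutation group\<close>

definition gsum :: "'a set \<Rightarrow> (('a \<Rightarrow> 'a) \<Rightarrow> bool) \<Rightarrow> 'v \<Rightarrow> 'v" where
  "gsum X Q v = (\<Sum>s | s permutes X \<and> Q s. \<rho> s v)"

abbreviation total :: "'a set \<Rightarrow> 'v \<Rightarrow> 'v" where
  "total X \<equiv> gsum X (\<lambda>_. True)"

lemma linear_gsum: "linear (gsum X Q)"
  unfolding gsum_def by (intro linear_compose_sum ballI rho_linear) (auto intro: permutes_bij)

text \<open>Right translation only changes the condition on the permutations. When
  \<open>Q s\<close> says \<open>s y = p\<close>, acting on the vector moves the point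
  \<open>y\<close>, so coset sums behave like functions of a position.\<close>

lemma gsum_rho:
  assumes "t permutes X"
  shows "gsum X Q (\<rho> t v) = gsum X (\<lambda>s. Q (s \<circ> inv t)) v"
proof -
  have inv: "inv t permutes X" "inv t \<circ> t = id" "t \<circ> inv t = id"
    using assms by (auto simp: permutes_inv permutes_inv_o)
  show ?thesis
    unfolding gsum_def
  proof (rule sum.reindex_bij_witness[of _ "\<lambda>s. s \<circ> inv t" "\<lambda>s. s \<circ> t"])
    fix s assume s: "s \<in> {s. s permutes X \<and> Q s}"
    show "(s \<circ> t) \<circ> inv t = s"
      by (simp add: comp_assoc inv)
    then show "s \<circ> t \<in> {s. s permutes X \<and> Q (s \<circ> inv t)}"
      using s assms by (auto intro: permutes_compose)
    show "\<rho> (s \<circ> t) v = \<rho> s (\<rho> t v)"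
      using s assms by (auto intro!: rho_comp permutes_bij)
  next
    fix s assume s: "s \<in> {s. s permutes X \<and> Q (s \<circ> inv t)}"
    show "(s \<circ> inv t) \<circ> t = s"
      by (simp add: comp_assoc inv)
    show "s \<circ> inv t \<in> {s. s permutes X \<and> Q s}"
      using s inv(1) by (auto intro: permutes_compose)
  qed
qed

lemma gsum_swp:
  assumes "i \<in> X" "j \<in> X"
  shows "gsum X Q (\<rho> (swp i j) v) = gsum X (\<lambda>s. Q (s \<circ> swp i j)) v"
  using gsum_rho[OF permutes_swap_id[OF assms], of Q v] by simp

lemma gsum_ich:
  assumes "Y \<subseteq> X"
  shows "2 *\<^sub>R gsum X Q (ich Y c v) =
    (\<Sum>i\<in>Y. \<Sum>j\<in>Y. c i j *\<^sub>R (gsum X Q v - gsum X (\<lambda>s. Q (s \<circ> swp i j)) v))"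
  unfolding ich_def
  by (simp add: linear_scale[OF linear_gsum] linear_sum[OF linear_gsum] linear_diff[OF linear_gsum])
    (intro sum.cong refl, use assms in \<open>auto simp: gsum_swp subset_iff\<close>)

lemma gsum_fixing:
  assumes "x \<in> X"
  shows "gsum X (\<lambda>s. s x = x \<and> Q s) v = gsum (X - {x}) Q v"
proof -
  have "s permutes X \<and> s x = x \<longleftrightarrow> s permutes (X - {x})" for s
    using assms permutes_superset[of s X "X - {x}"] permutes_subset[of s "X - {x}" X]
      permutes_not_in[of s "X - {x}" x] by auto
  then have "{s. s permutes X \<and> s x = x \<and> Q s} = {s. s permutes (X - {x}) \<and> Q s}"
    by auto
  then show ?thesis
    by (simp add: gsum_def)
qed

lemma total_fixing: "x \<in> X \<Longrightarrow> gsum X (\<lambda>s. s x = x) v = total (X - {x}) v"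
  using gsum_fixing[of x X "\<lambda>_. True"] by simp

lemma gsum_split:
  assumes "finite X" "p \<in> X"
  shows "(\<Sum>y\<in>X. gsum X (\<lambda>s. s y = p \<and> Q s) v) = gsum X Q v"
proof -
  have fin: "finite {s. s permutes X}"
    using assms by (simp add: finite_permutations)
  have "gsum X (\<lambda>s. s y = p \<and> Q s) v = (\<Sum>s | s permutes X. if s y = p then (if Q s then \<rho> s v else 0) else 0)" for y
    unfolding gsum_def using fin by (subst sum.inter_filter[symmetric]) (auto intro!: sum.cong simp: sum.inter_filter[symmetric])
  then have "(\<Sum>y\<in>X. gsum X (\<lambda>s. s y = p \<and> Q s) v) =
     (\<Sum>s | s permutes X. \<Sum>y\<in>X. if s y = p then (if Q s then \<rho> s v else 0) else 0)"
    by (simp add: sum.swap[of _ X])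
  also have "\<dots> = (\<Sum>s | s permutes X. if Q s then \<rho> s v else 0)"
  proof (rule sum.cong[OF refl])
    fix s assume "s \<in> {s. s permutes X}"
    then have s: "s permutes X" by simp
    have "s y = p \<longleftrightarrow> y = inv s p" for y
      using s permutes_inverses[OF s] by metis
    moreover have "inv s p \<in> X"
      using permutes_inv[OF s] assms(2) by (simp add: permutes_in_image)
    ultimately show "(\<Sum>y\<in>X. if s y = p then (if Q s then \<rho> s v else 0) else 0) = (if Q s then \<rho> s v else 0)"
      using assms(1) by simp
  qed
  also have "\<dots> = gsum X Q v"
    unfolding gsum_def using fin by (simp add: sum.inter_filter[symmetric])
  finally show ?thesis .
qed

lemma total_rho: "t permutes X \<Longrightarrow> total X (\<rho> t v) = total X v"
  by (simp add: gsum_rho)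

text \<open>The permutations sending \<open>x\<close> to \<open>p\<close> are the coset of the
  stabilizer of \<open>x\<close> represented by the transposition. One vanishing stabilizer sum
  therefore kills the coset sums at \<open>x\<close> for all \<open>p\<close>.\<close>

lemma gsum_transport:
  assumes "x \<in> X" "p \<in> X"
  shows "gsum X (\<lambda>s. s x = p) v = \<rho> (swp x p) (total (X - {x}) v)"
proof -
  have sw: "swp x p permutes X"
    using assms by (rule permutes_swap_id)
  have "gsum X (\<lambda>s. s x = p) v = (\<Sum>s | s permutes X \<and> s x = x. \<rho> (swp x p \<circ> s) v)"
    unfolding gsum_def
    by (rule sum.reindex_bij_witness[of _ "\<lambda>s. swp x p \<circ> s" "\<lambda>s. swp x p \<circ> s"])
      (auto simp: comp_assoc[symmetric] permutes_compose[OF _ sw])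
  also have "\<dots> = (\<Sum>s | s permutes X \<and> s x = x. \<rho> (swp x p) (\<rho> s v))"
    by (intro sum.cong refl rho_comp) (auto intro: permutes_bij)
  also have "\<dots> = \<rho> (swp x p) (gsum X (\<lambda>s. s x = x) v)"
    by (simp add: gsum_def linear_sum[OF rho_linear])
  finally show ?thesis
    by (simp add: total_fixing assms)
qed

text \<open>Pairing with \<open>u\<close> makes the coset sums scalar. By \<open>gsum_ich\<close>
  the operator then acts on the position \<open>y\<close> alone, where \<open>lap_swp\<close>
  identifies it with the Laplacian.\<close>

lemma lap_gsum:
  assumes "finite X" "weights_on X c" "y \<in> X" "ich X c v = l *\<^sub>R v"
  shows "lap X c (\<lambda>y. ip (gsum X (\<lambda>s. s y = p) v) u) y = l * ip (gsum X (\<lambda>s. s y = p) v) u"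
proof -
  let ?F = "\<lambda>y. ip (gsum X (\<lambda>s. s y = p) v) u"
  have "2 * l * ?F y = ip (2 *\<^sub>R gsum X (\<lambda>s. s y = p) (ich X c v)) u"
    by (simp add: assms(4) linear_scale[OF linear_gsum] ip_simps)
  also have "\<dots> = (\<Sum>i\<in>X. \<Sum>j\<in>X. c i j * (?F y - ?F (swp i j y)))"
    by (simp add: gsum_ich ip_sum_left ip_simps)
  also have "\<dots> = 2 * lap X c ?F y"
    using lap_swp[OF assms(1-3), of ?F] by simp
  finally show ?thesis by simp
qed

theorem interchange_gap:
  assumes "finite X" "X \<noteq> {}" "weights_on X c" "poincare X c g" "total X v = 0"
  shows "g * ip v v \<le> ip (ich X c v) v"
proof (cases "g > 0")
  case False
  then show ?thesis
    using ip_ich_nonneg[OF assms(3), of v] ip_ge_0[of v] mult_nonpos_nonneg[of g "ip v v"] by linarith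
next
  case g: True
  show ?thesis
    using assms
  proof (induction "card X" arbitrary: X c v)
    case (Suc n)
    show ?case
    proof (cases "v = 0")
      case False
      \<comment> \<open>The span of the orbit of \<open>v\<close> is a finite-dimensional invariant
        subspace on which \<open>total X\<close> vanishes, so a minimal eigenvector exists there
        although the ambient space may be infinite-dimensional.\<close>
      define S where "S = {\<rho> s v | s. s permutes X}"
      have fin: "finite S"
        unfolding S_def using finite_permutations[OF Suc.prems(1)] by simp
      have vS: "v \<in> span S"
        unfolding S_def using rho_id[of v, symmetric] permutes_id[of X] by (intro span_base) blast
      have inv: "\<rho> t u \<in> span S" if "t permutes X" "u \<in> span S" for t u
      proof -
        have "\<rho> t ` S \<subseteq> S"
          using that(1) unfolding S_def by (auto simp: rho_comp[symmetric] permutes_bij intro: permutes_compose)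
        then show ?thesis
          using that linear_span_image[OF rho_linear[OF permutes_bij[OF that(1)]], of S] span_mono by blast
      qed
      have ker: "total X u = 0" if "u \<in> span S" for u
      proof -
        have "S \<subseteq> {u. total X u = 0}"
          unfolding S_def using total_rho Suc.prems(5) by auto
        then have "span S \<subseteq> {u. total X u = 0}"
          by (intro span_minimal) (auto simp: linear_subspace_kernel[OF linear_gsum])
        then show ?thesis using that by blast
      qed
      have ichS: "ich X c u \<in> span S" if "u \<in> span S" for u
        unfolding ich_def
        by (intro span_scale span_sum span_diff inv that permutes_swap_id)
      obtain l w where lw: "w \<in> span S" "w \<noteq> 0" "ich X c w = l *\<^sub>R w"
        and min: "\<And>u. u \<in> span S \<Longrightarrow> ip (ich X c u) u \<ge> l * ip u u"
      proof (rule rayleigh_min[OF linear_ich[of X c] subspace_span fin order_refl _ ichS])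
        show "span S \<noteq> {0}"
          using vS False by auto
      qed (auto simp: ich_symmetric)
      have "g \<le> l"
      proof (cases "\<exists>p\<in>X. \<exists>u. \<exists>y\<in>X. ip (gsum X (\<lambda>s. s y = p) w) u \<noteq> 0")
        case True
        then obtain p u where pu: "p \<in> X" "\<exists>y\<in>X. ip (gsum X (\<lambda>s. s y = p) w) u \<noteq> 0"
          by blast
        have "(\<Sum>y\<in>X. ip (gsum X (\<lambda>s. s y = p) w) u) = 0"
          using gsum_split[OF Suc.prems(1) pu(1), of "\<lambda>_. True" w] ker[OF lw(1)]
          by (simp add: ip_sum_left[symmetric])
        then show ?thesis
          using pu poincare_eigenvalue_le[OF Suc.prems(1,3,4) _ lap_gsum[OF Suc.prems(1,3) _ lw(3)]]
          by blast
      next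
        case False
        obtain x where x: "x \<in> X"
          using Suc.prems by auto
        have "gsum X (\<lambda>s. s x = x) w = 0"
          using False x ip_eq_0_iff by blast
        then have tot: "total (X - {x}) w = 0"
          by (simp add: total_fixing x)
        \<comment> \<open>The empty set has only the identity permutation; its sum would be
          \<open>w\<close> itself, which is nonzero.\<close>
        have ne: "X \<noteq> {x}"
          using tot lw(2) by (auto simp: gsum_def rho_id permutes_empty)
        have hub: "hub_weight X c x > 0"
          using hub_weight_pos[OF Suc.prems(1,3,4) g x ne] .
        have "g * ip w w \<le> ip (ich (X - {x}) (reduce X c x) w) w"
          using Suc.prems(1) Suc.hyps(2) x ne tot weights_on_reduce[OF Suc.prems(3) x]
            poincare_reduce[OF Suc.prems(1,3,4) g x]
          by (intro Suc.hyps(1)) auto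
        also have "\<dots> \<le> ip (ich X c w) w"
          by (rule ich_reduce_le[OF Suc.prems(1) x Suc.prems(3) hub])
        finally show ?thesis
          using ip_pos[OF lw(2)] by (simp add: lw(3) ip_simps)
      qed
      then show ?thesis
        using min[OF vS] ip_ge_0[of v] mult_right_mono[of g l "ip v v"] by linarith
    qed (simp add: linear_0[OF linear_ich])
  qed simp
qed

end

section \<open>The case of equality\<close>

definition square_graph :: "'a set \<Rightarrow> ('a \<Rightarrow> 'a \<Rightarrow> real) \<Rightarrow> real \<Rightarrow> bool" where
  "square_graph X c m \<longleftrightarrow> (\<exists>x y z w. distinct [x, y, z, w] \<and> X = {x, y, z, w} \<and>
     c x y = m \<and> c y z = m \<and> c z w = m \<and> c w x = m \<and> c x z = 0 \<and> c y w = 0)"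

lemma square_graph_card: "square_graph X c m \<Longrightarrow> card X = 4"
  unfolding square_graph_def by force

lemma square_graph_row:
  assumes "square_graph X c m" "weights_on X c" "y \<in> X"
  shows "(\<Sum>z\<in>X - {y}. c y z) = 2 * m"
proof -
  obtain a b d e where X: "distinct [a, b, d, e]" "X = {a, b, d, e}"
     "c a b = m" "c b d = m" "c d e = m" "c e a = m" "c a d = 0" "c b e = 0"
    using assms(1) unfolding square_graph_def by blast
  have "(\<Sum>z\<in>X. c y z) = c y a + c y b + c y d + c y e"
    using X by simp
  moreover have "(\<Sum>z\<in>X. c y z) = c y y + (\<Sum>z\<in>X - {y}. c y z)"
    using assms(3) X(2) by (intro sum.remove) auto
  ultimately have sum: "(\<Sum>z\<in>X - {y}. c y z) = c y a + c y b + c y d + c y e - c y y"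
    by linarith
  have "a \<in> X" "b \<in> X" "d \<in> X" "e \<in> X"
    using X(2) by simp_all
  then have sym: "c b a = m" "c d b = m" "c e d = m" "c a e = m" "c d a = 0" "c e b = 0"
    using X(3-8) weights_on_sym[OF assms(2)] by metis+
  have "y = a \<or> y = b \<or> y = d \<or> y = e"
    using assms(3) X(2) by blast
  then show ?thesis
    unfolding sum by (elim disjE; hypsubst; simp add: X(3-8) sym)
qed

text \<open>Rows of a square of weight \<open>g / 2\<close> sum to \<open>g\<close>, so if every
  reduction were one, \<open>(c x y)\<^sup>2 = d x * (d y - g)\<close> would hold for all pairs,
  with \<open>d\<close> the hub weights. The symmetry of the left side makes \<open>d\<close>
  constant, and a missing diagonal of one square then forces \<open>d = g\<close> and all weights to
  vanish.\<close>

lemma exists_not_square_reduce: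
  assumes "finite X" "card X = 5" "weights_on X c" "poincare X c g" "g > 0"
  shows "\<exists>x\<in>X. \<not> square_graph (X - {x}) (reduce X c x) (g / 2)"
proof (rule ccontr)
  assume "\<not> ?thesis"
  then have sq: "square_graph (X - {x}) (reduce X c x) (g / 2)" if "x \<in> X" for x
    using that by blast
  define d where "d = hub_weight X c"
  have sym: "c x y = c y x" if "x \<in> X" "y \<in> X" for x y
    using weights_on_sym[OF assms(3) that] .
  have d: "d x > 0" if "x \<in> X" for x
    unfolding d_def using assms that by (intro hub_weight_pos) auto
  have eq: "(c x y)\<^sup>2 = d x * (d y - g)" if xy: "x \<in> X" "y \<in> X" "x \<noteq> y" for x y
  proof -
    have 1: "(\<Sum>z\<in>X - {x} - {y}. c y z) = d y - c y x"
      using xy assms(1) by (simp add: d_def hub_weight_def sum.remove[of "X - {y}" x] Diff_insert2[symmetric] insert_commute)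
    have 2: "(\<Sum>z\<in>X - {x} - {y}. c x z) = d x - c x y"
      using xy assms(1) by (simp add: d_def hub_weight_def sum.remove[of "X - {x}" y])
    have "g = (\<Sum>z\<in>X - {x} - {y}. reduce X c x y z)"
      using square_graph_row[OF sq[OF xy(1)] weights_on_reduce[OF assms(3) xy(1)], of y] xy by simp
    also have "\<dots> = (d y - c y x) + c x y / d x * (d x - c x y)"
      unfolding 1[symmetric] 2[symmetric] sum_distrib_left by (simp add: reduce_def sum.distrib d_def)
    also have "\<dots> = d y - (c x y)\<^sup>2 / d x"
      using d[OF xy(1)] sym[OF xy(1,2)] by (simp add: field_simps power2_eq_square)
    finally show ?thesis
      using d[OF xy(1)] by (simp add: field_simps)
  qed
  have deq: "d x = d y" if "x \<in> X" "y \<in> X" for x y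
  proof (cases "x = y")
    case False
    have "d x * (d y - g) = d y * (d x - g)"
      using eq[OF that False] eq[OF that(2,1)] False sym[OF that] by auto
    then show ?thesis
      using assms(5) by (simp add: algebra_simps)
  qed auto
  obtain x where x: "x \<in> X"
    using assms(2) by fastforce
  obtain y z where yz: "y \<in> X - {x}" "z \<in> X - {x}" "y \<noteq> z" "reduce X c x y z = 0"
    using sq[OF x] unfolding square_graph_def by auto
  have "0 \<le> c y z" "0 \<le> c x y * c x z / d x"
    using yz x d[OF x] weights_on_nonneg[OF assms(3)] by (auto intro!: divide_nonneg_pos mult_nonneg_nonneg)
  then have "c y z = 0"
    using yz(4) by (simp add: reduce_def d_def)
  then have "d x * (d x - g) = 0"
    using eq[of y z] yz deq[of y x] deq[of z x] x by auto
  then have "(c x u)\<^sup>2 = 0" if "u \<in> X - {x}" for u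
    using eq[of x u] deq[of u x] x that by auto
  then have "d x = 0"
    by (simp add: d_def hub_weight_def)
  then show False
    using d[OF x] by simp
qed

section \<open>Functions on pairs and their extremal entries\<close>

locale gap_matrix =
  fixes X :: "'a set" and c :: "'a \<Rightarrow> 'a \<Rightarrow> real" and g :: real and F :: "'a \<Rightarrow> 'a \<Rightarrow> real"
  assumes fin: "finite X" and weights: "weights_on X c" and gpos: "g > 0"
    and F_sym: "a \<in> X \<Longrightarrow> b \<in> X \<Longrightarrow> F a b = F b a"
    and F_diag: "a \<in> X \<Longrightarrow> F a a = 0"
    and F_row: "a \<in> X \<Longrightarrow> (\<Sum>b\<in>X. F a b) = 0"
    and F_eig: "a \<in> X \<Longrightarrow> b \<in> X \<Longrightarrow> lap X c (F a) b = g * F a b"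
    and F_supp: "a \<in> X \<Longrightarrow> b \<in> X \<Longrightarrow> F a b \<noteq> 0 \<Longrightarrow> c a b = g / 2"
begin

lemma uminus: "gap_matrix X c g (\<lambda>a b. - F a b)"
proof unfold_locales
  fix a b assume ab: "a \<in> X" "b \<in> X"
  show "lap X c (\<lambda>b. - F a b) b = g * - F a b"
  proof -
    have "lap X c (\<lambda>b. - F a b) b = - lap X c (F a) b"
      unfolding lap_def sum_negf[symmetric] by (intro sum.cong refl) (simp add: algebra_simps)
    then show ?thesis
      using F_eig[OF ab] by simp
  qed
qed (use fin weights gpos F_sym F_diag F_row F_supp in \<open>auto simp: sum_negf\<close>)

text \<open>Two eigenvalue equations at a maximal entry, read from either end of the edge, bound the
  mass on the support of \<open>F\<close> from above, while the row sums demand at least as much.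
  Everything is tight, so each further vertex sees \<open>- M\<close> from at most one end.\<close>

lemma max_entry:
  assumes xy: "x \<in> X" "y \<in> X" "F x y = M" and M: "M > 0"
    and bound: "\<And>a b. a \<in> X \<Longrightarrow> b \<in> X \<Longrightarrow> \<bar>F a b\<bar> \<le> M"
  obtains z where "z \<in> X" "z \<noteq> x" "z \<noteq> y" "F y z = - M" "F x z = 0"
    "\<And>u. u \<in> X \<Longrightarrow> u \<noteq> x \<Longrightarrow> u \<noteq> y \<Longrightarrow> u \<noteq> z \<Longrightarrow> c y u = 0"
proof -
  define R where "R = X - {x, y}"
  have ne: "x \<noteq> y"
    using xy M F_diag by auto
  have split: "(\<Sum>u\<in>X. f u) = f x + f y + (\<Sum>u\<in>R. f u)" for f :: "'a \<Rightarrow> real"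
    using fin xy ne sum.remove[of X x f] sum.remove[of "X - {x}" y f]
    by (simp add: R_def Diff_insert2[symmetric] insert_commute)
  have bd: "F x u \<le> M" "F y u \<le> M" "- M \<le> F x u" "- M \<le> F y u" if "u \<in> R" for u
    using bound[of x u] bound[of y u] that xy by (auto simp: R_def)
  have cxy: "c y x = g / 2" "c x y = g / 2" "F y x = M"
    using F_supp[of x y] F_sym[of x y] F_supp[of y x] xy M by auto
  have nn: "0 \<le> c y u" "0 \<le> c x u" if "u \<in> R" for u
    using that weights xy by (auto simp: weights_on_def R_def)
  have e1: "(\<Sum>u\<in>R. c y u * (M - F x u)) = g / 2 * M"
    using F_eig[of x y] xy cxy F_diag[of x] by (simp add: lap_def split)
  have e2: "(\<Sum>u\<in>R. c x u * (M - F y u)) = g / 2 * M"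
    using F_eig[of y x] xy cxy F_diag[of y] by (simp add: lap_def split)
  have r1: "(\<Sum>u\<in>R. F x u) = - M" and r2: "(\<Sum>u\<in>R. F y u) = - M"
    using F_row[of x] F_row[of y] xy cxy F_diag by (auto simp: split)
  have half: "(\<Sum>u\<in>R. of_bool (F b u \<noteq> 0) * (M - F a u)) \<le> M"
    if "(\<Sum>u\<in>R. c b u * (M - F a u)) = g / 2 * M" "a \<in> {x, y}" "b \<in> {x, y}" for a b
  proof -
    have "g / 2 * (\<Sum>u\<in>R. of_bool (F b u \<noteq> 0) * (M - F a u)) \<le> (\<Sum>u\<in>R. c b u * (M - F a u))"
      unfolding sum_distrib_left mult.assoc[symmetric]
    proof (intro sum_mono mult_right_mono)
      fix u assume u: "u \<in> R"
      then show "g / 2 * of_bool (F b u \<noteq> 0) \<le> c b u" "0 \<le> M - F a u"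
        using F_supp[of b u] nn[OF u] bd[OF u] xy that by (auto simp: R_def)
    qed
    then show ?thesis
      using that gpos by simp
  qed
  \<comment> \<open>The first two terms are what the eigenvalue equations bound by \<open>M\<close>
    each, the last two are the row sums, \<open>- M\<close> each. Each \<open>r u\<close> is
    nonnegative: if both entries are nonzero it equals \<open>2 * M\<close>, if one is, it is
    \<open>M\<close> plus that entry.\<close>
  define r where "r u = of_bool (F y u \<noteq> 0) * (M - F x u) + of_bool (F x u \<noteq> 0) * (M - F y u) + F x u + F y u" for u
  have r0: "0 \<le> r u" if "u \<in> R" for u
    using bd[OF that] M by (auto simp: r_def of_bool_def)
  moreover have "(\<Sum>u\<in>R. r u) \<le> 0"
    using half[OF e1] half[OF e2] r1 r2 by (simp add: r_def sum.distrib)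
  ultimately have "\<forall>u\<in>R. r u = 0"
    using fin sum_nonneg_eq_0_iff[of R r] sum_nonneg[of R r] by (auto simp: R_def)
  then have alt: "F x u = 0 \<and> F y u = 0 \<or> F x u = 0 \<and> F y u = - M \<or> F x u = - M \<and> F y u = 0" if "u \<in> R" for u
    using that M by (fastforce simp: r_def of_bool_def split: if_splits)
  have "\<exists>z\<in>R. F y z \<noteq> 0"
    using r2 M by (metis neg_equal_0_iff_equal order_less_irrefl sum.neutral)
  then obtain z where z: "z \<in> R" "F y z \<noteq> 0" by blast
  then have z': "F y z = - M" "F x z = 0" "z \<in> X" "z \<noteq> x" "z \<noteq> y"
    using alt[OF z(1)] by (auto simp: R_def)
  have "c y z = g / 2"
    using F_supp z(2) z' xy by auto
  \<comment> \<open>The edge to \<open>z\<close> alone accounts for the whole value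
    \<open>g / 2 * M\<close> in \<open>e1\<close>.\<close>
  then have "(\<Sum>u\<in>R - {z}. c y u * (M - F x u)) = 0"
    using e1 fin unfolding sum.remove[OF finite_Diff[OF fin, of "{x, y}", folded R_def] z(1)] z'(2) \<open>c y z = g / 2\<close>
    by simp
  then have "\<forall>u\<in>R - {z}. c y u * (M - F x u) = 0"
    using fin bd nn by (subst (asm) sum_nonneg_eq_0_iff) (auto simp: R_def)
  moreover have "M - F x u \<noteq> 0" if "u \<in> R" for u
    using alt[OF that] M by auto
  ultimately have "c y u = 0" if "u \<in> R - {z}" for u
    using that by auto
  then show ?thesis
    using that[of z] z' by (auto simp: R_def)
qed

text \<open>Each end of a maximal edge has just one further neighbour, and so do these neighbours,
  by the same lemma for \<open>- F\<close>. The eigenvalue equation at the zero entry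
  \<open>F x z\<close> shows that the two paths close up in a common vertex; connectedness excludes
  other vertices.\<close>

lemma square_from_max:
  assumes pc: "poincare X c g" and xy: "x \<in> X" "y \<in> X" "F x y = M" and M: "M > 0"
    and bound: "\<And>a b. a \<in> X \<Longrightarrow> b \<in> X \<Longrightarrow> \<bar>F a b\<bar> \<le> M"
  shows "square_graph X c (g / 2)"
proof -
  interpret neg: gap_matrix X c g "\<lambda>a b. - F a b"
    by (rule uminus)
  obtain z where z: "z \<in> X" "z \<noteq> x" "z \<noteq> y" "F y z = - M" "F x z = 0"
    and cy: "\<And>u. u \<in> X \<Longrightarrow> u \<noteq> x \<Longrightarrow> u \<noteq> y \<Longrightarrow> u \<noteq> z \<Longrightarrow> c y u = 0"
    by (rule max_entry[OF xy M bound]) blast+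
  have yx: "F y x = M"
    using F_sym xy by simp
  obtain w where w: "w \<in> X" "w \<noteq> x" "w \<noteq> y" "F x w = - M" "F y w = 0"
    and cx: "\<And>u. u \<in> X \<Longrightarrow> u \<noteq> y \<Longrightarrow> u \<noteq> x \<Longrightarrow> u \<noteq> w \<Longrightarrow> c x u = 0"
    by (rule max_entry[OF xy(2,1) yx M bound]) blast+
  have "- F y z = M" "- F x w = M"
    using z w by auto
  obtain z' where z': "z' \<in> X" "z' \<noteq> z" "z' \<noteq> y" "- F z z' = - M"
    and cz: "\<And>u. u \<in> X \<Longrightarrow> u \<noteq> y \<Longrightarrow> u \<noteq> z \<Longrightarrow> u \<noteq> z' \<Longrightarrow> c z u = 0"
    by (rule neg.max_entry[OF xy(2) z(1) \<open>- F y z = M\<close> M]) (use bound in auto)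
  obtain w' where w': "w' \<in> X" "w' \<noteq> w" "w' \<noteq> x"
    and cw: "\<And>u. u \<in> X \<Longrightarrow> u \<noteq> x \<Longrightarrow> u \<noteq> w \<Longrightarrow> u \<noteq> w' \<Longrightarrow> c w u = 0"
    by (rule neg.max_entry[OF xy(1) w(1) \<open>- F x w = M\<close> M]) (use bound in auto)
  have sym: "c a b = c b a" if "a \<in> X" "b \<in> X" for a b
    using weights_on_sym[OF weights that] .
  have edges: "c x y = g / 2" "c y z = g / 2" "c x w = g / 2" "c z z' = g / 2"
    using F_supp xy z w z' M by auto
  have "0 = (\<Sum>u\<in>X. c z u * (F x z - F x u))"
    using F_eig[OF xy(1) z(1)] z by (simp add: lap_def)
  also have "\<dots> = (\<Sum>u\<in>{y, z'}. c z u * (F x z - F x u))"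
    using fin xy z z' cz by (intro sum.mono_neutral_right) auto
  also have "\<dots> = c z y * (F x z - F x y) + c z z' * (F x z - F x z')"
    using z' by simp
  also have "c z y = g / 2"
    using edges(2) sym[OF xy(2) z(1)] by simp
  also have "g / 2 * (F x z - F x y) + c z z' * (F x z - F x z') = g / 2 * (- M) + g / 2 * (- F x z')"
    unfolding edges(4) z(5) xy(3) by simp
  finally have "g / 2 * (M + F x z') = 0"
    by (simp add: algebra_simps)
  then have Fxz': "F x z' = - M"
    using gpos by simp
  then have "c x z' = g / 2" "z' \<noteq> x"
    using F_supp[of x z'] xy z' M F_diag[of x] by auto
  then have z'w: "z' = w"
    using cx[of z'] z' gpos by auto
  have "c w z = g / 2"
    using edges z'w sym z w by simp
  then have w'z: "w' = z"
    using cw[of z] z z' z'w gpos by auto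
  have "{x, y, z, w} = X"
  proof (rule poincare_connected[OF fin weights pc gpos])
    fix i j assume "i \<in> {x, y, z, w}" "j \<in> X - {x, y, z, w}"
    then show "c i j = 0"
      using cx cy cz cw z'w w'z by auto
  qed (use xy z w in auto)
  moreover have "distinct [x, y, z, w]"
    using xy z w z' z'w M F_diag by auto
  moreover have "c x z = 0" "c y w = 0"
    using cx[of z] cy[of w] z w z' z'w by auto
  ultimately show ?thesis
    unfolding square_graph_def using edges z'w sym xy z w by metis
qed

lemma zero_or_square:
  assumes "poincare X c g" "a \<in> X" "b \<in> X" "F a b \<noteq> 0"
  shows "square_graph X c (g / 2)"
proof -
  define A where "A = (\<lambda>(a, b). \<bar>F a b\<bar>) ` (X \<times> X)"
  have A: "finite A" "A \<noteq> {}"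
    using fin assms by (auto simp: A_def)
  define M where "M = Max A"
  have bound: "\<bar>F a b\<bar> \<le> M" if "a \<in> X" "b \<in> X" for a b
    unfolding M_def using that A by (intro Max_ge) (auto simp: A_def)
  have "M \<in> A"
    unfolding M_def using A by (rule Max_in)
  then obtain x y where xy: "x \<in> X" "y \<in> X" "\<bar>F x y\<bar> = M"
    by (auto simp: A_def)
  have M: "M > 0"
    using bound[OF assms(2,3)] assms(4) by linarith
  show ?thesis
  proof (cases "F x y = M")
    case True
    then show ?thesis
      using square_from_max[OF assms(1) xy(1,2) _ M] bound by blast
  next
    case False
    then have "- F x y = M"
      using xy by auto
    then show ?thesis
      using gap_matrix.square_from_max[OF uminus assms(1) xy(1,2) _ M] bound by simp
  qed
qed

end

section \<open>Equality passes to reductions\<close>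

context perm_rep
begin

text \<open>The form of the reduced operator at \<open>v\<close> is squeezed between
  \<open>g * ip v v\<close>, by the gap inequality, and the form of the full operator, which has the
  same value. \<open>psd_kernel\<close> on the kernel of the stabilizer sum gives the eigenvector
  equation.\<close>

lemma ich_reduce_eigenvector:
  assumes "finite X" "weights_on X c" "poincare X c g" "g > 0" "x \<in> X" "X \<noteq> {x}"
    and eig: "ich X c v = g *\<^sub>R v" and tot: "total (X - {x}) v = 0"
  shows "ich (X - {x}) (reduce X c x) v = g *\<^sub>R v"
proof -
  let ?Y = "X - {x}" and ?c = "reduce X c x"
  note w = weights_on_reduce[OF assms(2,5)]
  have hub: "hub_weight X c x > 0"
    by (rule hub_weight_pos[OF assms(1-6)])
  have gap: "g * ip u u \<le> ip (ich ?Y ?c u) u" if "total ?Y u = 0" for u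
    using assms that by (intro interchange_gap w poincare_reduce) auto
  have "ich ?Y ?c v - g *\<^sub>R v = 0"
  proof (rule psd_kernel[where M = "\<lambda>u. ich ?Y ?c u - g *\<^sub>R u" and W = "{u. total ?Y u = 0}"])
    show "linear (\<lambda>u. ich ?Y ?c u - g *\<^sub>R u)"
      by (intro linear_compose_sub linear_ich linear_compose_scale_right linear_id[unfolded id_def])
    show "subspace {u. total ?Y u = 0}"
      by (rule linear_subspace_kernel[OF linear_gsum])
    show "ich ?Y ?c u - g *\<^sub>R u \<in> {u. total ?Y u = 0}" if "u \<in> {u. total ?Y u = 0}" for u
      using gsum_ich[of ?Y ?Y "\<lambda>_. True" ?c u] that
      by (simp add: linear_diff[OF linear_gsum] linear_scale[OF linear_gsum])
    show "ip (ich ?Y ?c u - g *\<^sub>R u) u' = ip u (ich ?Y ?c u' - g *\<^sub>R u')" for u u'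
      by (simp add: ip_simps ich_symmetric)
    show "0 \<le> ip (ich ?Y ?c u - g *\<^sub>R u) u" if "u \<in> {u. total ?Y u = 0}" for u
      using gap that by (simp add: ip_simps)
    show "ip (ich ?Y ?c v - g *\<^sub>R v) v = 0"
      using gap[OF tot] ich_reduce_le[OF assms(1,5,2) hub, of v] eig by (simp add: ip_simps)
  qed (use tot in auto)
  then show ?thesis by simp
qed

lemma total_pair_zero:
  assumes "finite X" "weights_on X c" "poincare X c g" "g > 0"
    and eig: "ich X c v = g *\<^sub>R v" and tot: "\<And>x. x \<in> X \<Longrightarrow> total (X - {x}) v = 0"
    and pq: "p \<in> X" "q \<in> X" "p \<noteq> q"
    and sq: "square_graph X c (g / 2) \<Longrightarrow> total (X - {p, q}) (v + \<rho> (swp p q) v) = 0"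
  shows "total (X - {p, q}) v = 0"
proof -
  \<comment> \<open>The test vector is the one to be shown zero, so that \<open>F p q\<close> is its
    squared norm.\<close>
  define u where "u = total (X - {p, q}) v"
  define G where "G p q a b = ip (gsum X (\<lambda>s. s a = p \<and> s b = q) v) u" for p q a b
  have G_swap: "G p q a b = G q p b a" for p q a b
    by (simp add: G_def conj_commute)
  have diag: "G p q a a = 0" if "p \<noteq> q" for p q a
  proof -
    have "gsum X (\<lambda>s. s a = p \<and> s a = q) v = 0"
      unfolding gsum_def using that by (intro sum.neutral) auto
    then show ?thesis
      by (simp only: G_def ip_zero_left)
  qed
  have row: "(\<Sum>b\<in>X. G p q a b) = 0" if "p \<in> X" "q \<in> X" "a \<in> X" for p q a
  proof -
    have "(\<Sum>b\<in>X. gsum X (\<lambda>s. s b = q \<and> s a = p) v) = gsum X (\<lambda>s. s a = p) v"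
      using gsum_split[OF assms(1) that(2)] .
    also have "\<dots> = 0"
      using gsum_transport[OF that(3,1)] tot[OF that(3)] by (simp add: linear_0[OF rho_linear])
    finally show ?thesis
      by (simp add: G_def ip_sum_left[symmetric] conj_commute)
  qed
  \<comment> \<open>The operator of the graph reduced at \<open>a\<close> leaves the first argument
    alone, so its eigenvector equation reads as an equation for the row of \<open>a\<close>. The row
    vanishes at \<open>a\<close>, which allows extending the equation to all of
    \<open>X\<close>.\<close>
  have col: "lap X c (G p q a) b = g * G p q a b"
    if "p \<in> X" "q \<in> X" "p \<noteq> q" "a \<in> X" "b \<in> X" for p q a b
  proof (rule extend_eigenfunction[OF assms(1-4) that(4) _ _ _ _ that(5)])
    show "X \<noteq> {a}"
      using that by auto
    show "sum (G p q a) (X - {a}) = 0"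
      using row[OF that(1,2,4)] diag[OF that(3)] assms(1) that by (simp add: sum.remove[of X a])
    show "G p q a a = 0"
      using diag[OF that(3)] .
    fix y assume y: "y \<in> X - {a}"
    have "2 * g * G p q a y = ip (2 *\<^sub>R gsum X (\<lambda>s. s a = p \<and> s y = q) (ich (X - {a}) (reduce X c a) v)) u"
      using ich_reduce_eigenvector[OF assms(1-4) that(4) \<open>X \<noteq> {a}\<close> eig tot[OF that(4)]]
      by (simp add: linear_scale[OF linear_gsum] ip_simps G_def)
    also have "\<dots> = (\<Sum>i\<in>X - {a}. \<Sum>j\<in>X - {a}. reduce X c a i j *
        (G p q a y - G p q a (swp i j y)))"
    proof -
      have fix_a: "swp i j a = a" if "i \<in> X - {a}" "j \<in> X - {a}" for i j
        using that by (auto simp: Transposition.transpose_def)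
      show ?thesis
        by (simp add: gsum_ich[of "X - {a}"] ip_sum_left ip_simps G_def)
          (intro sum.cong refl, simp add: fix_a)
    qed
    also have "\<dots> = 2 * lap (X - {a}) (reduce X c a) (G p q a) y"
      using assms(1) y by (intro lap_swp weights_on_reduce[OF assms(2) that(4)]) auto
    finally show "lap (X - {a}) (reduce X c a) (G p q a) y = g * G p q a y"
      by simp
  qed
  define F where "F = G p q"
  have qp: "q \<in> X" "p \<in> X" "q \<noteq> p"
    using pq by auto
  \<comment> \<open>The row and the column each contribute \<open>g * F a b\<close>, while the full
    operator contributes it only once; the excess must equal the correction term of
    \<open>lap_swp_pair\<close>.\<close>
  have pair: "g * F a b = c a b * (F a b + F b a)" if ab: "a \<in> X" "b \<in> X" for a b
  proof (cases "a = b")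
    case True
    then show ?thesis
      using diag[OF pq(3)] by (simp add: F_def)
  next
    case False
    have "2 * g * F a b = ip (2 *\<^sub>R gsum X (\<lambda>s. s a = p \<and> s b = q) (ich X c v)) u"
      by (simp add: eig linear_scale[OF linear_gsum] ip_simps G_def F_def)
    also have "\<dots> = (\<Sum>i\<in>X. \<Sum>j\<in>X. c i j * (F a b - F (swp i j a) (swp i j b)))"
      by (simp add: gsum_ich ip_sum_left ip_simps G_def F_def)
    also have "\<dots> = 2 * (lap X c (\<lambda>z. F z b) a + lap X c (F a) b - c a b * (F a b + F b a))"
      using diag[OF pq(3)] by (intro lap_swp_pair assms ab False) (auto simp: F_def)
    also have "lap X c (F a) b = g * F a b"
      unfolding F_def by (rule col[OF pq ab])
    also have "lap X c (\<lambda>z. F z b) a = g * F a b"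
      unfolding F_def G_swap[of p q] by (rule col[OF qp ab(2,1)])
    finally show ?thesis by simp
  qed
  have sym: "F a b = F b a" if "a \<in> X" "b \<in> X" for a b
  proof -
    have "g * F a b = g * F b a"
      using pair[OF that] pair[OF that(2,1)] weights_on_sym[OF assms(2) that] by (simp add: add.commute)
    then show ?thesis
      using assms(4) by simp
  qed
  have supp: "c a b = g / 2" if "a \<in> X" "b \<in> X" "F a b \<noteq> 0" for a b
    using pair[OF that(1,2)] sym[OF that(1,2)] that(3) by (simp add: algebra_simps)
  interpret gap_matrix X c g F
    using assms(1,2,4) sym diag[OF pq(3)] row[OF pq(1,2)] col[OF pq] supp
    by unfold_locales (auto simp: F_def)
  have pp: "gsum X (\<lambda>s. s p = p \<and> s q = q) = total (X - {p, q})"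
  proof
    fix w
    have "gsum X (\<lambda>s. s p = p \<and> s q = q) w = gsum (X - {p}) (\<lambda>s. s q = q) w"
      by (rule gsum_fixing[OF pq(1)])
    also have "\<dots> = total (X - {p} - {q}) w"
      using pq by (intro total_fixing) auto
    finally show "gsum X (\<lambda>s. s p = p \<and> s q = q) w = total (X - {p, q}) w"
      by (simp add: Diff_insert2[symmetric] insert_commute)
  qed
  have "F p q = 0"
  proof (cases "square_graph X c (g / 2)")
    case True
    \<comment> \<open>On the square only the symmetrized sum is known to vanish. As \<open>F\<close>
      is symmetric, this still gives \<open>2 * F p q = 0\<close>.\<close>
    have "gsum X (\<lambda>s. s q = p \<and> s p = q) v = gsum X (\<lambda>s. s p = p \<and> s q = q) (\<rho> (swp p q) v)"
      using pq by (simp add: gsum_swp)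
    then have "F p q + F q p = ip (total (X - {p, q}) (v + \<rho> (swp p q) v)) u"
      by (simp add: F_def G_def pp ip_add_left[symmetric] linear_add[OF linear_gsum, symmetric])
    then show ?thesis
      using sq[OF True] sym[OF pq(1,2)] by simp
  next
    case False
    then show ?thesis
      using zero_or_square[OF assms(3) pq(1,2)] by blast
  qed
  then have "ip u u = 0"
    by (simp add: F_def G_def pp u_def)
  then show ?thesis
    by (simp add: u_def)
qed

text \<open>The induction must delete a vertex whose reduction is not a square: then the last
  premise is vacuous for the smaller graph. Only the passage from five to four vertices needs a
  choice, made by \<open>exists_not_square_reduce\<close>. With two vertices left, a stabilizer sum
  is \<open>v\<close> itself.\<close>

theorem interchange_gap_strict:
  assumes "finite X" "card X \<ge> 2" "weights_on X c" "poincare X c g" "g > 0"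
    and "ich X c v = g *\<^sub>R v" and "\<And>x. x \<in> X \<Longrightarrow> total (X - {x}) v = 0"
    and "\<And>p q. square_graph X c (g / 2) \<Longrightarrow> p \<in> X \<Longrightarrow> q \<in> X \<Longrightarrow> p \<noteq> q \<Longrightarrow>
      total (X - {p, q}) (v + \<rho> (swp p q) v) = 0"
  shows "v = 0"
  using assms
proof (induction "card X" arbitrary: X c)
  case (Suc n)
  show ?case
  proof (cases "n = 1")
    case True
    then obtain x y where "X = {x, y}" "x \<noteq> y"
      using Suc.hyps(2) by (metis Suc_1 card_2_iff)
    then have "X - {x} = {y}"
      by auto
    moreover have "{s. s permutes {y}} = {id}"
      by (auto simp: permutes_sing)
    ultimately have "total (X - {x}) v = v"
      by (simp add: gsum_def rho_id)
    then show ?thesis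
      using Suc.prems(7)[of x] \<open>X = {x, y}\<close> by simp
  next
    case False
    have n: "n \<ge> 2"
      using False Suc.hyps(2) Suc.prems(2) by simp
    obtain x where x: "x \<in> X" "\<not> square_graph (X - {x}) (reduce X c x) (g / 2)"
    proof (cases "n = 4")
      case True
      then show ?thesis
        using exists_not_square_reduce[OF Suc.prems(1) _ Suc.prems(3-5)] Suc.hyps(2) that by auto
    next
      case False
      obtain x where "x \<in> X"
        using Suc.prems(2) by fastforce
      then show ?thesis
        using that[of x] square_graph_card[of "X - {x}"] Suc.hyps(2) Suc.prems(1) False by fastforce
    qed
    have pair: "total (X - {p, q}) v = 0" if "p \<in> X" "q \<in> X" "p \<noteq> q" for p q
      using total_pair_zero[OF Suc.prems(1,3-7) that] Suc.prems(8) that by blast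
    show ?thesis
    proof (rule Suc.hyps(1)[of "X - {x}" "reduce X c x"])
      show "ich (X - {x}) (reduce X c x) v = g *\<^sub>R v"
        using Suc.prems x n Suc.hyps(2) by (intro ich_reduce_eigenvector) auto
      show "total (X - {x} - {y}) v = 0" if "y \<in> X - {x}" for y
      proof -
        have "total (X - {x, y}) v = 0"
          using that x by (intro pair) auto
        then show ?thesis
          by (simp add: Diff_insert2[symmetric] insert_commute)
      qed
    qed (use Suc.prems(1) Suc.hyps(2) n x weights_on_reduce[OF Suc.prems(3) x(1)]
        poincare_reduce[OF Suc.prems(1,3-5) x(1)] Suc.prems(5) in auto)
  qed
qed simp

end

section \<open>Specht modules as representations\<close>

definition tab_ip :: "(tabloid \<Rightarrow>\<^sub>0 real) \<Rightarrow> (tabloid \<Rightarrow>\<^sub>0 real) \<Rightarrow> real" where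
  "tab_ip f g = (\<Sum>T\<in>Poly_Mapping.keys f. Poly_Mapping.lookup f T * Poly_Mapping.lookup g T)"

lemma tab_ip_superset:
  assumes "finite A" "Poly_Mapping.keys f \<subseteq> A"
  shows "tab_ip f g = (\<Sum>T\<in>A. Poly_Mapping.lookup f T * Poly_Mapping.lookup g T)"
  unfolding tab_ip_def using assms by (intro sum.mono_neutral_left) (auto simp: in_keys_iff)

lemma perm_act_comp: "perm_act (s \<circ> t) f = perm_act s (perm_act t f)"
  unfolding perm_act_def[of t] perm_act_def[of "s \<circ> t"]
  by (simp add: linear_sum[OF linear_perm_act] perm_act_single comp_def image_image)

lemma perm_act_id: "perm_act id f = f"
  by (rule poly_mapping_eqI)
    (simp add: perm_act_def lookup_sum lookup_single when_def sum.delta' in_keys_iff)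

lemma inj_map_image: "bij s \<Longrightarrow> inj (map ((`) s))"
  by (intro inj_mapI injI) (metis bij_is_inj inj_image_eq_iff)

lemma lookup_perm_act:
  assumes "bij s"
  shows "Poly_Mapping.lookup (perm_act s f) (map ((`) s) T) = Poly_Mapping.lookup f T"
  using inj_map_image[OF assms]
  by (simp add: perm_act_def lookup_sum lookup_single when_def inj_eq sum.delta' in_keys_iff)

lemma keys_perm_act: "Poly_Mapping.keys (perm_act s f) \<subseteq> map ((`) s) ` Poly_Mapping.keys f"
  unfolding perm_act_def using keys_sum by (force split: if_splits)

lemma tab_ip_perm_act:
  assumes "bij s"
  shows "tab_ip (perm_act s f) (perm_act s g) = tab_ip f g"
proof -
  have "tab_ip (perm_act s f) (perm_act s g) = (\<Sum>T\<in>map ((`) s) ` Poly_Mapping.keys f.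
      Poly_Mapping.lookup (perm_act s f) T * Poly_Mapping.lookup (perm_act s g) T)"
    using keys_perm_act by (intro tab_ip_superset) auto
  also have "\<dots> = tab_ip f g"
    using inj_map_image[OF assms]
    by (subst sum.reindex) (auto intro: inj_on_subset simp: lookup_perm_act[OF assms] tab_ip_def)
  finally show ?thesis .
qed

interpretation tab: perm_rep tab_ip perm_act
proof
  fix u v w :: "tabloid \<Rightarrow>\<^sub>0 real" and r :: real and s t :: "nat \<Rightarrow> nat"
  let ?K = "Poly_Mapping.keys"
  have fin: "finite (?K u \<union> ?K v)" by simp
  show "tab_ip (u + v) w = tab_ip u w + tab_ip v w"
    using keys_add[of u v] by (simp add: tab_ip_superset[OF fin] lookup_add distrib_right sum.distrib)
  have "?K (r *\<^sub>R u) \<subseteq> ?K u"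
    by (auto simp: in_keys_iff lookup_scaleR)
  then show "tab_ip (r *\<^sub>R u) w = r * tab_ip u w"
    by (simp add: tab_ip_superset[of "?K u"] lookup_scaleR sum_distrib_left mult.assoc)
  show "tab_ip u v = tab_ip v u"
    by (simp add: tab_ip_superset[OF fin] mult.commute)
  show "tab_ip v v > 0" if "v \<noteq> 0"
  proof -
    obtain T where "T \<in> ?K v"
      using \<open>v \<noteq> 0\<close> keys_eq_empty[of v] by blast
    then show ?thesis
      unfolding tab_ip_def by (intro sum_pos2[of _ T]) (auto simp: in_keys_iff zero_less_mult_iff)
  qed
qed (simp_all add: linear_perm_act perm_act_comp perm_act_id tab_ip_perm_act
    linear_add[OF linear_perm_act] linear_scale[OF linear_perm_act])

context perm_rep
begin

lemma rho_total:
  assumes "t permutes Y"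
  shows "\<rho> t (total Y v) = total Y v"
proof -
  have inv: "inv t permutes Y" "inv t \<circ> t = id" "t \<circ> inv t = id"
    using assms by (auto simp: permutes_inv permutes_inv_o)
  have "\<rho> t (total Y v) = (\<Sum>s | s permutes Y. \<rho> (t \<circ> s) v)"
    using assms by (auto simp: gsum_def linear_sum[OF rho_linear] permutes_bij rho_comp intro!: sum.cong)
  also have "\<dots> = (\<Sum>s | s permutes Y. \<rho> s v)"
    by (rule sum.reindex_bij_witness[of _ "\<lambda>s. inv t \<circ> s" "\<lambda>s. t \<circ> s"])
      (auto simp: comp_assoc[symmetric] inv intro: permutes_compose[OF _ inv(1)] permutes_compose[OF _ assms])
  finally show ?thesis
    by (simp add: gsum_def)
qed

lemma rho_total_disjoint:
  assumes "p \<notin> Y" "q \<notin> Y"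
  shows "\<rho> (swp p q) (total Y v) = total Y (\<rho> (swp p q) v)"
proof -
  have "\<rho> (swp p q) (\<rho> s v) = \<rho> s (\<rho> (swp p q) v)" if s: "s permutes Y" for s
  proof -
    have "s p = p" "s q = q"
      using assms s permutes_not_in by metis+
    moreover have "inj s"
      using s by (simp add: permutes_inj)
    ultimately have "swp p q \<circ> s = s \<circ> swp p q"
      by (auto simp: fun_eq_iff Transposition.transpose_def inj_def)
    then show ?thesis
      using permutes_bij[OF s] by (metis bij_swp rho_comp)
  qed
  then show ?thesis
    by (simp add: gsum_def linear_sum[OF rho_linear])
qed

end

section \<open>Tableaux and vectors fixed by Young subgroups\<close>

lemma tableau_inj:
  assumes "is_tableau \<mu> t" "p \<in> young_diagram \<mu>" "q \<in> young_diagram \<mu>" "t p = t q"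
  shows "p = q"
  using assms unfolding is_tableau_def bij_betw_def by (meson inj_onD)

lemma tableau_in: "is_tableau \<mu> t \<Longrightarrow> p \<in> young_diagram \<mu> \<Longrightarrow> t p \<in> {1..sum_list \<mu>}"
  unfolding is_tableau_def bij_betw_def by blast

lemma polytabloid_alternating:
  assumes t: "is_tableau \<mu> t" and cells: "(i, j) \<in> young_diagram \<mu>" "(i', j) \<in> young_diagram \<mu>" "i \<noteq> i'"
    and ab: "a = t (i, j)" "b = t (i', j)"
  shows "perm_act (swp a b) (polytabloid \<mu> t) = - polytabloid \<mu> t"
proof -
  let ?C = "column_stabilizer \<mu> t"
  let ?S = "Poly_Mapping.single (tabloid_of \<mu> t) 1 :: tabloid \<Rightarrow>\<^sub>0 real"
  have ne: "a \<noteq> b"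
    using tableau_inj[OF t cells(1,2)] cells(3) ab by auto
  have swp: "swp a b permutes {1..sum_list \<mu>}"
    using tableau_in[OF t] cells ab by (intro permutes_swap_id) auto
  have swpcol: "swp a b ` {t (k, l) | k. (k, l) \<in> young_diagram \<mu>} = {t (k, l) | k. (k, l) \<in> young_diagram \<mu>}" for l
  proof (cases "l = j")
    case True
    then have "a \<in> {t (k, l) | k. (k, l) \<in> young_diagram \<mu>}" "b \<in> {t (k, l) | k. (k, l) \<in> young_diagram \<mu>}"
      using cells ab by auto
    then show ?thesis by simp
  next
    case False
    then have "a \<notin> {t (k, l) | k. (k, l) \<in> young_diagram \<mu>}" "b \<notin> {t (k, l) | k. (k, l) \<in> young_diagram \<mu>}"
      using tableau_inj[OF t] cells ab by auto
    then show ?thesis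
      by (intro transpose_image_eq) blast
  qed
  have closed: "swp a b \<circ> \<pi> \<in> ?C" if "\<pi> \<in> ?C" for \<pi>
    using that swp permutes_compose[OF _ swp]
    unfolding column_stabilizer_def Let_def by (auto simp only: image_comp[symmetric] swpcol mem_Collect_eq)
  have sgn: "sign (swp a b \<circ> \<pi>) = - sign \<pi>" if "\<pi> \<in> ?C" for \<pi>
  proof -
    have "permutation \<pi>"
      using that permutation_permutes unfolding column_stabilizer_def by blast
    then show ?thesis
      using ne by (simp add: sign_compose permutation_swap_id sign_swap_id)
  qed
  have "perm_act (swp a b) (polytabloid \<mu> t) =
      (\<Sum>\<pi>\<in>?C. of_int (sign \<pi>) *\<^sub>R perm_act (swp a b \<circ> \<pi>) ?S)"
    by (simp add: polytabloid_def linear_sum[OF linear_perm_act] linear_cmul[OF linear_perm_act] perm_act_comp)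
  also have "\<dots> = (\<Sum>\<pi>\<in>?C. - (of_int (sign \<pi>) *\<^sub>R perm_act \<pi> ?S))"
    by (rule sum.reindex_bij_witness[of _ "\<lambda>\<pi>. swp a b \<circ> \<pi>" "\<lambda>\<pi>. swp a b \<circ> \<pi>"])
      (auto simp: closed sgn comp_assoc[symmetric])
  finally show ?thesis
    by (simp add: polytabloid_def sum_negf)
qed

text \<open>A transposition within a column fixes \<open>u\<close> and negates the polytabloid, so
  they are orthogonal. If every tableau admits such a transposition, \<open>u\<close> is orthogonal
  to the whole module, and in particular to itself.\<close>

lemma specht_fixed_zero:
  assumes u: "u \<in> specht \<mu>"
    and fixed: "\<And>t. is_tableau \<mu> t \<Longrightarrow> \<exists>i i' j. (i, j) \<in> young_diagram \<mu> \<and> (i', j) \<in> young_diagram \<mu> \<and> i \<noteq> i'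
      \<and> perm_act (swp (t (i, j)) (t (i', j))) u = u"
  shows "u = 0"
proof -
  have "tab_ip u (polytabloid \<mu> t) = 0" if t: "is_tableau \<mu> t" for t
  proof -
    obtain i i' j where c: "(i, j) \<in> young_diagram \<mu>" "(i', j) \<in> young_diagram \<mu>" "i \<noteq> i'"
      "perm_act (swp (t (i, j)) (t (i', j))) u = u"
      using fixed[OF t] by blast
    then have "tab_ip u (polytabloid \<mu> t) = tab_ip u (- polytabloid \<mu> t)"
      using polytabloid_alternating[OF t c(1-3) refl refl] tab_ip_perm_act[of "swp (t (i, j)) (t (i', j))" u "polytabloid \<mu> t"]
      by simp
    then show ?thesis
      by (simp add: tab.ip_minus_right)
  qed
  moreover have "subspace {w. tab_ip u w = 0}"
    by (auto simp: subspace_def tab.ip_simps)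
  ultimately have "specht \<mu> \<subseteq> {w. tab_ip u w = 0}"
    unfolding specht_def by (intro span_minimal) auto
  then show ?thesis
    using u by auto
qed

lemma young_diagram_Sigma: "young_diagram \<mu> = Sigma {..<length \<mu>} (\<lambda>i. {..<\<mu> ! i})"
  by (auto simp: young_diagram_def)

lemma tableau_exists: "\<exists>t. is_tableau \<mu> t"
proof -
  have "card (young_diagram \<mu>) = card {1..sum_list \<mu>}"
    by (simp add: young_diagram_Sigma sum_list_sum_nth atLeast0LessThan)
  moreover have "finite (young_diagram \<mu>)"
    by (simp add: young_diagram_Sigma)
  ultimately show ?thesis
    unfolding is_tableau_def using finite_same_card_bij by blast
qed

text \<open>A column permutation that also preserves all rows is the identity, so the tabloid of
  \<open>t\<close> occurs with coefficient 1. This makes the spectrum on a Specht module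
  nonempty.\<close>

lemma polytabloid_nonzero:
  assumes t: "is_tableau \<mu> t"
  shows "polytabloid \<mu> t \<noteq> 0"
proof -
  let ?C = "column_stabilizer \<mu> t" and ?T = "tabloid_of \<mu> t"
  have fin: "finite ?C"
    by (rule finite_subset[OF _ finite_permutations[of "{1..sum_list \<mu>}"]]) (auto simp: column_stabilizer_def)
  have id: "id \<in> ?C"
    by (auto simp: column_stabilizer_def permutes_id)
  have triv: "\<pi> = id" if \<pi>: "\<pi> \<in> ?C" "map ((`) \<pi>) ?T = ?T" for \<pi>
  proof
    fix x
    have perm: "\<pi> permutes {1..sum_list \<mu>}"
      using \<pi> by (simp add: column_stabilizer_def)
    show "\<pi> x = id x"
    proof (cases "x \<in> {1..sum_list \<mu>}")
      case True
      then have "x \<in> t ` young_diagram \<mu>"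
        using t unfolding is_tableau_def bij_betw_def by simp
      then obtain i j where ij: "(i, j) \<in> young_diagram \<mu>" "x = t (i, j)"
        by auto
      have "\<pi> ` {t (i, j) | i. (i, j) \<in> young_diagram \<mu>} = {t (i, j) | i. (i, j) \<in> young_diagram \<mu>}"
        using \<pi>(1) by (simp add: column_stabilizer_def Let_def)
      moreover have "\<pi> x \<in> \<pi> ` {t (i, j) | i. (i, j) \<in> young_diagram \<mu>}"
        using ij by blast
      ultimately obtain i' where i': "(i', j) \<in> young_diagram \<mu>" "\<pi> x = t (i', j)"
        by auto
      have i: "i < length \<mu>" "j < \<mu> ! i"
        using ij by (auto simp: young_diagram_def)
      then have row: "?T ! i = {t (i, j) | j. j < \<mu> ! i}"
        by (simp add: tabloid_of_def)
      have "\<pi> ` (?T ! i) = ?T ! i"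
      proof -
        have "length ?T = length \<mu>"
          by (simp add: tabloid_of_def)
        then have "map ((`) \<pi>) ?T ! i = \<pi> ` (?T ! i)"
          using i by simp
        then show ?thesis
          by (simp only: \<pi>(2))
      qed
      moreover have "x \<in> ?T ! i"
        using i ij by (auto simp: row)
      ultimately have "\<pi> x \<in> {t (i, j) | j. j < \<mu> ! i}"
        unfolding row by blast
      then obtain j' where "j' < \<mu> ! i" "\<pi> x = t (i, j')"
        by auto
      then have "(i', j) = (i, j')"
        using i i' tableau_inj[OF t] by (auto simp: young_diagram_def)
      then show ?thesis
        using i' ij by simp
    qed (simp add: permutes_not_in[OF perm])
  qed
  have "Poly_Mapping.lookup (polytabloid \<mu> t) ?T =
     (\<Sum>\<pi>\<in>?C. if map ((`) \<pi>) ?T = ?T then of_int (sign \<pi>) else 0)"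
    by (simp add: polytabloid_def lookup_sum lookup_scaleR perm_act_single lookup_single when_def)
      (intro sum.cong refl, simp)
  also have "\<dots> = (\<Sum>\<pi>\<in>?C. if \<pi> = id then 1 else 0)"
    using triv by (intro sum.cong refl) (auto simp: sign_id)
  also have "\<dots> = 1"
    using fin id by simp
  finally show ?thesis
    by auto
qed

lemma specht_nonzero: "specht \<mu> \<noteq> {0}"
proof -
  obtain t where t: "is_tableau \<mu> t"
    using tableau_exists by blast
  then have "polytabloid \<mu> t \<in> specht \<mu>"
    unfolding specht_def by (intro span_base) blast
  then show ?thesis
    using polytabloid_nonzero[OF t] by auto
qed

lemma specht_finite_span: "\<exists>S. finite S \<and> specht \<mu> \<subseteq> span S"
proof -
  let ?S = "(\<lambda>T. Poly_Mapping.single T 1 :: tabloid \<Rightarrow>\<^sub>0 real) `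
     {T. set T \<subseteq> Pow {1..sum_list \<mu>} \<and> length T = length \<mu>}"
  have "polytabloid \<mu> t \<in> span ?S" if t: "is_tableau \<mu> t" for t
    unfolding polytabloid_def
  proof (intro span_sum span_scale span_base)
    fix \<pi> assume "\<pi> \<in> column_stabilizer \<mu> t"
    then have "\<pi> permutes {1..sum_list \<mu>}"
      by (simp add: column_stabilizer_def)
    then have "\<pi> y \<in> {1..sum_list \<mu>}" if "y \<in> {1..sum_list \<mu>}" for y
      using that permutes_in_image by metis
    then have "set (map ((`) \<pi>) (tabloid_of \<mu> t)) \<subseteq> Pow {1..sum_list \<mu>}"
      using tableau_in[OF t] by (auto simp: tabloid_of_def young_diagram_def)
    then show "perm_act \<pi> (Poly_Mapping.single (tabloid_of \<mu> t) 1) \<in> ?S"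
      unfolding perm_act_single by (intro imageI) (simp add: tabloid_of_def)
  qed
  then have "specht \<mu> \<subseteq> span ?S"
    unfolding specht_def by (intro span_minimal) auto
  moreover have "finite ?S"
    by (intro finite_imageI finite_lists_length_eq) auto
  ultimately show ?thesis by blast
qed

lemma subspace_specht: "subspace (specht \<mu>)"
  by (simp add: specht_def)

lemma interchange_eq_ich:
  assumes "weights_on {1..n} c"
  shows "interchange perm_act n c v = tab.ich {1..n} c v"
proof -
  let ?g = "\<lambda>i j. c i j *\<^sub>R (v - perm_act (swp i j) v)"
  have "(\<Sum>i\<in>{1..n}. ?g i j) = (\<Sum>i\<in>{1..<j}. ?g i j) + (\<Sum>i\<in>{j<..n}. ?g i j)" if "j \<in> {1..n}" for j
  proof -
    have "{1..n} = {1..<j} \<union> ({j} \<union> {j<..n})"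
      using that by auto
    then have "(\<Sum>i\<in>{1..n}. ?g i j) = (\<Sum>i\<in>{1..<j} \<union> ({j} \<union> {j<..n}). ?g i j)"
      by (simp only:)
    also have "\<dots> = (\<Sum>i\<in>{1..<j}. ?g i j) + (\<Sum>i\<in>{j} \<union> {j<..n}. ?g i j)"
      by (rule sum.union_disjoint) auto
    also have "(\<Sum>i\<in>{j} \<union> {j<..n}. ?g i j) = (\<Sum>i\<in>{j}. ?g i j) + (\<Sum>i\<in>{j<..n}. ?g i j)"
      by (rule sum.union_disjoint) auto
    finally show ?thesis
      by (simp add: perm_act_id)
  qed
  then have "(\<Sum>j\<in>{1..n}. \<Sum>i\<in>{1..n}. ?g i j) =
     (\<Sum>j\<in>{1..n}. \<Sum>i\<in>{1..<j}. ?g i j) + (\<Sum>j\<in>{1..n}. \<Sum>i\<in>{j<..n}. ?g i j)"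
    by (simp add: sum.distrib)
  also have "(\<Sum>j\<in>{1..n}. \<Sum>i\<in>{j<..n}. ?g i j) = (\<Sum>i\<in>{1..n}. \<Sum>j\<in>{1..<i}. ?g i j)"
    by (subst sum.Sigma, simp, simp, subst sum.Sigma, simp, simp,
      rule sum.reindex_bij_witness[of _ prod.swap prod.swap], auto)
  also have "\<dots> = (\<Sum>j\<in>{1..n}. \<Sum>i\<in>{1..<j}. ?g i j)"
    using weights_on_sym[OF assms] by (intro sum.cong refl) (auto simp: transpose_commute)
  finally have "(\<Sum>j\<in>{1..n}. \<Sum>i\<in>{1..n}. ?g i j) = 2 *\<^sub>R interchange perm_act n c v"
    by (simp add: interchange_def scaleR_2)
  then show ?thesis
    by (simp add: tab.ich_def sum.swap[of "\<lambda>i j. ?g i j"])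
qed

text \<open>Replaces the minimum over a set of eigenvalues by an attained variational bound, the
  form in which \<open>lambda_min\<close> is used from here on.\<close>

lemma lambda_min_props:
  assumes "sum_list \<mu> = n" "weights_on {1..n} c"
  shows "\<exists>w\<in>specht \<mu>. w \<noteq> 0 \<and> tab.ich {1..n} c w = lambda_min n c \<mu> *\<^sub>R w"
    and "u \<in> specht \<mu> \<Longrightarrow> lambda_min n c \<mu> * tab_ip u u \<le> tab_ip (tab.ich {1..n} c u) u"
proof -
  let ?L = "tab.ich {1..n} c"
  have L: "interchange perm_act n c = ?L"
    using interchange_eq_ich[OF assms(2)] by (intro ext)
  have inv: "?L u \<in> specht \<mu>" if "u \<in> specht \<mu>" for u
    using interchange_specht[OF assms(1) that, of c] by (simp add: L)
  obtain S where S: "finite S" "specht \<mu> \<subseteq> span S"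
    using specht_finite_span by blast
  obtain l w where lw: "w \<in> specht \<mu>" "w \<noteq> 0" "?L w = l *\<^sub>R w"
    and min: "\<And>u. u \<in> specht \<mu> \<Longrightarrow> tab_ip (?L u) u \<ge> l * tab_ip u u"
    by (rule tab.rayleigh_min[OF tab.linear_ich subspace_specht S specht_nonzero inv]) (auto simp: tab.ich_symmetric)
  have "l = lambda_min n c \<mu>"
    unfolding lambda_min_def L
  proof (rule Min_eqI[symmetric])
    show "finite (eigenvalues_on ?L (specht \<mu>))"
      by (rule tab.eigenvalues_finite[OF subspace_specht S]) (auto simp: tab.ich_symmetric)
    show "l \<in> eigenvalues_on ?L (specht \<mu>)"
      using lw by (auto simp: eigenvalues_on_def eigenspace_on_def)
    fix m assume "m \<in> eigenvalues_on ?L (specht \<mu>)"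
    then obtain u where u: "u \<in> specht \<mu>" "?L u = m *\<^sub>R u" "u \<noteq> 0"
      by (auto simp: eigenvalues_on_def eigenspace_on_def)
    then show "l \<le> m"
      using min[OF u(1)] tab.ip_pos[OF u(3)] by (simp add: tab.ip_simps)
  qed
  then show "\<exists>w\<in>specht \<mu>. w \<noteq> 0 \<and> ?L w = lambda_min n c \<mu> *\<^sub>R w"
    and "u \<in> specht \<mu> \<Longrightarrow> lambda_min n c \<mu> * tab_ip u u \<le> tab_ip (?L u) u"
    using lw min by blast+
qed

lemma total_specht:
  assumes "sum_list \<mu> = n" "v \<in> specht \<mu>" "Y \<subseteq> {1..n}"
  shows "tab.total Y v \<in> specht \<mu>"
  unfolding tab.gsum_def
proof (rule subspace_sum[OF subspace_specht])
  fix s assume "s \<in> {s. s permutes Y \<and> True}"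
  then have "s permutes {1..sum_list \<mu>}"
    using assms(1,3) permutes_subset by blast
  then show "perm_act s v \<in> specht \<mu>"
    using assms(2) by (rule perm_act_specht)
qed

lemma first_column_cell: "\<mu> \<turnstile> n \<Longrightarrow> i < length \<mu> \<Longrightarrow> (i, 0) \<in> young_diagram \<mu>"
  unfolding is_partition_def young_diagram_def by (metis (mono_tags, lifting) case_prodI gr0I mem_Collect_eq nth_mem)

lemma partition_short:
  assumes "\<mu> \<turnstile> n" "length \<mu> < 3" "n > 0"
  shows "\<mu> = [n] \<or> \<mu> = [n - 1, 1] \<or> (\<exists>a b. \<mu> = [a, b] \<and> a \<ge> b \<and> b \<ge> 2 \<and> a + b = n)"
proof -
  consider "\<mu> = []" | a where "\<mu> = [a]" | a b where "\<mu> = [a, b]"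
    using assms(2) by (cases \<mu>; cases "tl \<mu>"; cases "tl (tl \<mu>)") auto
  then show ?thesis
    using assms(1,3) by cases (auto simp: is_partition_def)
qed

lemma total_specht_zero:
  assumes "\<mu> \<turnstile> n" "\<mu> \<noteq> [n]" "n > 0" "v \<in> specht \<mu>"
  shows "tab.total {1..n} v = 0"
proof (rule specht_fixed_zero)
  have n: "sum_list \<mu> = n"
    using assms(1) by (simp add: is_partition_def)
  show "tab.total {1..n} v \<in> specht \<mu>"
    using total_specht[OF n assms(4)] by simp
  fix t assume t: "is_tableau \<mu> t"
  have "length \<mu> \<ge> 2"
    using partition_short[OF assms(1) _ assms(3)] assms(2) by (cases "length \<mu> < 3") auto
  then have c: "(0, 0) \<in> young_diagram \<mu>" "(1, 0) \<in> young_diagram \<mu>"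
    by (auto intro: first_column_cell[OF assms(1)])
  have "perm_act (swp (t (0, 0)) (t (1, 0))) (tab.total {1..n} v) = tab.total {1..n} v"
    using tableau_in[OF t] c n by (intro tab.rho_total permutes_swap_id) auto
  then show "\<exists>i i' j. (i, j) \<in> young_diagram \<mu> \<and> (i', j) \<in> young_diagram \<mu> \<and> i \<noteq> i' \<and>
      perm_act (swp (t (i, j)) (t (i', j))) (tab.total {1..n} v) = tab.total {1..n} v"
    using c zero_neq_one by blast
qed

text \<open>The excluded point \<open>x\<close> occupies one cell. The shapes left have either three
  rows or two columns of height two, so some column contains two entries different from
  \<open>x\<close>, and these may be exchanged.\<close>

lemma total_remove_specht_zero:
  assumes "\<mu> \<turnstile> n" "\<mu> \<noteq> [n]" "\<mu> \<noteq> [n - 1, 1]" "n > 0" "v \<in> specht \<mu>"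
  shows "tab.total ({1..n} - {x}) v = 0"
proof (rule specht_fixed_zero)
  have n: "sum_list \<mu> = n"
    using assms(1) by (simp add: is_partition_def)
  show "tab.total ({1..n} - {x}) v \<in> specht \<mu>"
    using total_specht[OF n assms(5)] by simp
  fix t assume t: "is_tableau \<mu> t"
  have "\<exists>i i' j. (i, j) \<in> young_diagram \<mu> \<and> (i', j) \<in> young_diagram \<mu> \<and> i \<noteq> i' \<and> t (i, j) \<noteq> x \<and> t (i', j) \<noteq> x"
  proof (cases "length \<mu> < 3")
    case True
    then obtain a b where ab: "\<mu> = [a, b]" "a \<ge> b" "b \<ge> 2"
      using partition_short[OF assms(1) True assms(4)] assms(2,3) by blast
    then have c: "(0, 0) \<in> young_diagram \<mu>" "(1, 0) \<in> young_diagram \<mu>" "(0, 1) \<in> young_diagram \<mu>" "(1, 1) \<in> young_diagram \<mu>"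
      by (auto simp: young_diagram_def)
    show ?thesis
    proof (cases "t (0, 0) = x \<or> t (1, 0) = x")
      case True
      then have "t (0, 1) \<noteq> x \<and> t (1, 1) \<noteq> x"
        using tableau_inj[OF t c(3)] tableau_inj[OF t c(4)] c by force
      then show ?thesis using c zero_neq_one by blast
    qed (use c zero_neq_one in blast)
  next
    case False
    then have c: "(0, 0) \<in> young_diagram \<mu>" "(1, 0) \<in> young_diagram \<mu>" "(2, 0) \<in> young_diagram \<mu>"
      by (auto intro: first_column_cell[OF assms(1)])
    have "t (0, 0) \<noteq> t (1, 0)" "t (0, 0) \<noteq> t (2, 0)" "t (1, 0) \<noteq> t (2, 0)"
      using tableau_inj[OF t c(1,2)] tableau_inj[OF t c(1,3)] tableau_inj[OF t c(2,3)] by auto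
    moreover have "(0::nat) \<noteq> 1" "(0::nat) \<noteq> 2" "(1::nat) \<noteq> 2"
      by auto
    ultimately show ?thesis
      using c by metis
  qed
  then obtain i i' j where c: "(i, j) \<in> young_diagram \<mu>" "(i', j) \<in> young_diagram \<mu>" "i \<noteq> i'" "t (i, j) \<noteq> x" "t (i', j) \<noteq> x"
    by blast
  then have "perm_act (swp (t (i, j)) (t (i', j))) (tab.total ({1..n} - {x}) v) = tab.total ({1..n} - {x}) v"
    using tableau_in[OF t] n by (intro tab.rho_total permutes_swap_id) auto
  then show "\<exists>i i' j. (i, j) \<in> young_diagram \<mu> \<and> (i', j) \<in> young_diagram \<mu> \<and> i \<noteq> i' \<and>
      perm_act (swp (t (i, j)) (t (i', j))) (tab.total ({1..n} - {x}) v) = tab.total ({1..n} - {x}) v"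
    using c by blast
qed

text \<open>The vector is fixed by transpositions inside the pair and inside its complement. Among
  three entries of the first column, two lie in the same one of these blocks.\<close>

lemma total_pair_specht_zero:
  assumes "\<mu> \<turnstile> n" "length \<mu> \<ge> 3" "v \<in> specht \<mu>" "p \<in> {1..n}" "q \<in> {1..n}"
  shows "tab.total ({1..n} - {p, q}) (v + perm_act (swp p q) v) = 0"
    (is "tab.total ?Y ?v = 0")
proof (rule specht_fixed_zero)
  have n: "sum_list \<mu> = n"
    using assms(1) by (simp add: is_partition_def)
  have "?v \<in> specht \<mu>"
    using assms n by (intro subspace_add[OF subspace_specht] perm_act_specht permutes_swap_id) auto
  then show "tab.total ?Y ?v \<in> specht \<mu>"
    using total_specht[OF n] by simp
  fix t assume t: "is_tableau \<mu> t"
  have pq: "perm_act (swp p q) (tab.total ?Y ?v) = tab.total ?Y ?v"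
    by (simp add: tab.rho_total_disjoint linear_add[OF linear_perm_act] add.commute perm_act_comp[symmetric] perm_act_id)
  have Y: "perm_act (swp a b) (tab.total ?Y ?v) = tab.total ?Y ?v" if "a \<in> ?Y" "b \<in> ?Y" for a b
    using that by (intro tab.rho_total permutes_swap_id)
  have good: "perm_act (swp a b) (tab.total ?Y ?v) = tab.total ?Y ?v"
    if "a \<in> {1..n}" "b \<in> {1..n}" "a \<in> {p, q} \<longleftrightarrow> b \<in> {p, q}" "a \<noteq> b" for a b
  proof (cases "a \<in> {p, q}")
    case True
    then have "swp a b = swp p q"
      using that by (auto simp: transpose_commute)
    then show ?thesis using pq by simp
  qed (use that Y in blast)
  have c: "(0, 0) \<in> young_diagram \<mu>" "(1, 0) \<in> young_diagram \<mu>" "(2, 0) \<in> young_diagram \<mu>"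
    using assms(2) by (auto intro: first_column_cell[OF assms(1)])
  have d: "t (0, 0) \<noteq> t (1, 0)" "t (0, 0) \<noteq> t (2, 0)" "t (1, 0) \<noteq> t (2, 0)"
    using tableau_inj[OF t c(1,2)] tableau_inj[OF t c(1,3)] tableau_inj[OF t c(2,3)] by auto
  have i: "t (0, 0) \<in> {1..n}" "t (1, 0) \<in> {1..n}" "t (2, 0) \<in> {1..n}"
    using tableau_in[OF t] c n by auto
  have "(0::nat) \<noteq> 1" "(0::nat) \<noteq> 2" "(1::nat) \<noteq> 2"
    by auto
  then show "\<exists>i i' j. (i, j) \<in> young_diagram \<mu> \<and> (i', j) \<in> young_diagram \<mu> \<and> i \<noteq> i' \<and>
      perm_act (swp (t (i, j)) (t (i', j))) (tab.total ?Y ?v) = tab.total ?Y ?v"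
    using good[OF i(1,2) _ d(1)] good[OF i(1,3) _ d(2)] good[OF i(2,3) _ d(3)] c by metis
qed

section \<open>The standard representation\<close>

declare One_nat_def [simp del]

definition hook_tabloid :: "nat \<Rightarrow> nat \<Rightarrow> tabloid" where
  "hook_tabloid n y = [{1..n} - {y}, {y}]"

text \<open>A tabloid of shape \<open>[n - 1, 1]\<close> is determined by the entry of its second
  row. Functions on points thus become vectors, and \<open>ich_hook_vec\<close> matches the
  interchange operator with the Laplacian.\<close>

definition hook_vec :: "nat \<Rightarrow> (nat \<Rightarrow> real) \<Rightarrow> (tabloid \<Rightarrow>\<^sub>0 real)" where
  "hook_vec n f = (\<Sum>y\<in>{1..n}. f y *\<^sub>R Poly_Mapping.single (hook_tabloid n y) 1)"

lemma hook_tabloid_eq_iff [simp]: "hook_tabloid n y = hook_tabloid n z \<longleftrightarrow> y = z"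
  by (auto simp: hook_tabloid_def)

lemma lookup_hook_vec: "z \<in> {1..n} \<Longrightarrow> Poly_Mapping.lookup (hook_vec n f) (hook_tabloid n z) = f z"
  by (simp add: hook_vec_def lookup_sum lookup_scaleR lookup_single when_def if_distrib cong: if_cong)

lemma hook_vec_cong: "(\<And>y. y \<in> {1..n} \<Longrightarrow> f y = g y) \<Longrightarrow> hook_vec n f = hook_vec n g"
  by (simp add: hook_vec_def)

lemma hook_vec_add: "hook_vec n (\<lambda>y. f y + g y) = hook_vec n f + hook_vec n g"
  by (simp add: hook_vec_def scaleR_add_left sum.distrib)

lemma hook_vec_diff: "hook_vec n (\<lambda>y. f y - g y) = hook_vec n f - hook_vec n g"
  by (simp add: hook_vec_def scaleR_diff_left sum_subtractf)

lemma hook_vec_scale: "hook_vec n (\<lambda>y. r * f y) = r *\<^sub>R hook_vec n f"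
  by (simp add: hook_vec_def scaleR_sum_right)

lemma hook_vec_sum: "hook_vec n (\<lambda>y. \<Sum>i\<in>A. f i y) = (\<Sum>i\<in>A. hook_vec n (f i))"
  by (simp add: hook_vec_def scaleR_sum_left sum.swap[of _ A])

lemma hook_vec_delta:
  assumes "a \<in> {1..n}"
  shows "hook_vec n (\<lambda>y. of_bool (y = a)) = Poly_Mapping.single (hook_tabloid n a) 1"
proof -
  have "hook_vec n (\<lambda>y. of_bool (y = a)) = (\<Sum>y\<in>{1..n}. if y = a then Poly_Mapping.single (hook_tabloid n a) 1 else 0)"
    unfolding hook_vec_def by (intro sum.cong) auto
  then show ?thesis
    using assms by simp
qed

lemma tab_ip_single: "tab_ip (Poly_Mapping.single S 1) (Poly_Mapping.single T 1) = of_bool (S = T)"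
  by (auto simp: tab_ip_def lookup_single)

lemma tab_ip_hook_vec: "tab_ip (hook_vec n f) (hook_vec n g) = (\<Sum>y\<in>{1..n}. f y * g y)"
proof -
  have "tab_ip (hook_vec n f) (hook_vec n g) = (\<Sum>y\<in>{1..n}. \<Sum>z\<in>{1..n}. if y = z then f y * g y else 0)"
    by (simp add: hook_vec_def tab.ip_sum_left tab.ip_sum_right tab.ip_simps tab_ip_single of_bool_def if_distrib mult_ac cong: if_cong)
  then show ?thesis by simp
qed

lemma perm_act_hook_tabloid:
  assumes "s permutes {1..n}"
  shows "map ((`) s) (hook_tabloid n y) = hook_tabloid n (s y)"
proof -
  have "s ` ({1..n} - {y}) = s ` {1..n} - s ` {y}"
    using permutes_inj[OF assms] by (rule image_set_diff)
  then show ?thesis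
    using permutes_image[OF assms] by (simp add: hook_tabloid_def)
qed

lemma perm_act_hook_vec:
  assumes "i \<in> {1..n}" "j \<in> {1..n}"
  shows "perm_act (swp i j) (hook_vec n f) = hook_vec n (\<lambda>y. f (swp i j y))"
proof -
  have s: "swp i j permutes {1..n}"
    using assms by (rule permutes_swap_id)
  have "perm_act (swp i j) (hook_vec n f) =
      (\<Sum>y\<in>{1..n}. f y *\<^sub>R Poly_Mapping.single (hook_tabloid n (swp i j y)) 1)"
    by (simp add: hook_vec_def linear_sum[OF linear_perm_act] linear_scale[OF linear_perm_act]
        perm_act_single perm_act_hook_tabloid[OF s])
  also have "\<dots> = hook_vec n (\<lambda>y. f (swp i j y))"
    unfolding hook_vec_def
    by (rule sum.reindex_bij_witness[of _ "swp i j" "swp i j"])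
      (use permutes_in_image[OF s] in auto)
  finally show ?thesis .
qed

lemma ich_hook_vec:
  assumes "weights_on {1..n} c"
  shows "tab.ich {1..n} c (hook_vec n f) = hook_vec n (lap {1..n} c f)"
proof -
  let ?X = "{1..n}"
  have "(\<Sum>i\<in>?X. \<Sum>j\<in>?X. c i j *\<^sub>R (hook_vec n f - perm_act (swp i j) (hook_vec n f))) =
     (\<Sum>i\<in>?X. \<Sum>j\<in>?X. hook_vec n (\<lambda>y. c i j * (f y - f (swp i j y))))"
    by (intro sum.cong refl) (simp only: perm_act_hook_vec hook_vec_diff[symmetric] hook_vec_scale[symmetric])
  also have "\<dots> = hook_vec n (\<lambda>y. \<Sum>i\<in>?X. \<Sum>j\<in>?X. c i j * (f y - f (swp i j y)))"
    by (simp only: hook_vec_sum)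
  also have "\<dots> = hook_vec n (\<lambda>y. 2 * lap ?X c f y)"
    by (intro hook_vec_cong lap_swp[OF _ assms]) auto
  finally show ?thesis
    by (simp add: tab.ich_def hook_vec_scale)
qed

text \<open>Only the first column has two cells, so the column stabilizer consists of the identity
  and one transposition.\<close>

lemma polytabloid_hook:
  assumes n: "n \<ge> 2" and t: "is_tableau [n - 1, 1] t"
  shows "t (0, 0) \<in> {1..n}" "t (1, 0) \<in> {1..n}" "t (0, 0) \<noteq> t (1, 0)"
    "polytabloid [n - 1, 1] t = Poly_Mapping.single (hook_tabloid n (t (1, 0))) 1
      - Poly_Mapping.single (hook_tabloid n (t (0, 0))) 1"
proof -
  let ?\<mu> = "[n - 1, 1]"
  define a where "a = t (1, 0)"
  define b where "b = t (0, 0)"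
  have sum: "sum_list ?\<mu> = n"
    using n by simp
  have YD: "(i, j) \<in> young_diagram ?\<mu> \<longleftrightarrow> i = 0 \<and> j < n - 1 \<or> i = 1 \<and> j = 0" for i j
    by (auto simp: young_diagram_def less_Suc_eq nth_Cons')
  have c: "(0, 0) \<in> young_diagram ?\<mu>" "(1, 0) \<in> young_diagram ?\<mu>"
    using n by (auto simp: YD)
  show ab: "t (0, 0) \<in> {1..n}" "t (1, 0) \<in> {1..n}" "t (0, 0) \<noteq> t (1, 0)"
    using tableau_in[OF t] tableau_inj[OF t c] c sum by auto
  have onto: "t ` young_diagram ?\<mu> = {1..n}"
    using t sum by (simp add: is_tableau_def bij_betw_def)
  have row0: "{t (0, j) | j. j < n - 1} = {1..n} - {a}"
  proof -
    have "t (0, j) \<noteq> a" if "j < n - 1" for j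
      using tableau_inj[OF t _ c(2), of "(0, j)"] that by (auto simp: YD a_def)
    moreover have "t (0, j) \<in> {1..n}" if "j < n - 1" for j
      using tableau_in[OF t, of "(0, j)"] that sum by (simp add: YD)
    moreover have "x \<in> {t (0, j) | j. j < n - 1}" if "x \<in> {1..n} - {a}" for x
    proof -
      have "x \<in> t ` young_diagram ?\<mu>"
        using that onto by auto
      then obtain i j where "(i, j) \<in> young_diagram ?\<mu>" "x = t (i, j)"
        by auto
      then show ?thesis
        using that by (auto simp: YD a_def)
    qed
    ultimately show ?thesis by blast
  qed
  have tabl: "tabloid_of ?\<mu> t = hook_tabloid n a"
    using row0 by (simp add: tabloid_of_def hook_tabloid_def a_def upt_rec One_nat_def)
  have col0: "{t (i, 0) | i. (i, 0) \<in> young_diagram ?\<mu>} = {a, b}"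
    using n by (auto simp: YD a_def b_def)
  have colj: "{t (i, j) | i. (i, j) \<in> young_diagram ?\<mu>} = (if j < n - 1 then {t (0, j)} else {})" if "j \<noteq> 0" for j
    using that by (auto simp: YD)
  have C: "column_stabilizer ?\<mu> t = {id, swp a b}"
  proof (intro equalityI subsetI)
    fix \<pi> assume \<pi>: "\<pi> \<in> column_stabilizer ?\<mu> t"
    then have perm: "\<pi> permutes {1..n}"
      and cols: "\<And>j. \<pi> ` {t (i, j) | i. (i, j) \<in> young_diagram ?\<mu>} = {t (i, j) | i. (i, j) \<in> young_diagram ?\<mu>}"
      using sum by (auto simp: column_stabilizer_def Let_def)
    have \<pi>ab: "\<pi> ` {a, b} = {a, b}"
      using cols[of 0] by (simp only: col0)
    have other: "\<pi> x = x" if "x \<noteq> a" "x \<noteq> b" for x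
    proof (cases "x \<in> {1..n}")
      case True
      then have "x \<in> {t (0, j) | j. j < n - 1}"
        using row0 that by auto
      then obtain j where "j < n - 1" "x = t (0, j)"
        by blast
      moreover from this have "j \<noteq> 0"
        using that by (cases j) (auto simp: b_def)
      ultimately show ?thesis
        using cols[of j] by (simp add: colj)
    qed (simp add: permutes_not_in[OF perm])
    show "\<pi> \<in> {id, swp a b}"
    proof (cases "\<pi> a = a")
      case True
      then have "\<pi> b = b"
        using \<pi>ab ab by (auto simp: a_def b_def)
      then have "\<pi> = id"
        using True other by (metis eq_id_iff)
      then show ?thesis by simp
    next
      case False
      then have "\<pi> a = b" "\<pi> b = a"
        using \<pi>ab by (auto simp: doubleton_eq_iff)
      then have "\<pi> = swp a b"
        using other by (auto simp: fun_eq_iff Transposition.transpose_def)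
      then show ?thesis by simp
    qed
  next
    fix \<pi> assume \<pi>: "\<pi> \<in> {id, swp a b}"
    have "swp a b ` {t (i, j) | i. (i, j) \<in> young_diagram ?\<mu>} = {t (i, j) | i. (i, j) \<in> young_diagram ?\<mu>}" for j
    proof (cases "j = 0")
      case True
      then show ?thesis
        unfolding True col0 by (simp add: insert_commute)
    next
      case False
      have "t (0, j) \<noteq> a" "t (0, j) \<noteq> b" if "j < n - 1"
        using tableau_inj[OF t _ c(2), of "(0, j)"] tableau_inj[OF t _ c(1), of "(0, j)"] that False
        by (auto simp: YD a_def b_def)
      then show ?thesis
        by (simp add: colj[OF False])
    qed
    moreover have "swp a b permutes {1..n}"
      using ab by (intro permutes_swap_id) (auto simp: a_def b_def)
    ultimately have "swp a b \<in> column_stabilizer ?\<mu> t"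
      unfolding column_stabilizer_def Let_def sum by blast
    moreover have "id \<in> column_stabilizer ?\<mu> t"
      by (simp add: column_stabilizer_def permutes_id)
    ultimately show "\<pi> \<in> column_stabilizer ?\<mu> t"
      using \<pi> by blast
  qed
  have ne: "a \<noteq> b"
    using ab by (simp add: a_def b_def)
  then have "id \<noteq> swp a b"
    by (metis id_apply transpose_apply_first)
  moreover have "swp a b permutes {1..n}"
    using ab by (intro permutes_swap_id) (auto simp: a_def b_def)
  ultimately show "polytabloid ?\<mu> t = Poly_Mapping.single (hook_tabloid n (t (1, 0))) 1
      - Poly_Mapping.single (hook_tabloid n (t (0, 0))) 1"
    using ne unfolding polytabloid_def C tabl
    by (simp add: sign_id sign_swap_id perm_act_id perm_act_single perm_act_hook_tabloid a_def[symmetric] b_def[symmetric])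
qed

lemma specht_hook:
  assumes n: "n \<ge> 2"
  shows "specht [n - 1, 1] = {hook_vec n f | f. sum f {1..n} = 0}" (is "_ = ?V")
proof
  let ?S = "\<lambda>a. Poly_Mapping.single (hook_tabloid n a) 1 :: tabloid \<Rightarrow>\<^sub>0 real"
  have gen: "?S a - ?S b \<in> ?V" if "a \<in> {1..n}" "b \<in> {1..n}" for a b
  proof -
    have "?S a - ?S b = hook_vec n (\<lambda>y. of_bool (y = a) - of_bool (y = b))"
      using that by (simp add: hook_vec_diff hook_vec_delta)
    moreover have "(\<Sum>y\<in>{1..n}. of_bool (y = a) - of_bool (y = b) :: real) = 0"
      using that by (simp add: sum_subtractf of_bool_def)
    ultimately show ?thesis by blast
  qed
  have "subspace ?V"
  proof (rule subspaceI)
    show "0 \<in> ?V"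
      by (rule CollectI, rule exI[of _ "\<lambda>_. 0"]) (simp add: hook_vec_def)
    show "u + v \<in> ?V" if uv: "u \<in> ?V" "v \<in> ?V" for u v
    proof -
      obtain f g where "u = hook_vec n f" "v = hook_vec n g" "sum f {1..n} = 0" "sum g {1..n} = 0"
        using uv by blast
      then show ?thesis
        by (intro CollectI exI[of _ "\<lambda>y. f y + g y"]) (simp add: hook_vec_add sum.distrib)
    qed
    show "r *\<^sub>R u \<in> ?V" if u: "u \<in> ?V" for r u
    proof -
      obtain f where "u = hook_vec n f" "sum f {1..n} = 0"
        using u by blast
      then show ?thesis
        by (intro CollectI exI[of _ "\<lambda>y. r * f y"]) (simp add: hook_vec_scale sum_distrib_left[symmetric])
    qed
  qed
  then show "specht [n - 1, 1] \<subseteq> ?V"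
    unfolding specht_def using polytabloid_hook[OF n] gen by (intro span_minimal) auto
  show "?V \<subseteq> specht [n - 1, 1]"
  proof
    fix v assume "v \<in> ?V"
    then obtain f where f: "v = hook_vec n f" "sum f {1..n} = 0"
      by blast
    obtain t where t: "is_tableau [n - 1, 1] t"
      using tableau_exists by blast
    define a where "a = t (1, 0)"
    define b where "b = t (0, 0)"
    note p = polytabloid_hook[OF n t, folded a_def b_def]
    have base: "?S a - ?S b \<in> specht [n - 1, 1]"
      unfolding p(4)[symmetric] specht_def using t by (intro span_base) blast
    \<comment> \<open>The transposition of \<open>a\<close> and \<open>y\<close> fixes
      \<open>b\<close> and carries the known difference to the one wanted.\<close>
    have all: "?S y - ?S b \<in> specht [n - 1, 1]" if y: "y \<in> {1..n}" for y
    proof (cases "y = b")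
      case False
      have s: "swp a y permutes {1..n}"
        using p(2) y by (rule permutes_swap_id)
      have "perm_act (swp a y) (?S a - ?S b) = ?S y - ?S b"
        using False p(3) by (simp add: linear_diff[OF linear_perm_act] perm_act_single perm_act_hook_tabloid[OF s])
      then show ?thesis
        using perm_act_specht[OF _ base, of "swp a y"] s n by simp
    qed (simp add: subspace_0[OF subspace_specht])
    have "v = (\<Sum>y\<in>{1..n}. f y *\<^sub>R (?S y - ?S b))"
      using f by (simp add: hook_vec_def scaleR_diff_right sum_subtractf scaleR_sum_left[symmetric])
    also have "\<dots> \<in> specht [n - 1, 1]"
      by (intro subspace_sum[OF subspace_specht] subspace_scale[OF subspace_specht] all)
    finally show "v \<in> specht [n - 1, 1]" .
  qed
qed

section \<open>Comparison of smallest eigenvalues\<close>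

lemma poincare_lambda_min:
  assumes n: "n \<ge> 2" and w: "weights_on {1..n} c"
  shows "poincare {1..n} c (lambda_min n c [n - 1, 1])"
  unfolding poincare_def
proof (intro allI impI)
  fix f :: "nat \<Rightarrow> real" assume "sum f {1..n} = 0"
  then have "hook_vec n f \<in> specht [n - 1, 1]"
    using specht_hook[OF n] by blast
  then have "lambda_min n c [n - 1, 1] * tab_ip (hook_vec n f) (hook_vec n f)
      \<le> tab_ip (tab.ich {1..n} c (hook_vec n f)) (hook_vec n f)"
    using n by (intro lambda_min_props(2)[OF _ w]) auto
  then show "lambda_min n c [n - 1, 1] * (\<Sum>i\<in>{1..n}. (f i)\<^sup>2) \<le> energy {1..n} c f"
    by (simp add: ich_hook_vec[OF w] tab_ip_hook_vec energy_eq_lap[OF w] power2_eq_square mult.commute)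
qed

lemma weighted_graph_weights: "weighted_graph n c \<Longrightarrow> weights_on {1..n} c"
  by (auto simp: weighted_graph_def weights_on_def)

lemma support_edges_iff:
  assumes "weighted_graph n c"
  shows "{i, j} \<in> support_edges n c \<longleftrightarrow> i \<in> {1..n} \<and> j \<in> {1..n} \<and> i \<noteq> j \<and> c i j > 0"
proof
  assume "{i, j} \<in> support_edges n c"
  then obtain k l where kl: "{i, j} = {k, l}" "1 \<le> k" "k < l" "l \<le> n" "c k l > 0"
    by (auto simp: support_edges_def)
  then have "c k l = c l k"
    using assms by (auto simp: weighted_graph_def)
  then show "i \<in> {1..n} \<and> j \<in> {1..n} \<and> i \<noteq> j \<and> c i j > 0"
    using kl by (auto simp: doubleton_eq_iff)
next
  assume ij: "i \<in> {1..n} \<and> j \<in> {1..n} \<and> i \<noteq> j \<and> c i j > 0"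
  then have "c j i > 0"
    using assms by (auto simp: weighted_graph_def)
  show "{i, j} \<in> support_edges n c"
  proof (cases "i < j")
    case True
    then show ?thesis
      using ij by (auto simp: support_edges_def)
  next
    case False
    then have "1 \<le> j \<and> j < i \<and> i \<le> n"
      using ij by auto
    then have "{j, i} \<in> support_edges n c"
      unfolding support_edges_def using \<open>c j i > 0\<close> by blast
    then show ?thesis
      by (simp add: insert_commute)
  qed
qed

text \<open>An eigenfunction with eigenvalue at most zero has zero energy, hence is constant along
  edges; connectedness and mean zero make it vanish.\<close>

lemma lambda_min_hook_pos:
  assumes n: "n \<ge> 2" and wg: "weighted_graph n c" and con: "connected_support n c"
  shows "lambda_min n c [n - 1, 1] > 0"
proof (rule ccontr)
  let ?l = "lambda_min n c [n - 1, 1]" and ?X = "{1..n}"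
  assume neg: "\<not> ?l > 0"
  note w = weighted_graph_weights[OF wg]
  obtain v where v: "v \<in> specht [n - 1, 1]" "v \<noteq> 0" "tab.ich ?X c v = ?l *\<^sub>R v"
    using lambda_min_props(1)[OF _ w, of "[n - 1, 1]"] n by auto
  obtain f where f: "v = hook_vec n f" "sum f ?X = 0"
    using v(1) specht_hook[OF n] by blast
  have "energy ?X c f = tab_ip (tab.ich ?X c v) v"
    by (simp add: f(1) ich_hook_vec[OF w] tab_ip_hook_vec energy_eq_lap[OF w] mult.commute)
  also have "\<dots> \<le> 0"
    using neg tab.ip_ge_0[of v] by (simp add: v(3) tab.ip_simps mult_nonpos_nonneg)
  finally have "(\<Sum>i\<in>?X. \<Sum>j\<in>?X. c i j * (f i - f j)\<^sup>2) = 0"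
    using energy_nonneg[OF w, of f] by (simp add: energy_def)
  moreover have nn: "0 \<le> c i j * (f i - f j)\<^sup>2" if "i \<in> ?X" "j \<in> ?X" for i j
    using that weights_on_nonneg[OF w] by simp
  ultimately have "\<forall>i\<in>?X. (\<Sum>j\<in>?X. c i j * (f i - f j)\<^sup>2) = 0"
    by (subst (asm) sum_nonneg_eq_0_iff) (auto intro!: sum_nonneg)
  then have zero: "c i j * (f i - f j)\<^sup>2 = 0" if "i \<in> ?X" "j \<in> ?X" for i j
    using that nn sum_nonneg_eq_0_iff[of ?X "\<lambda>j. c i j * (f i - f j)\<^sup>2"] by auto
  have edge: "f i = f j" if "{i, j} \<in> support_edges n c" for i j
    using that zero[of i j] by (auto simp: support_edges_iff[OF wg])
  have const: "f i = f j" if "(i, j) \<in> {(u, v). {u, v} \<in> support_edges n c}\<^sup>*" for i j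
    using that by (induction rule: rtrancl_induct) (auto dest: edge)
  have f1: "f i = f 1" if "i \<in> ?X" for i
    using con const that n unfolding connected_support_def by auto
  have "sum f ?X = (\<Sum>i\<in>?X. f 1)"
    by (rule sum.cong[OF refl]) (rule f1)
  then have "f 1 = 0"
    using f(2) n by simp
  then have "f i = 0" if "i \<in> ?X" for i
    using f1[OF that] by simp
  then have "v = 0"
    by (simp add: f(1) hook_vec_def)
  then show False
    using v(2) by simp
qed

text \<open>Otherwise \<open>interchange_gap\<close> forces the two eigenvalues to agree, and
  \<open>interchange_gap_strict\<close> kills the eigenvector. The premise \<open>sq\<close> asks
  for three rows only on the exceptional square, so both parts of the final theorem are
  instances.\<close>

theorem lambda_min_hook_less:
  assumes n: "n \<ge> 3" and wg: "weighted_graph n c" and con: "connected_support n c"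
    and \<mu>: "\<mu> \<turnstile> n" "\<mu> \<noteq> [n]" "\<mu> \<noteq> [n - 1, 1]"
    and sq: "square_graph {1..n} c (lambda_min n c [n - 1, 1] / 2) \<Longrightarrow> length \<mu> \<ge> 3"
  shows "lambda_min n c [n - 1, 1] < lambda_min n c \<mu>"
proof (rule ccontr)
  let ?l = "lambda_min n c [n - 1, 1]" and ?X = "{1..n}"
  assume le: "\<not> ?l < lambda_min n c \<mu>"
  note w = weighted_graph_weights[OF wg]
  have sum: "sum_list \<mu> = n"
    using \<mu>(1) by (simp add: is_partition_def)
  obtain v where v: "v \<in> specht \<mu>" "v \<noteq> 0" "tab.ich ?X c v = lambda_min n c \<mu> *\<^sub>R v"
    using lambda_min_props(1)[OF sum w] by blast
  have pc: "poincare ?X c ?l"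
    using n by (intro poincare_lambda_min w) auto
  have "?l * tab_ip v v \<le> tab_ip (tab.ich ?X c v) v"
    using n by (intro tab.interchange_gap w pc total_specht_zero[OF \<mu>(1,2) _ v(1)]) auto
  then have eq: "lambda_min n c \<mu> = ?l"
    using le tab.ip_pos[OF v(2)] by (simp add: v(3) tab.ip_simps)
  have "v = 0"
  proof (rule tab.interchange_gap_strict[OF _ _ w pc])
    show "0 < ?l"
      using n by (intro lambda_min_hook_pos wg con) auto
    show "tab.ich ?X c v = ?l *\<^sub>R v"
      using v(3) eq by simp
    show "tab.total (?X - {x}) v = 0" for x
      using n by (intro total_remove_specht_zero[OF \<mu> _ v(1)]) auto
    show "tab.total (?X - {p, q}) (v + perm_act (swp p q) v) = 0"
      if "square_graph ?X c (?l / 2)" "p \<in> ?X" "q \<in> ?X" for p q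
      using total_pair_specht_zero[OF \<mu>(1) sq[OF that(1)] v(1) that(2,3)] .
  qed (use n in auto)
  then show False
    using v(2) by simp
qed

section \<open>The uniform four-cycle\<close>

lemma uniform_cycle_imp_square:
  assumes "weighted_graph 4 c" "uniform_cycle 4 c"
  shows "\<exists>w>0. square_graph {1..4} c w"
proof -
  obtain vs w where vs: "distinct vs" "set vs = {1..4}"
      "support_edges 4 c = {{vs ! k, vs ! (Suc k mod 4)} | k. k < 4}"
    and w: "w > 0" "\<forall>i\<in>{1..4}. \<forall>j\<in>{1..4}. {i, j} \<in> support_edges 4 c \<longrightarrow> c i j = w"
    using assms(2) unfolding uniform_cycle_def by auto
  have "length vs = 4"
    using vs(1,2) distinct_card by fastforce
  then obtain x y z v where xs: "vs = [x, y, z, v]"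
    by (auto simp: length_Suc_conv numeral_eq_Suc)
  have E: "support_edges 4 c = {{x, y}, {y, z}, {z, v}, {v, x}}"
  proof -
    have "{k :: nat. k < 4} = {0, 1, 2, 3}"
      by auto
    then have "{{vs ! k, vs ! (Suc k mod 4)} | k. k < 4} = (\<lambda>k. {vs ! k, vs ! (Suc k mod 4)}) ` {0, 1, 2, 3}"
      by blast
    then show ?thesis
      unfolding vs(3) by (simp add: xs)
  qed
  have X: "{x, y, z, v} = {1..4}" "distinct [x, y, z, v]"
    using vs xs by auto
  then have mem: "x \<in> {1..4}" "y \<in> {1..4}" "z \<in> {1..4}" "v \<in> {1..4}"
    by blast+
  have "c x y = w" "c y z = w" "c z v = w" "c v x = w"
    using w(2) mem E by auto
  moreover have "c x z = 0" "c y v = 0"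
  proof -
    have "{x, z} \<notin> support_edges 4 c" "{y, v} \<notin> support_edges 4 c"
      unfolding E using X(2) by (auto simp: doubleton_eq_iff)
    then show "c x z = 0" "c y v = 0"
      using support_edges_iff[OF assms(1), of x z] support_edges_iff[OF assms(1), of y v] mem X(2)
        weights_on_nonneg[OF weighted_graph_weights[OF assms(1)]] by force+
  qed
  ultimately show ?thesis
    unfolding square_graph_def using X w(1) by metis
qed

lemma square_imp_uniform_cycle:
  assumes "weighted_graph 4 c" "square_graph {1..4} c w" "w > 0"
  shows "uniform_cycle 4 c"
proof -
  obtain x y z v where X: "distinct [x, y, z, v]" "{1..4} = {x, y, z, v}"
    and c: "c x y = w" "c y z = w" "c z v = w" "c v x = w" "c x z = 0" "c y v = 0"
    using assms(2) unfolding square_graph_def by blast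
  note wt = weights_on_sym[OF weighted_graph_weights[OF assms(1)]]
  have mem: "x \<in> {1..4}" "y \<in> {1..4}" "z \<in> {1..4}" "v \<in> {1..4}"
    using X(2) by auto
  have c': "c y x = w" "c z y = w" "c v z = w" "c x v = w" "c z x = 0" "c v y = 0"
    using c wt mem by metis+
  have iff: "{i, j} \<in> support_edges 4 c \<longleftrightarrow> {i, j} \<in> {{x, y}, {y, z}, {z, v}, {v, x}}" for i j
  proof -
    have "{i, j} \<in> support_edges 4 c \<longleftrightarrow> i \<in> {x, y, z, v} \<and> j \<in> {x, y, z, v} \<and> i \<noteq> j \<and> c i j > 0"
      unfolding support_edges_iff[OF assms(1)] X(2) ..
    also have "\<dots> \<longleftrightarrow> {i, j} \<in> {{x, y}, {y, z}, {z, v}, {v, x}}"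
    proof
      assume "i \<in> {x, y, z, v} \<and> j \<in> {x, y, z, v} \<and> i \<noteq> j \<and> c i j > 0"
      then have "i = x \<or> i = y \<or> i = z \<or> i = v" "j = x \<or> j = y \<or> j = z \<or> j = v" "i \<noteq> j" "c i j > 0"
        by auto
      then show "{i, j} \<in> {{x, y}, {y, z}, {z, v}, {v, x}}"
        by (elim disjE; hypsubst; simp add: c c' insert_commute)
    next
      assume "{i, j} \<in> {{x, y}, {y, z}, {z, v}, {v, x}}"
      then consider "i = x \<and> j = y \<or> i = y \<and> j = x" | "i = y \<and> j = z \<or> i = z \<and> j = y"
        | "i = z \<and> j = v \<or> i = v \<and> j = z" | "i = v \<and> j = x \<or> i = x \<and> j = v"
        by (auto simp only: insert_iff empty_iff doubleton_eq_iff)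
      then show "i \<in> {x, y, z, v} \<and> j \<in> {x, y, z, v} \<and> i \<noteq> j \<and> c i j > 0"
        using X(1) assms(3) by cases (elim disjE conjE; hypsubst; simp add: c c')+
    qed
    finally show ?thesis .
  qed
  have "e \<in> support_edges 4 c \<Longrightarrow> \<exists>i j. e = {i, j}" for e
    unfolding support_edges_def by blast
  moreover have "e \<in> {{x, y}, {y, z}, {z, v}, {v, x}} \<Longrightarrow> \<exists>i j. e = {i, j}" for e
    by blast
  ultimately have "e \<in> support_edges 4 c \<longleftrightarrow> e \<in> {{x, y}, {y, z}, {z, v}, {v, x}}" for e
    by (metis iff)
  then have E: "support_edges 4 c = {{x, y}, {y, z}, {z, v}, {v, x}}"
    by (rule set_eqI)
  have "{k :: nat. k < 4} = {0, 1, 2, 3}"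
    by auto
  then have "{{[x, y, z, v] ! k, [x, y, z, v] ! (Suc k mod 4)} | k. k < 4} =
      (\<lambda>k. {[x, y, z, v] ! k, [x, y, z, v] ! (Suc k mod 4)}) ` {0, 1, 2, 3}"
    by blast
  then have "support_edges 4 c = {{[x, y, z, v] ! k, [x, y, z, v] ! (Suc k mod 4)} | k. k < 4}"
    unfolding E by simp
  moreover have "c i j = w" if "{i, j} \<in> support_edges 4 c" for i j
    using that c c' unfolding E by (auto simp: doubleton_eq_iff)
  moreover have "distinct [x, y, z, v]" "set [x, y, z, v] = {1..4}"
    using X by simp_all
  ultimately show ?thesis
    unfolding uniform_cycle_def using assms(3) by blast
qed

lemma dim_span_pair:
  assumes "A \<notin> span {B}" "B \<noteq> (0 :: 'v::real_vector)"
  shows "dim (span {A, B}) = 2"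
proof -
  have "independent {A, B}"
    using assms by (auto simp: independent_insert)
  moreover have "A \<noteq> B"
    using assms(1) by (auto intro: span_base)
  ultimately show ?thesis
    by (simp add: dim_eq_card_independent)
qed

lemma subspace_eigenspace_on:
  assumes "linear A" "subspace V"
  shows "subspace (eigenspace_on A V l)"
  using assms by (auto simp: eigenspace_on_def subspace_def linear_0 linear_add linear_scale scaleR_add_right)

locale square4 =
  fixes c :: "nat \<Rightarrow> nat \<Rightarrow> real" and m :: real and x y z w :: nat
  assumes wt: "weights_on {1..4} c" and m: "m > 0"
    and dist: "distinct [x, y, z, w]" and X: "{1..4} = {x, y, z, w}"
    and c: "c x y = m" "c y z = m" "c z w = m" "c w x = m" "c x z = 0" "c y w = 0"
begin

lemma mem: "x \<in> {1..4}" "y \<in> {1..4}" "z \<in> {1..4}" "w \<in> {1..4}"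
  using X by auto

lemma c': "c y x = m" "c z y = m" "c w z = m" "c x w = m" "c z x = 0" "c w y = 0"
  using c weights_on_sym[OF wt] mem by metis+

lemma sum_X: "(\<Sum>i\<in>{1..4}. f i) = f x + f y + f z + f w" for f :: "nat \<Rightarrow> 'b::comm_monoid_add"
  unfolding X using dist by (simp add: add.assoc)

lemma lap_square:
  "lap {1..4} c f x = m * (2 * f x - f y - f w)" "lap {1..4} c f y = m * (2 * f y - f x - f z)"
  "lap {1..4} c f z = m * (2 * f z - f y - f w)" "lap {1..4} c f w = m * (2 * f w - f x - f z)"
  by (simp_all add: lap_def sum_X c c' algebra_simps)

abbreviation "L \<equiv> interchange perm_act 4 c"

lemma L_eq: "L = tab.ich {1..4} c"
  using interchange_eq_ich[OF wt] by (intro ext)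

lemma L_linear: "linear L"
  by (simp add: L_eq tab.linear_ich)

lemma L_square:
  "L v = m *\<^sub>R ((v - perm_act (swp x y) v) + (v - perm_act (swp y z) v)
     + (v - perm_act (swp z w) v) + (v - perm_act (swp w x) v))"
proof -
  let ?d = "\<lambda>i j. v - perm_act (swp i j) v"
  have d: "?d y x = ?d x y" "?d z y = ?d y z" "?d w z = ?d z w" "?d x w = ?d w x"
    by (simp_all add: transpose_commute)
  have "2 *\<^sub>R L v = (\<Sum>i\<in>{1..4}. \<Sum>j\<in>{1..4}. c i j *\<^sub>R ?d i j)"
    by (simp add: L_eq tab.ich_def)
  also have "\<dots> = 2 *\<^sub>R (m *\<^sub>R (?d x y + ?d y z + ?d z w + ?d w x))"
    unfolding sum_X c c' d scaleR_2 by (simp add: perm_act_id scaleR_add_right add_ac)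
  finally show ?thesis
    by (simp only: scaleR_cancel_left) simp
qed

section \<open>The standard module on the square\<close>

definition "A1 = hook_vec 4 (\<lambda>u. of_bool (u = x) - of_bool (u = z))"
definition "A2 = hook_vec 4 (\<lambda>u. of_bool (u = y) - of_bool (u = w))"

lemma specht31: "specht [3, 1] = {hook_vec 4 f | f. f x + f y + f z + f w = 0}"
  using specht_hook[of 4] by (simp add: sum_X)

lemma A_specht: "A1 \<in> specht [3, 1]" "A2 \<in> specht [3, 1]"
  unfolding specht31 A1_def A2_def
  by (intro CollectI exI conjI, rule refl, use dist in simp)+

lemma L_hook: "L (hook_vec 4 f) = hook_vec 4 (lap {1..4} c f)"
  using ich_hook_vec[of 4] wt by (simp add: L_eq)

lemma hook_vec_eqI: "f x = g x \<Longrightarrow> f y = g y \<Longrightarrow> f z = g z \<Longrightarrow> f w = g w \<Longrightarrow> hook_vec 4 f = hook_vec 4 g"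
  by (rule hook_vec_cong) (use X in auto)

lemma L_A: "L A1 = (2 * m) *\<^sub>R A1" "L A2 = (2 * m) *\<^sub>R A2"
  unfolding A1_def A2_def L_hook hook_vec_scale[symmetric]
  by (rule hook_vec_eqI; use dist in \<open>simp add: lap_square\<close>)+

lemma lookup_A:
  "Poly_Mapping.lookup A1 (hook_tabloid 4 x) = 1" "Poly_Mapping.lookup A2 (hook_tabloid 4 x) = 0"
  "Poly_Mapping.lookup A2 (hook_tabloid 4 y) = 1"
  using dist mem by (simp_all add: A1_def A2_def lookup_hook_vec)

lemma eigenvector31:
  assumes "v \<in> specht [3, 1]" "L v = l *\<^sub>R v" "v \<noteq> 0"
  shows "l \<ge> 2 * m" "l = 2 * m \<Longrightarrow> v \<in> span {A1, A2}"
proof -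
  obtain f where f: "v = hook_vec 4 f" "f x + f y + f z + f w = 0"
    using assms(1) specht31 by blast
  have "hook_vec 4 (lap {1..4} c f) = hook_vec 4 (\<lambda>u. l * f u)"
    using assms(2) f(1) L_hook hook_vec_scale by simp
  then have "lap {1..4} c f u = l * f u" if "u \<in> {1..4}" for u
    using lookup_hook_vec[OF that, of "lap {1..4} c f"] lookup_hook_vec[OF that, of "\<lambda>u. l * f u"] by simp
  note e = this[OF mem(1)] this[OF mem(2)] this[OF mem(3)] this[OF mem(4)]
  note e = e[unfolded lap_square]
  \<comment> \<open>Adding the equations at the opposite vertices \<open>x\<close> and
    \<open>z\<close> isolates the alternating eigenfunction, of eigenvalue
    \<open>4 * m\<close>.\<close>
  have "(l - 4 * m) * (f x + f z) = 0"
    using e(1) e(3) f(2) by algebra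
  have s: "l = 4 * m \<or> f x + f z = 0 \<and> f y + f w = 0"
    using \<open>(l - 4 * m) * (f x + f z) = 0\<close> f(2) by auto
  show "l \<ge> 2 * m"
  proof (rule ccontr)
    assume "\<not> l \<ge> 2 * m"
    then have l: "l < 2 * m" by simp
    then have s': "f z = - f x" "f w = - f y"
      using s m by auto
    have "(l - 2 * m) * f x = 0"
      using e(1) s' by algebra
    moreover have "(l - 2 * m) * f y = 0"
      using e(2) s' by algebra
    ultimately have "f x = 0" "f y = 0" "f z = 0" "f w = 0"
      using l s' by auto
    then have "v = hook_vec 4 (\<lambda>_. 0)"
      unfolding f(1) by (intro hook_vec_eqI)
    then show False
      using assms(3) by (simp add: hook_vec_def)
  qed
  assume "l = 2 * m"
  then have s': "f z = - f x" "f w = - f y"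
    using s m by auto
  have "v = hook_vec 4 (\<lambda>u. f x * (of_bool (u = x) - of_bool (u = z)) + f y * (of_bool (u = y) - of_bool (u = w)))"
    unfolding f(1) using dist s' by (intro hook_vec_eqI) auto
  also have "\<dots> = f x *\<^sub>R A1 + f y *\<^sub>R A2"
    by (simp only: hook_vec_add hook_vec_scale A1_def A2_def)
  finally show "v \<in> span {A1, A2}"
    by (simp add: span_add span_scale span_base)
qed

lemma lambda_min_eqI:
  assumes "sum_list \<mu> = 4" "u \<in> specht \<mu>" "u \<noteq> 0" "L u = k *\<^sub>R u"
    and "\<And>v l. v \<in> specht \<mu> \<Longrightarrow> L v = l *\<^sub>R v \<Longrightarrow> v \<noteq> 0 \<Longrightarrow> l \<ge> k"
  shows "lambda_min 4 c \<mu> = k"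
proof (rule antisym)
  show "lambda_min 4 c \<mu> \<le> k"
    using lambda_min_props(2)[OF assms(1) wt assms(2)] assms(4) tab.ip_pos[OF assms(3)]
    by (simp add: L_eq tab.ip_simps)
  show "k \<le> lambda_min 4 c \<mu>"
    using lambda_min_props(1)[OF assms(1) wt] assms(5) by (auto simp: L_eq)
qed

lemma A_nonzero: "A1 \<noteq> 0" "A2 \<noteq> 0"
  using lookup_A by force+

lemma lambda_min31: "lambda_min 4 c [3, 1] = 2 * m"
  by (rule lambda_min_eqI[OF _ A_specht(1) A_nonzero(1) L_A(1)]) (use eigenvector31 in auto)

lemma lambda_mult31: "lambda_mult 4 c [3, 1] = 2"
proof -
  have "eigenspace_on L (specht [3, 1]) (2 * m) = span {A1, A2}"
  proof
    show "span {A1, A2} \<subseteq> eigenspace_on L (specht [3, 1]) (2 * m)"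
      using A_specht L_A
      by (intro span_minimal subspace_eigenspace_on L_linear subspace_specht) (auto simp: eigenspace_on_def)
    show "eigenspace_on L (specht [3, 1]) (2 * m) \<subseteq> span {A1, A2}"
    proof
      fix v assume "v \<in> eigenspace_on L (specht [3, 1]) (2 * m)"
      then show "v \<in> span {A1, A2}"
        using eigenvector31(2)[of v "2 * m"] by (cases "v = 0") (auto simp: eigenspace_on_def span_zero)
    qed
  qed
  moreover have "A1 \<notin> span {A2}"
  proof
    assume "A1 \<in> span {A2}"
    then obtain k where "A1 = k *\<^sub>R A2"
      by (auto simp: span_singleton)
    then show False
      using lookup_A by (simp add: lookup_scaleR)
  qed
  ultimately show ?thesis
    using dim_span_pair[OF _ A_nonzero(2)] by (simp add: lambda_mult_def eig_mult_def lambda_min31)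
qed

section \<open>The module of shape (2,2) on the square\<close>

definition pairing :: "nat set \<Rightarrow> (tabloid \<Rightarrow>\<^sub>0 real)" where
  "pairing S = Poly_Mapping.single [S, {1..4} - S] 1 + Poly_Mapping.single [{1..4} - S, S] 1"

lemma pairing_compl: "S \<subseteq> {1..4} \<Longrightarrow> pairing ({1..4} - S) = pairing S"
  by (simp add: pairing_def double_diff add.commute)

lemma perm_act_pairing:
  assumes "s permutes {1..4}"
  shows "perm_act s (pairing S) = pairing (s ` S)"
proof -
  have "s ` ({1..4} - S) = {1..4} - s ` S"
    using image_set_diff[OF permutes_inj[OF assms]] permutes_image[OF assms] by metis
  then show ?thesis
    by (simp add: pairing_def linear_add[OF linear_perm_act] perm_act_single)
qed

text \<open>The three ways of splitting four points into pairs: \<open>M1\<close> and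
  \<open>M2\<close> consist of opposite edges of the cycle, \<open>M3\<close> of its diagonals.
  Permutations act on them through the quotient by the Klein four-group.\<close>

definition "M1 = pairing {x, y}"
definition "M2 = pairing {y, z}"
definition "M3 = pairing {x, z}"

lemma compl: "{1..4} - {x, y} = {z, w}" "{1..4} - {y, z} = {x, w}" "{1..4} - {x, z} = {y, w}"
  unfolding X using dist by auto

lemma pairing_cases:
  "pairing {x, y} = M1" "pairing {y, z} = M2" "pairing {x, z} = M3"
  "pairing {z, w} = M1" "pairing {x, w} = M2" "pairing {y, w} = M3"
  using pairing_compl[of "{x, y}"] pairing_compl[of "{y, z}"] pairing_compl[of "{x, z}"] mem
  by (auto simp: M1_def M2_def M3_def compl)

lemma pairing_pair: "a \<in> {1..4} \<Longrightarrow> b \<in> {1..4} \<Longrightarrow> a \<noteq> b \<Longrightarrow> pairing {a, b} \<in> {M1, M2, M3}"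
  unfolding X using pairing_cases by (auto simp: insert_commute)

lemma lookup_M:
  fixes k1 k2 k3 :: real
  defines "v \<equiv> k1 *\<^sub>R M1 + k2 *\<^sub>R M2 + k3 *\<^sub>R M3"
  shows "Poly_Mapping.lookup v [{x, y}, {z, w}] = k1" "Poly_Mapping.lookup v [{y, z}, {x, w}] = k2"
    "Poly_Mapping.lookup v [{x, z}, {y, w}] = k3"
  using dist
  by (simp_all add: v_def M1_def M2_def M3_def pairing_def compl lookup_add lookup_scaleR lookup_single
      when_def doubleton_eq_iff)

text \<open>Exchanging the ends of an edge fixes the pairing containing that edge and swaps the
  other two. So \<open>L\<close> acts as the Laplacian of a path with middle \<open>M3\<close> and
  weights \<open>2 * m\<close>, of spectrum 0, \<open>2 * m\<close>, \<open>6 * m\<close>.\<close>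

lemma L_M: "L M1 = (2 * m) *\<^sub>R (M1 - M3)" "L M2 = (2 * m) *\<^sub>R (M2 - M3)"
  "L M3 = (2 * m) *\<^sub>R (2 *\<^sub>R M3 - M1 - M2)"
proof -
  have s: "perm_act (swp x y) (pairing S) = pairing (swp x y ` S)" "perm_act (swp y z) (pairing S) = pairing (swp y z ` S)"
    "perm_act (swp z w) (pairing S) = pairing (swp z w ` S)" "perm_act (swp w x) (pairing S) = pairing (swp w x ` S)" for S
    by (intro perm_act_pairing permutes_swap_id mem)+
  have p: "pairing {y, x} = M1" "pairing {w, z} = M1" "pairing {z, y} = M2" "pairing {w, x} = M2"
    "pairing {z, x} = M3" "pairing {w, y} = M3"
    using pairing_cases by (simp_all add: insert_commute)
  have t: "swp x y z = z" "swp x y w = w" "swp y z x = x" "swp y z w = w" "swp z w x = x" "swp z w y = y"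
    "swp w x y = y" "swp w x z = z"
    using dist by (auto simp: Transposition.transpose_def)
  have two: "(m * 2) *\<^sub>R u = m *\<^sub>R u + m *\<^sub>R u" for u :: "tabloid \<Rightarrow>\<^sub>0 real"
    by (simp only: mult_2_right scaleR_add_left)
  have four: "(m * 4) *\<^sub>R u = m *\<^sub>R u + m *\<^sub>R u + (m *\<^sub>R u + m *\<^sub>R u)" for u :: "tabloid \<Rightarrow>\<^sub>0 real"
    by (simp add: scaleR_add_left[symmetric])
  show "L M1 = (2 * m) *\<^sub>R (M1 - M3)"
    unfolding L_square unfolding M1_def s by (simp add: t p pairing_cases scaleR_2[symmetric])
  show "L M2 = (2 * m) *\<^sub>R (M2 - M3)"
    unfolding L_square unfolding M2_def s by (simp add: t p pairing_cases scaleR_2[symmetric] algebra_simps)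
  show "L M3 = (2 * m) *\<^sub>R (2 *\<^sub>R M3 - M1 - M2)"
    unfolding L_square unfolding M3_def s by (simp add: t p pairing_cases two four algebra_simps)
qed

text \<open>The column stabilizer is a Klein four-group. Its two even elements give the two orders
  of one pairing, its two odd elements those of another.\<close>

lemma polytabloid22:
  assumes t: "is_tableau [2, 2] t"
  defines "p \<equiv> t (0, 0)" and "q \<equiv> t (1, 0)" and "r \<equiv> t (0, 1)" and "s \<equiv> t (1, 1)"
  shows "distinct [p, q, r, s]" "{1..4} = {p, q, r, s}"
    "polytabloid [2, 2] t = pairing {p, r} - pairing {q, r}"
proof -
  have YD: "young_diagram [2, 2] = {(0, 0), (1, 0), (0, 1), (1, 1)}"
    by (auto simp: young_diagram_def less_Suc_eq nth_Cons' numeral_eq_Suc)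
  have YD': "(i, j) \<in> young_diagram [2, 2] \<longleftrightarrow> (i = 0 \<or> i = 1) \<and> (j = 0 \<or> j = 1)" for i j
    by (auto simp: YD)
  have inj: "inj_on t (young_diagram [2, 2])" and onto: "t ` young_diagram [2, 2] = {1..4}"
    using t by (auto simp: is_tableau_def bij_betw_def)
  show d: "distinct [p, q, r, s]"
    using inj by (auto simp: YD inj_on_def p_def q_def r_def s_def)
  show U: "{1..4} = {p, q, r, s}"
    using onto by (auto simp: YD p_def q_def r_def s_def)
  have sum: "sum_list [2, 2] = (4 :: nat)"
    by simp
  have row: "{t (i, j) | j. j < 2} = {t (i, 0), t (i, 1)}" for i
    by (auto simp: less_Suc_eq numeral_eq_Suc One_nat_def)
  have tabl: "tabloid_of [2, 2] t = [{p, r}, {q, s}]"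
    using row by (simp add: tabloid_of_def p_def q_def r_def s_def upt_rec One_nat_def numeral_eq_Suc)
  have col: "{t (i, j) | i. (i, j) \<in> young_diagram [2, 2]} =
      (if j = 0 then {p, q} else if j = 1 then {r, s} else {})" for j
    by (auto simp: YD' p_def q_def r_def s_def)
  have in4: "p \<in> {1..4}" "q \<in> {1..4}" "r \<in> {1..4}" "s \<in> {1..4}"
    using U by auto
  have perms: "swp p q permutes {1..4}" "swp r s permutes {1..4}"
    using in4 by (intro permutes_swap_id; simp)+
  have C: "column_stabilizer [2, 2] t = {\<pi>. \<pi> permutes {1..4} \<and> \<pi> ` {p, q} = {p, q} \<and> \<pi> ` {r, s} = {r, s}}"
  proof -
    have cols: "(\<forall>j :: nat. \<pi> ` (if j = 0 then {p, q} else if j = 1 then {r, s} else {}) =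
        (if j = 0 then {p, q} else if j = 1 then {r, s} else {})) \<longleftrightarrow> \<pi> ` {p, q} = {p, q} \<and> \<pi> ` {r, s} = {r, s}"
      (is "(\<forall>j. ?P j) \<longleftrightarrow> ?Q") for \<pi>
    proof
      assume "\<forall>j. ?P j"
      then have "?P 0" "?P 1"
        by blast+
      then show ?Q by simp
    qed simp
    show ?thesis
      unfolding column_stabilizer_def Let_def sum col cols ..
  qed
  have C4: "column_stabilizer [2, 2] t = {id, swp p q, swp r s, swp p q \<circ> swp r s}"
  proof (intro equalityI subsetI)
    fix \<pi> assume "\<pi> \<in> column_stabilizer [2, 2] t"
    then have perm: "\<pi> permutes {1..4}" and im: "\<pi> ` {p, q} = {p, q}" "\<pi> ` {r, s} = {r, s}"
      by (auto simp: C)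
    have out: "\<pi> u = u" if "u \<noteq> p" "u \<noteq> q" "u \<noteq> r" "u \<noteq> s" for u
      using permutes_not_in[OF perm, of u] that U by auto
    have "\<pi> p = p \<and> \<pi> q = q \<or> \<pi> p = q \<and> \<pi> q = p" "\<pi> r = r \<and> \<pi> s = s \<or> \<pi> r = s \<and> \<pi> s = r"
      using im by (auto simp: doubleton_eq_iff)
    then consider "\<pi> p = p" "\<pi> q = q" "\<pi> r = r" "\<pi> s = s" | "\<pi> p = q" "\<pi> q = p" "\<pi> r = r" "\<pi> s = s"
      | "\<pi> p = p" "\<pi> q = q" "\<pi> r = s" "\<pi> s = r" | "\<pi> p = q" "\<pi> q = p" "\<pi> r = s" "\<pi> s = r"
      by blast
    then show "\<pi> \<in> {id, swp p q, swp r s, swp p q \<circ> swp r s}"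
    proof cases
      case 1
      then have "\<pi> = id"
        by (intro fun_eq_on_list[of _ _ "[p, q, r, s]"]) (use out d in \<open>auto simp: Transposition.transpose_def\<close>)
      then show ?thesis by simp
    next
      case 2
      then have "\<pi> = swp p q"
        by (intro fun_eq_on_list[of _ _ "[p, q, r, s]"]) (use out d in \<open>auto simp: Transposition.transpose_def\<close>)
      then show ?thesis by simp
    next
      case 3
      then have "\<pi> = swp r s"
        by (intro fun_eq_on_list[of _ _ "[p, q, r, s]"]) (use out d in \<open>auto simp: Transposition.transpose_def\<close>)
      then show ?thesis by simp
    next
      case 4
      then have "\<pi> = swp p q \<circ> swp r s"
        by (intro fun_eq_on_list[of _ _ "[p, q, r, s]"]) (use out d in \<open>auto simp: Transposition.transpose_def\<close>)
      then show ?thesis by simp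
    qed
  next
    fix \<pi> assume "\<pi> \<in> {id, swp p q, swp r s, swp p q \<circ> swp r s}"
    then show "\<pi> \<in> column_stabilizer [2, 2] t"
      using perms permutes_compose[OF perms(2,1)] d unfolding C
      by (auto simp: permutes_id Transposition.transpose_def)
  qed
  have val: "id p = p" "id r = r" "swp p q p = q" "swp p q r = r" "swp r s p = p" "swp r s r = s"
    "(swp p q \<circ> swp r s) p = q" "(swp p q \<circ> swp r s) r = s"
    using d by (auto simp: Transposition.transpose_def)
  have ne: "id \<noteq> swp p q" "id \<noteq> swp r s" "id \<noteq> swp p q \<circ> swp r s" "swp p q \<noteq> swp r s"
    "swp p q \<noteq> swp p q \<circ> swp r s" "swp r s \<noteq> swp p q \<circ> swp r s"
    using val d by (metis distinct_length_2_or_more)+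
  have sg: "sign (swp p q) = - 1" "sign (swp r s) = - 1" "sign (swp p q \<circ> swp r s) = 1"
    using d by (simp_all add: sign_swap_id sign_compose permutation_swap_id)
  have im: "swp p q ` {p, r} = {q, r}" "swp p q ` {q, s} = {p, s}" "swp r s ` {p, r} = {p, s}"
     "swp r s ` {q, s} = {q, r}" "(swp p q \<circ> swp r s) ` {p, r} = {q, s}" "(swp p q \<circ> swp r s) ` {q, s} = {p, r}"
    using d by (auto simp: Transposition.transpose_def)
  have "polytabloid [2, 2] t = Poly_Mapping.single [{p, r}, {q, s}] 1 - Poly_Mapping.single [{q, r}, {p, s}] 1
     - Poly_Mapping.single [{p, s}, {q, r}] 1 + Poly_Mapping.single [{q, s}, {p, r}] 1"
    using ne unfolding polytabloid_def C4 tabl perm_act_single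
    by (simp add: sg im sign_id del: image_insert image_comp o_apply)
  moreover have "{1..4} - {p, r} = {q, s}" "{1..4} - {q, r} = {p, s}"
    unfolding U using d by auto
  ultimately show "polytabloid [2, 2] t = pairing {p, r} - pairing {q, r}"
    by (simp add: pairing_def)
qed

lemma specht22_subset: "specht [2, 2] \<subseteq> {k1 *\<^sub>R M1 + k2 *\<^sub>R M2 + k3 *\<^sub>R M3 | k1 k2 k3. k1 + k2 + k3 = 0}"
  (is "_ \<subseteq> ?V")
proof -
  have diff: "a - b \<in> ?V" if "a \<in> {M1, M2, M3}" "b \<in> {M1, M2, M3}" for a b
  proof -
    have "\<exists>k1 k2 k3. a = k1 *\<^sub>R M1 + k2 *\<^sub>R M2 + k3 *\<^sub>R M3 \<and> k1 + k2 + k3 = 1"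
      if a: "a \<in> {M1, M2, M3}" for a
    proof -
      consider "a = 1 *\<^sub>R M1 + 0 *\<^sub>R M2 + 0 *\<^sub>R M3" | "a = 0 *\<^sub>R M1 + 1 *\<^sub>R M2 + 0 *\<^sub>R M3"
        | "a = 0 *\<^sub>R M1 + 0 *\<^sub>R M2 + 1 *\<^sub>R M3"
        using a by auto
      then show ?thesis
        by cases (metis add_0 add_0_right)+
    qed
    from this[OF that(1)] this[OF that(2)] obtain k1 k2 k3 l1 l2 l3
      where k: "a = k1 *\<^sub>R M1 + k2 *\<^sub>R M2 + k3 *\<^sub>R M3" "k1 + k2 + k3 = 1"
       and l: "b = l1 *\<^sub>R M1 + l2 *\<^sub>R M2 + l3 *\<^sub>R M3" "l1 + l2 + l3 = 1"
      by metis
    have "a - b = (k1 - l1) *\<^sub>R M1 + (k2 - l2) *\<^sub>R M2 + (k3 - l3) *\<^sub>R M3"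
      by (simp add: k l scaleR_diff_left)
    moreover have "(k1 - l1) + (k2 - l2) + (k3 - l3) = 0"
      using k l by simp
    ultimately show ?thesis by blast
  qed
  have "subspace ?V"
  proof (rule subspaceI)
    show "0 \<in> ?V"
      by (intro CollectI exI[of _ 0]) simp
    show "u + v \<in> ?V" if uv: "u \<in> ?V" "v \<in> ?V" for u v
    proof -
      obtain k1 k2 k3 where k: "u = k1 *\<^sub>R M1 + k2 *\<^sub>R M2 + k3 *\<^sub>R M3" "k1 + k2 + k3 = 0"
        using uv(1) by blast
      obtain l1 l2 l3 where l: "v = l1 *\<^sub>R M1 + l2 *\<^sub>R M2 + l3 *\<^sub>R M3" "l1 + l2 + l3 = 0"
        using uv(2) by blast
      have "u + v = (k1 + l1) *\<^sub>R M1 + (k2 + l2) *\<^sub>R M2 + (k3 + l3) *\<^sub>R M3"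
        by (simp add: k l scaleR_add_left)
      moreover have "(k1 + l1) + (k2 + l2) + (k3 + l3) = 0"
        using k l by simp
      ultimately show ?thesis by blast
    qed
    show "a *\<^sub>R u \<in> ?V" if u: "u \<in> ?V" for a u
    proof -
      obtain k1 k2 k3 where k: "u = k1 *\<^sub>R M1 + k2 *\<^sub>R M2 + k3 *\<^sub>R M3" "k1 + k2 + k3 = 0"
        using u by blast
      have "a *\<^sub>R u = (a * k1) *\<^sub>R M1 + (a * k2) *\<^sub>R M2 + (a * k3) *\<^sub>R M3"
        by (simp add: k scaleR_add_right)
      moreover have "a * k1 + a * k2 + a * k3 = 0"
        using k by (simp add: distrib_left[symmetric])
      ultimately show ?thesis by blast
    qed
  qed
  moreover have "polytabloid [2, 2] t \<in> ?V" if "is_tableau [2, 2] t" for t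
  proof -
    note p = polytabloid22[OF that]
    have "t (0, 0) \<in> {1..4}" "t (1, 0) \<in> {1..4}" "t (0, 1) \<in> {1..4}"
      unfolding p(2) by auto
    then show ?thesis
      unfolding p(3) using p(1) by (intro diff pairing_pair) auto
  qed
  ultimately show ?thesis
    unfolding specht_def by (intro span_minimal) auto
qed

lemma M12_specht: "M1 - M2 \<in> specht [2, 2]"
proof -
  \<comment> \<open>Rows \<open>x, y\<close> and \<open>z, w\<close>: the polytabloid of this
    tableau is the difference of the two cycle pairings, which is antisymmetric about the middle of
    the path.\<close>
  define t where "t = (\<lambda>p :: nat \<times> nat. if p = (0, 0) then x else if p = (1, 0) then z else if p = (0, 1) then y else w)"
  have YD: "young_diagram [2, 2] = {(0, 0), (1, 0), (0, 1), (1, 1)}"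
    by (auto simp: young_diagram_def less_Suc_eq nth_Cons' numeral_eq_Suc)
  have "is_tableau [2, 2] t"
    unfolding is_tableau_def bij_betw_def YD using dist X by (auto simp: t_def inj_on_def)
  moreover from polytabloid22(3)[OF this] have "polytabloid [2, 2] t = M1 - M2"
    by (simp add: t_def M1_def M2_def insert_commute)
  ultimately show ?thesis
    unfolding specht_def by (metis (mono_tags, lifting) mem_Collect_eq span_base)
qed

lemma M12_nonzero: "M1 - M2 \<noteq> 0"
  using lookup_M(1)[of 1 "-1" 0] by auto

lemma L_M12: "L (M1 - M2) = (2 * m) *\<^sub>R (M1 - M2)"
  by (simp add: linear_diff[OF L_linear] L_M scaleR_diff_right)

lemma eigenvector22:
  assumes "v \<in> specht [2, 2]" "L v = l *\<^sub>R v" "v \<noteq> 0"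
  shows "l \<ge> 2 * m" "l = 2 * m \<Longrightarrow> v \<in> span {M1 - M2}"
proof -
  obtain k1 k2 k3 where k: "v = k1 *\<^sub>R M1 + k2 *\<^sub>R M2 + k3 *\<^sub>R M3" "k1 + k2 + k3 = 0"
    using specht22_subset assms(1) by blast
  have "L v = (2 * m * (k1 - k3)) *\<^sub>R M1 + (2 * m * (k2 - k3)) *\<^sub>R M2 + (2 * m * (2 * k3 - k1 - k2)) *\<^sub>R M3"
    unfolding k(1) by (simp add: linear_add[OF L_linear] linear_scale[OF L_linear] L_M algebra_simps)
  moreover have "L v = (l * k1) *\<^sub>R M1 + (l * k2) *\<^sub>R M2 + (l * k3) *\<^sub>R M3"
    unfolding assms(2) by (simp add: k(1) scaleR_add_right)
  ultimately have e: "2 * m * (k1 - k3) = l * k1" "2 * m * (k2 - k3) = l * k2" "2 * m * (2 * k3 - k1 - k2) = l * k3"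
    using lookup_M by metis+
  \<comment> \<open>With coefficients of sum zero, the equation at the middle \<open>M3\<close> of
    the path involves \<open>k3\<close> alone.\<close>
  have "(l - 6 * m) * k3 = 0"
    using e(3) k(2) by algebra
  then have s: "l = 6 * m \<or> k3 = 0"
    by auto
  show "l \<ge> 2 * m"
  proof (rule ccontr)
    assume l: "\<not> l \<ge> 2 * m"
    then have "k3 = 0"
      using s m by auto
    have "(l - 2 * m) * k1 = 0"
      using e(1) \<open>k3 = 0\<close> by algebra
    moreover have "(l - 2 * m) * k2 = 0"
      using e(2) \<open>k3 = 0\<close> by algebra
    ultimately have "k1 = 0" "k2 = 0"
      using l by auto
    then show False
      using assms(3) \<open>k3 = 0\<close> by (simp add: k(1))
  qed
  assume "l = 2 * m"
  then have "k3 = 0"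
    using s m by auto
  then have "v = k1 *\<^sub>R (M1 - M2)"
    using k by (simp add: scaleR_diff_right eq_neg_iff_add_eq_0[symmetric] minus_equation_iff)
  then show "v \<in> span {M1 - M2}"
    by (simp add: span_scale span_base)
qed

lemma lambda_min22: "lambda_min 4 c [2, 2] = 2 * m"
  by (rule lambda_min_eqI[OF _ M12_specht M12_nonzero L_M12]) (use eigenvector22 in auto)

lemma lambda_mult22: "lambda_mult 4 c [2, 2] = 1"
proof -
  have "eigenspace_on L (specht [2, 2]) (2 * m) = span {M1 - M2}"
  proof
    show "span {M1 - M2} \<subseteq> eigenspace_on L (specht [2, 2]) (2 * m)"
      using M12_specht L_M12
      by (intro span_minimal subspace_eigenspace_on L_linear subspace_specht) (auto simp: eigenspace_on_def)
    show "eigenspace_on L (specht [2, 2]) (2 * m) \<subseteq> span {M1 - M2}"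
    proof
      fix v assume "v \<in> eigenspace_on L (specht [2, 2]) (2 * m)"
      then show "v \<in> span {M1 - M2}"
        using eigenvector22(2)[of v "2 * m"] by (cases "v = 0") (auto simp: eigenspace_on_def span_zero)
    qed
  qed
  moreover have "independent {M1 - M2}"
    using M12_nonzero by simp
  ultimately show ?thesis
    by (simp add: lambda_mult_def eig_mult_def lambda_min22 dim_eq_card_independent)
qed

end

lemma partition4_length:
  assumes "\<mu> \<turnstile> 4" "\<mu> \<notin> {[4], [3, 1], [2, 2]}"
  shows "length \<mu> \<ge> 3"
proof (rule ccontr)
  assume "\<not> ?thesis"
  then have "\<mu> = [4] \<or> \<mu> = [4 - 1, 1] \<or> (\<exists>a b. \<mu> = [a, b] \<and> a \<ge> b \<and> b \<ge> 2 \<and> a + b = 4)"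
    using assms(1) by (intro partition_short) auto
  moreover have "\<mu> = [2, 2]" if "\<mu> = [a, b]" "a \<ge> b" "b \<ge> 2" "a + b = 4" for a b
  proof -
    have "a = 2" "b = 2"
      using that by auto
    then show ?thesis using that by simp
  qed
  ultimately show False
    using assms(2) by auto
qed

theorem theorem2p4:
  fixes n :: nat and c :: "nat \<Rightarrow> nat \<Rightarrow> real"
  assumes "n \<ge> 3"
    and "weighted_graph n c"
    and "connected_support n c"
  shows "(n = 4 \<and> uniform_cycle n c \<longrightarrow>
            lambda_min n c [2, 2] = lambda_min n c [3, 1] \<and>
            lambda_mult n c [2, 2] = 1 \<and>
            lambda_mult n c [3, 1] = 2 \<and>
            (\<forall>\<mu>. \<mu> \<turnstile> 4 \<and> \<mu> \<notin> {[4], [3, 1], [2, 2]} \<longrightarrow>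
               lambda_min n c \<mu> > lambda_min n c [3, 1])) \<and>
         (\<not> (n = 4 \<and> uniform_cycle n c) \<longrightarrow>
            (\<forall>\<mu>. \<mu> \<turnstile> n \<and> \<mu> \<noteq> [n] \<and> \<mu> \<noteq> [n - 1, 1] \<longrightarrow>
               lambda_min n c \<mu> > lambda_min n c [n - 1, 1]))"
proof (intro conjI impI allI)
  assume "n = 4 \<and> uniform_cycle n c"
  then have n: "n = 4" and cyc: "uniform_cycle 4 c"
    by auto
  have wg: "weighted_graph 4 c"
    using assms(2) n by simp
  obtain m where "m > 0" "square_graph {1..4} c m"
    using uniform_cycle_imp_square[OF wg cyc] by blast
  then obtain x y z w where "square4 c m x y z w"
    unfolding square_graph_def square4_def using weighted_graph_weights[OF wg] by blast
  then interpret square4 c m x y z w .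
  show "lambda_min n c [2, 2] = lambda_min n c [3, 1]" "lambda_mult n c [2, 2] = 1" "lambda_mult n c [3, 1] = 2"
    by (simp_all add: n lambda_min22 lambda_min31 lambda_mult22 lambda_mult31)
  fix \<mu> assume \<mu>: "\<mu> \<turnstile> 4 \<and> \<mu> \<notin> {[4], [3, 1], [2, 2]}"
  show "lambda_min n c \<mu> > lambda_min n c [3, 1]"
    using lambda_min_hook_less[OF assms, of \<mu>] \<mu> partition4_length[of \<mu>] by (simp add: n)
next
  fix \<mu> assume nc: "\<not> (n = 4 \<and> uniform_cycle n c)" and \<mu>: "\<mu> \<turnstile> n \<and> \<mu> \<noteq> [n] \<and> \<mu> \<noteq> [n - 1, 1]"
  have "\<not> square_graph {1..n} c (lambda_min n c [n - 1, 1] / 2)"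
  proof
    assume sq: "square_graph {1..n} c (lambda_min n c [n - 1, 1] / 2)"
    then have "n = 4"
      using square_graph_card by fastforce
    \<comment> \<open>Connectedness makes the weight of the square positive, so that its sides
      really are edges of the support graph.\<close>
    moreover have "lambda_min n c [n - 1, 1] / 2 > 0"
      using lambda_min_hook_pos[OF _ assms(2,3)] assms(1) by simp
    ultimately show False
      using square_imp_uniform_cycle[of c] sq nc assms(2) by metis
  qed
  then show "lambda_min n c \<mu> > lambda_min n c [n - 1, 1]"
    using lambda_min_hook_less[OF assms] \<mu> by blast
qed

end
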